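(* For every $\varepsilon>0$, the symmetric state (S2), $\Psi=(1+\gamma)^{-1/2}(\eta_\varepsilon,\eta_\varepsilon)$, is a global minimizer of the energy $G_\varepsilon$ in the energy space $\mathcal{E}$ if $\gamma\in(0,1)$ and a saddle point of the energy if $\gamma\in(1,\infty)$. Moreover, the symmetric state is the only positive solution of the coupled system $$-\varepsilon^2\psi_1''+x^2\psi_1+(\psi_1^2+\gamma\psi_2^2-1)\psi_1=0,\qquad -\varepsilon^2\psi_2''+x^2\psi_2+(\gamma\psi_1^2+\psi_2^2-1)\psi_2=0,\qquad x\in\mathbb{R},$$ if $\gamma\in(0,1)$. The uncoupled states (S1), $\Psi=(\eta_\varepsilon,0)$ and $\Psi=(0,\eta_\varepsilon)$, are saddle points of the energy if $\gamma\in(0,1)$ and the only global minimizers of the energy if $\gamma\in(1,\infty)$.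
   Context: Here $\varepsilon>0$ is a small parameter (the limit $\varepsilon\to0$ is the Thomas–Fermi limit) and $\gamma>0$ is the coupling parameter. $L^{2,1}(\mathbb{R})=\{f\in L^2(\mathbb{R}):|x|f\in L^2(\mathbb{R})\}$ and $\mathcal{E}=H^1(\mathbb{R};\mathbb{R}^2)\cap L^{2,1}(\mathbb{R};\mathbb{R}^2)$. For real-valued $\Psi=(\psi_1,\psi_2)\in\mathcal{E}$, $$G_\varepsilon(\Psi)=\frac12\int_{\mathbb{R}}\Big[\varepsilon^2(\psi_1')^2+\varepsilon^2(\psi_2')^2+(x^2-1)(\psi_1^2+\psi_2^2)+\tfrac12(\psi_1^2+\psi_2^2)^2+(\gamma-1)\psi_1^2\psi_2^2\Big]dx,$$ whose Euler–Lagrange equations are the coupled system in the claim. The function $\eta_\varepsilon\in H^1(\mathbb{R};\mathbb{R})\cap L^{2,1}(\mathbb{R};\mathbb{R})$ is the positive solution of $\varepsilon^2\eta_\varepsilon''+(1-x^2-\eta_\varepsilon^2)\eta_\varepsilon=0$ on $\mathbb{R}$.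
   Formalization: For γ>1 "the only global minimizers" is read up to sign: the energy is even in each component, so (−η_ε,0) and (0,−η_ε) are minimizers too. The claim concerns any positive solution η_ε in the stated space, which exists only for ε<1. *)

theory Defs
  imports "HOL-Analysis.Analysis" "HOL-Library.Function_Algebras"
begin

section \<open>Function spaces on the real line\<close>

text \<open>
  Elements of \<open>L2\<close>, \<open>H1\<close> and \<open>L21\<close> are Borel functions rather than equivalence classes, so
  assertions of uniqueness for elements of these spaces have to be made almost everywhere.
\<close>

definition L2 :: "(real \<Rightarrow> real) set" where
  "L2 = {f. f \<in> borel_measurable lborel \<and> integrable lborel (\<lambda>x. (f x)\<^sup>2)}"

definition L21 :: "(real \<Rightarrow> real) set" where
  "L21 = {f \<in> L2. (\<lambda>x. \<bar>x\<bar> * f x) \<in> L2}"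

text \<open>
  Test functions are \<open>C\<^sup>1\<close> with compact support, as in Brezis' definition of
  one-dimensional Sobolev spaces; \<open>C\<^sup>\<infinity>\<close> test functions give the same weak derivatives.
\<close>

definition test_functions :: "(real \<Rightarrow> real) set" where
  "test_functions = {\<phi>. \<phi> C1_differentiable_on UNIV \<and> compact (closure {x. \<phi> x \<noteq> 0})}"

definition is_weak_deriv :: "(real \<Rightarrow> real) \<Rightarrow> (real \<Rightarrow> real) \<Rightarrow> bool" where
  "is_weak_deriv f g \<longleftrightarrow>
     (\<forall>\<phi>\<in>test_functions. (LINT x|lborel. f x * deriv \<phi> x) = - (LINT x|lborel. g x * \<phi> x))"

definition H1 :: "(real \<Rightarrow> real) set" where
  "H1 = {f \<in> L2. \<exists>g\<in>L2. is_weak_deriv f g}"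

text \<open>For \<open>f \<in> H1\<close> this is determined up to a null set, so integrals of it are well defined.\<close>

definition weak_deriv :: "(real \<Rightarrow> real) \<Rightarrow> real \<Rightarrow> real" where
  "weak_deriv f = (SOME g. g \<in> L2 \<and> is_weak_deriv f g)"

type_synonym state = "(real \<Rightarrow> real) \<times> (real \<Rightarrow> real)"

definition energy_space :: "state set" where
  "energy_space = (H1 \<inter> L21) \<times> (H1 \<inter> L21)"

fun energy_norm :: "state \<Rightarrow> real" where
  "energy_norm (\<psi>1, \<psi>2) = sqrt (LINT x|lborel.
     (weak_deriv \<psi>1 x)\<^sup>2 + (weak_deriv \<psi>2 x)\<^sup>2 + (1 + x\<^sup>2) * ((\<psi>1 x)\<^sup>2 + (\<psi>2 x)\<^sup>2))"

section \<open>The energy and its critical points\<close>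

fun energy :: "real \<Rightarrow> real \<Rightarrow> state \<Rightarrow> real" where
  "energy \<epsilon> \<gamma> (\<psi>1, \<psi>2) = 1 / 2 * (LINT x|lborel.
       \<epsilon>\<^sup>2 * (weak_deriv \<psi>1 x)\<^sup>2 + \<epsilon>\<^sup>2 * (weak_deriv \<psi>2 x)\<^sup>2
     + (x\<^sup>2 - 1) * ((\<psi>1 x)\<^sup>2 + (\<psi>2 x)\<^sup>2)
     + 1 / 2 * ((\<psi>1 x)\<^sup>2 + (\<psi>2 x)\<^sup>2)\<^sup>2
     + (\<gamma> - 1) * (\<psi>1 x)\<^sup>2 * (\<psi>2 x)\<^sup>2)"

definition global_minimizer :: "(state \<Rightarrow> real) \<Rightarrow> state \<Rightarrow> bool" where
  "global_minimizer G \<Psi> \<longleftrightarrow> \<Psi> \<in> energy_space \<and> (\<forall>\<Phi>\<in>energy_space. G \<Psi> \<le> G \<Phi>)"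

text \<open>The Frechet derivative with respect to \<open>energy_norm\<close> exists and vanishes.\<close>

definition critical_point :: "(state \<Rightarrow> real) \<Rightarrow> state \<Rightarrow> bool" where
  "critical_point G \<Psi> \<longleftrightarrow> \<Psi> \<in> energy_space \<and>
     (\<forall>e>0. \<exists>\<delta>>0. \<forall>\<Phi>\<in>energy_space.
        energy_norm \<Phi> < \<delta> \<longrightarrow> \<bar>G (\<Psi> + \<Phi>) - G \<Psi>\<bar> \<le> e * energy_norm \<Phi>)"

definition saddle_point :: "(state \<Rightarrow> real) \<Rightarrow> state \<Rightarrow> bool" where
  "saddle_point G \<Psi> \<longleftrightarrow> critical_point G \<Psi> \<and>
     (\<forall>\<delta>>0. (\<exists>\<Phi>\<in>energy_space. energy_norm \<Phi> < \<delta> \<and> G (\<Psi> + \<Phi>) < G \<Psi>) \<and>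
            (\<exists>\<Phi>\<in>energy_space. energy_norm \<Phi> < \<delta> \<and> G \<Psi> < G (\<Psi> + \<Phi>)))"

section \<open>Positive solutions\<close>

definition twice_differentiable :: "(real \<Rightarrow> real) \<Rightarrow> bool" where
  "twice_differentiable f \<longleftrightarrow>
     (\<forall>x. f differentiable (at x)) \<and> (\<forall>x. deriv f differentiable (at x))"

text \<open>Such an \<open>\<eta>\<close> exists only if \<open>\<epsilon> < 1\<close>, the lowest eigenvalue of \<open>- \<epsilon>\<^sup>2 \<partial>\<^sup>2 + x\<^sup>2\<close> being \<open>\<epsilon>\<close>.\<close>

definition is_ground_state :: "real \<Rightarrow> (real \<Rightarrow> real) \<Rightarrow> bool" where
  "is_ground_state \<epsilon> \<eta> \<longleftrightarrow> \<eta> \<in> H1 \<inter> L21 \<and> twice_differentiable \<eta> \<and> (\<forall>x. \<eta> x > 0) \<and>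
     (\<forall>x. \<epsilon>\<^sup>2 * deriv (deriv \<eta>) x + (1 - x\<^sup>2 - (\<eta> x)\<^sup>2) * \<eta> x = 0)"

fun coupled_solution :: "real \<Rightarrow> real \<Rightarrow> state \<Rightarrow> bool" where
  "coupled_solution \<epsilon> \<gamma> (\<psi>1, \<psi>2) \<longleftrightarrow>
     twice_differentiable \<psi>1 \<and> twice_differentiable \<psi>2 \<and>
     (\<forall>x. - \<epsilon>\<^sup>2 * deriv (deriv \<psi>1) x + x\<^sup>2 * \<psi>1 x
            + ((\<psi>1 x)\<^sup>2 + \<gamma> * (\<psi>2 x)\<^sup>2 - 1) * \<psi>1 x = 0) \<and>
     (\<forall>x. - \<epsilon>\<^sup>2 * deriv (deriv \<psi>2) x + x\<^sup>2 * \<psi>2 x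
            + (\<gamma> * (\<psi>1 x)\<^sup>2 + (\<psi>2 x)\<^sup>2 - 1) * \<psi>2 x = 0)"

fun positive_state :: "state \<Rightarrow> bool" where
  "positive_state (\<psi>1, \<psi>2) \<longleftrightarrow> (\<forall>x. \<psi>1 x > 0 \<and> \<psi>2 x > 0)"

definition symmetric_state :: "real \<Rightarrow> (real \<Rightarrow> real) \<Rightarrow> state" where
  "symmetric_state \<gamma> \<eta> = (\<lambda>x. (1 + \<gamma>) powr (-1/2) * \<eta> x, \<lambda>x. (1 + \<gamma>) powr (-1/2) * \<eta> x)"

fun ae_eq :: "state \<Rightarrow> state \<Rightarrow> bool" where
  "ae_eq (\<psi>1, \<psi>2) (\<phi>1, \<phi>2) \<longleftrightarrow> (AE x in lborel. \<psi>1 x = \<phi>1 x \<and> \<psi>2 x = \<phi>2 x)"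

end

theory Submission
  imports Defs
begin

text \<open>
  Let \<open>p = \<eta>' / \<eta>\<close> and \<open>Q(f) = \<integral> \<epsilon>\<^sup>2 f'\<^sup>2 + (x\<^sup>2 - 1 + \<eta>\<^sup>2) f\<^sup>2\<close>. By Picone's identity
  \<open>Q(f) = \<epsilon>\<^sup>2 \<integral> (f' - p f)\<^sup>2\<close>, so \<open>Q \<ge> 0\<close> and \<open>Q(\<eta>) = 0\<close>, hence \<open>Q(a \<eta> + f) = Q(f)\<close>. The boundary terms
  are avoided by testing with \<open>\<chi> f\<close>, where \<open>\<chi>(x) = (1 - (x/R)\<^sup>2)\<^sup>2\<close> vanishes at \<open>\<plusminus>R\<close>. Since
  \<open>2 G(f, h) = Q(f) + Q(h) + \<integral> P(\<eta>, f, h)\<close> with a quartic polynomial \<open>P\<close>, every claim about minimizers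
  and saddle points reduces to completing squares in \<open>P\<close>.

  For the uniqueness of the positive solution no decay is given. Comparing each \<open>\<psi>\<^sub>i\<close> with
  \<open>e = (1 + \<gamma>)\<^sup>-\<^sup>1\<^sup>/\<^sup>2 \<eta>\<close> by Picone's identity in both directions gives, for \<open>a = \<psi>\<^sub>1\<^sup>2 - e\<^sup>2\<close> and
  \<open>b = \<psi>\<^sub>2\<^sup>2 - e\<^sup>2\<close>, that \<open>\<integral> \<chi>\<^sup>2 (a\<^sup>2 + 2 \<gamma> a b + b\<^sup>2) \<le> \<epsilon>\<^sup>2 \<integral> \<chi>'\<^sup>2 (a + b + 4 e\<^sup>2)\<close>. As \<open>\<chi>'\<^sup>2 \<le> 16 \<chi> / R\<^sup>2\<close>,
  Young's inequality absorbs the terms linear in \<open>a\<close> and \<open>b\<close> into the left-hand side, and what remains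
  is \<open>O(1/R)\<close>.
\<close>

section \<open>Indefinite integrals and weak derivatives\<close>

text \<open>States are Borel functions fixed only up to null sets, and \<open>weak_deriv\<close> is
  a choice made by \<open>SOME\<close>, so no boundary value has a meaning until a locally
  absolutely continuous representative is at hand. \<open>ac_deriv\<close> encodes absolute
  continuity through interval integrals instead of differentiability almost everywhere, because
  integration by parts and uniqueness use exactly that. Putting \<eta>^2 into the form Q turns the
  nonlinear equation of \<eta> into a linear one with a positive solution, which is why Q is
  nonnegative and vanishes at \<eta>. Everything else in the energy is free of derivatives and can
  be minimized at each point separately; P is homogeneous of degree four, so its pointwise
  minimizers are multiples of \<eta>(x) with constant coefficients, exactly where Q costs nothing.
  Near such a multiple, invariance of Q under adding a \<eta> leaves no linear term in Q, so
  criticality needs no explicit Frechet derivative. Positive solutions of the coupled system are not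
  assumed to have finite energy. The energy bounds therefore say nothing about them, and their
  uniqueness is a separate argument on bounded intervals.\<close>

definition ac_deriv :: "(real \<Rightarrow> real) \<Rightarrow> (real \<Rightarrow> real) \<Rightarrow> bool" where
  "ac_deriv F f \<longleftrightarrow> f \<in> borel_measurable borel \<and> (\<forall>a b. set_integrable lborel {a..b} f) \<and>
     (\<forall>a b. a \<le> b \<longrightarrow> (LINT x:{a..b}|lborel. f x) = F b - F a)"

lemma ac_deriv_D:
  assumes "ac_deriv F f"
  shows "f \<in> borel_measurable borel" "set_integrable lborel {a..b} f"
    "a \<le> b \<Longrightarrow> (LINT x:{a..b}|lborel. f x) = F b - F a"
  using assms by (auto simp: ac_deriv_def)

lemma ac_deriv_has_integral:
  assumes "ac_deriv F f" "a \<le> b"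
  shows "(f has_integral (F b - F a)) {a..b}"
  using set_borel_integral_eq_integral[OF ac_deriv_D(2)[OF assms(1)], of a b] ac_deriv_D(3)[OF assms]
  by (metis integrable_integral)

lemma ac_deriv_continuous:
  assumes "ac_deriv F f"
  shows "continuous_on UNIV F"
proof -
  have "continuous_on {a..b} F" for a b
  proof -
    have "continuous_on {a..b} (\<lambda>x. F a + integral {a..x} f)"
      using set_borel_integral_eq_integral(1)[OF ac_deriv_D(2)[OF assms], of a b]
      by (intro continuous_intros indefinite_integral_continuous_1)
    moreover have "F a + integral {a..x} f = F x" if "x \<in> {a..b}" for x
      using ac_deriv_has_integral[OF assms, of a x] that by (auto dest: integral_unique)
    ultimately show ?thesis using continuous_on_cong[of "{a..b}" "{a..b}" "\<lambda>x. F a + integral {a..x} f" F] by simp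
  qed
  then show ?thesis
    by (metis (no_types, opaque_lifting) at_within_Icc_at continuous_at_imp_continuous_on continuous_on_eq_continuous_within
        atLeastAtMost_iff gt_ex lt_ex less_imp_le)
qed

lemma ac_deriv_measurable: "ac_deriv F f \<Longrightarrow> F \<in> borel_measurable borel"
  using ac_deriv_continuous borel_measurable_continuous_onI by blast

lemma set_integrable_continuous_mult:
  fixes f F :: "real \<Rightarrow> real"
  assumes "set_integrable lborel {a..b} f" "continuous_on {a..b} F"
  shows "set_integrable lborel {a..b} (\<lambda>x. F x * f x)"
proof -
  have "bounded (F ` {a..b})"
    using assms(2) by (intro compact_imp_bounded compact_continuous_image) auto
  then obtain M where M: "\<And>x. x \<in> {a..b} \<Longrightarrow> \<bar>F x\<bar> \<le> M"
    by (force simp: bounded_iff)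
  have Fm: "(\<lambda>x. indicator {a..b} x *\<^sub>R F x) \<in> borel_measurable borel"
    using assms(2) by (intro borel_measurable_continuous_on_indicator) auto
  have "integrable lborel (\<lambda>x. M * (indicator {a..b} x *\<^sub>R f x))"
    using assms(1) by (auto simp: set_integrable_def)
  moreover have "(\<lambda>x. (indicator {a..b} x *\<^sub>R F x) * (indicator {a..b} x *\<^sub>R f x)) \<in> borel_measurable lborel"
    using Fm borel_measurable_integrable[OF assms(1)[unfolded set_integrable_def]]
    by (intro borel_measurable_times) simp_all
  ultimately have "integrable lborel (\<lambda>x. (indicator {a..b} x *\<^sub>R F x) * (indicator {a..b} x *\<^sub>R f x))"
  proof (rule Bochner_Integration.integrable_bound, intro AE_I2)
    fix x
    show "norm ((indicator {a..b} x *\<^sub>R F x) * (indicator {a..b} x *\<^sub>R f x))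
       \<le> norm (M * (indicator {a..b} x *\<^sub>R f x))"
      using M[of x] by (auto simp: indicator_def abs_mult intro!: mult_right_mono)
  qed
  then show ?thesis unfolding set_integrable_def
    by (rule back_subst[of "integrable lborel"]) (simp add: indicator_def fun_eq_iff)
qed

text \<open>\<open>(F b - F a) (G b - G a)\<close> is the integral of \<open>f(x) g(y)\<close> over a square; split it along the diagonal.\<close>

lemma ac_deriv_mult:
  assumes F: "ac_deriv F f" and G: "ac_deriv G g"
  shows "ac_deriv (\<lambda>x. F x * G x) (\<lambda>x. f x * G x + F x * g x)"
proof -
  note [measurable] = ac_deriv_D(1)[OF F] ac_deriv_D(1)[OF G] ac_deriv_measurable[OF F] ac_deriv_measurable[OF G]
  have cF: "continuous_on S F" and cG: "continuous_on S G" for S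
    using ac_deriv_continuous[OF F] ac_deriv_continuous[OF G] by (auto intro: continuous_on_subset)
  have i1: "set_integrable lborel {a..b} (\<lambda>x. F x * g x)"
    and i2: "set_integrable lborel {a..b} (\<lambda>x. f x * G x)" for a b
    using set_integrable_continuous_mult[OF ac_deriv_D(2)[OF G] cF, of a b]
      set_integrable_continuous_mult[OF ac_deriv_D(2)[OF F] cG, of a b] by (auto simp: mult.commute)
  have "(LINT x:{a..b}|lborel. f x * G x + F x * g x) = F b * G b - F a * G a" if "a \<le> b" for a b
  proof -
    \<comment> \<open>Extension by zero turns the square into the whole plane and local
      integrability into integrability, as Fubini's theorem requires.\<close>
    define f' where "f' x = indicator {a..b} x * f x" for x
    define g' where "g' x = indicator {a..b} x * g x" for x
    have [measurable]: "f' \<in> borel_measurable borel" "g' \<in> borel_measurable borel"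
      unfolding f'_def[abs_def] g'_def[abs_def] by measurable
    have if': "integrable lborel f'" and ig': "integrable lborel g'"
      using ac_deriv_D(2)[OF F, of a b] ac_deriv_D(2)[OF G, of a b]
      by (auto simp: set_integrable_def f'_def[abs_def] g'_def[abs_def])
    have F_int: "integral\<^sup>L lborel f' = F b - F a" and G_int: "integral\<^sup>L lborel g' = G b - G a"
      using ac_deriv_D(3)[OF F that] ac_deriv_D(3)[OF G that]
      by (simp_all add: set_lebesgue_integral_def f'_def[abs_def] g'_def[abs_def])
    have P: "integrable (lborel \<Otimes>\<^sub>M lborel) (\<lambda>(x, y). f' x * g' y)"
    proof (rule lborel_pair.Fubini_integrable)
      show "integrable lborel (\<lambda>x. LINT y|lborel. norm (case (x, y) of (x, y) \<Rightarrow> f' x * g' y))"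
        using if' by (simp add: abs_mult)
      show "AE x in lborel. integrable lborel (\<lambda>y. case (x, y) of (x, y) \<Rightarrow> f' x * g' y)"
        using ig' by simp
    qed measurable
    have P1: "integrable (lborel \<Otimes>\<^sub>M lborel) (\<lambda>(x, y). if x \<le> y then f' x * g' y else 0)"
      by (rule Bochner_Integration.integrable_bound[OF P]) (auto split: prod.split)
    have P2: "integrable (lborel \<Otimes>\<^sub>M lborel) (\<lambda>(x, y). if x \<le> y then 0 else f' x * g' y)"
      by (rule Bochner_Integration.integrable_bound[OF P]) (auto split: prod.split)
    have inner1: "(LINT x|lborel. (if x \<le> y then f' x * g' y else 0)) = g' y * (F y - F a)" for y
    proof (cases "y \<in> {a..b}")
      case True
      have "(LINT x|lborel. (if x \<le> y then f' x * g' y else 0)) = (LINT x|lborel. g' y * (indicator {a..y} x *\<^sub>R f x))"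
        using True by (intro Bochner_Integration.integral_cong) (auto simp: f'_def indicator_def)
      also have "\<dots> = g' y * (F y - F a)"
        using ac_deriv_D(3)[OF F, of a y] True by (simp add: set_lebesgue_integral_def)
      finally show ?thesis .
    qed (simp add: g'_def cong: if_cong)
    have inner2: "(LINT y|lborel. (if x \<le> y then 0 else f' x * g' y)) = f' x * (G x - G a)" for x
    proof (cases "x \<in> {a..b}")
      case True
      have "(LINT y|lborel. (if x \<le> y then 0 else f' x * g' y)) = (LINT y|lborel. f' x * (indicator {a..x} y *\<^sub>R g y))"
      proof (rule Bochner_Integration.integral_cong_AE)
        show "AE y in lborel. (if x \<le> y then 0 else f' x * g' y) = f' x * (indicator {a..x} y *\<^sub>R g y)"
          \<comment> \<open>The diagonal was given to the other triangle, so \<open>y = x\<close> is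
            missing here while \<open>{a..x}\<close> contains it; a single point is null.\<close>
          using AE_lborel_singleton[of x] by eventually_elim (use True in \<open>auto simp: g'_def indicator_def\<close>)
      qed measurable
      also have "\<dots> = f' x * (G x - G a)"
        using ac_deriv_D(3)[OF G, of a x] True by (simp add: set_lebesgue_integral_def)
      finally show ?thesis .
    qed (simp add: f'_def cong: if_cong)
    have "(F b - F a) * (G b - G a) = (LINT x|lborel. LINT y|lborel. f' x * g' y)"
      using F_int G_int by simp
    also have "\<dots> = (LINT p|(lborel \<Otimes>\<^sub>M lborel). (\<lambda>(x, y). f' x * g' y) p)"
      using lborel_pair.integral_fst[OF P] by simp
    also have "\<dots> = (LINT p|(lborel \<Otimes>\<^sub>M lborel). (\<lambda>(x, y). if x \<le> y then f' x * g' y else 0) p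
                     + (\<lambda>(x, y). if x \<le> y then 0 else f' x * g' y) p)"
      by (intro Bochner_Integration.integral_cong) auto
    also have "\<dots> = (LINT p|(lborel \<Otimes>\<^sub>M lborel). (\<lambda>(x, y). if x \<le> y then f' x * g' y else 0) p)
                     + (LINT p|(lborel \<Otimes>\<^sub>M lborel). (\<lambda>(x, y). if x \<le> y then 0 else f' x * g' y) p)"
      by (rule Bochner_Integration.integral_add[OF P1 P2])
    also have "\<dots> = (LINT y|lborel. g' y * (F y - F a)) + (LINT x|lborel. f' x * (G x - G a))"
      using lborel_pair.integral_snd[OF P1] lborel_pair.integral_fst[OF P2]
      by (simp add: inner1 inner2)
    also have "(LINT y|lborel. g' y * (F y - F a)) = (LINT y|lborel. indicator {a..b} y *\<^sub>R (F y * g y) - F a * g' y)"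
      by (intro Bochner_Integration.integral_cong) (auto simp: g'_def algebra_simps)
    also have "\<dots> = (LINT y:{a..b}|lborel. F y * g y) - F a * (G b - G a)"
      using i1[of a b] ig' G_int
      by (subst Bochner_Integration.integral_diff) (auto simp: set_integrable_def set_lebesgue_integral_def)
    also have "(LINT x|lborel. f' x * (G x - G a)) = (LINT y|lborel. indicator {a..b} y *\<^sub>R (f y * G y) - G a * f' y)"
      by (intro Bochner_Integration.integral_cong) (auto simp: f'_def algebra_simps)
    also have "\<dots> = (LINT y:{a..b}|lborel. f y * G y) - G a * (F b - F a)"
      using i2[of a b] if' F_int
      by (subst Bochner_Integration.integral_diff) (auto simp: set_integrable_def set_lebesgue_integral_def)
    finally show ?thesis
      using i1[of a b] i2[of a b] by (simp add: set_integral_add algebra_simps)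
  qed
  then show ?thesis
    using i1 i2 unfolding ac_deriv_def by (auto intro!: set_integral_add)
qed

lemma ac_deriv_C1:
  assumes "\<And>x. (F has_real_derivative f x) (at x)" "continuous_on UNIV f"
  shows "ac_deriv F f"
  unfolding ac_deriv_def
proof (intro conjI allI impI)
  show "f \<in> borel_measurable borel" using assms(2) by (rule borel_measurable_continuous_onI)
  fix a b :: real
  show "set_integrable lborel {a..b} f"
    using assms(2) by (intro borel_integrable_atLeastAtMost') (auto intro: continuous_on_subset)
  assume "a \<le> b"
  have "(LINT x|lborel. indicator {a .. b} x *\<^sub>R f x) = F b - F a"
    using assms \<open>a \<le> b\<close>
    by (intro integral_FTC_Icc)
      (auto simp: has_real_derivative_iff_has_vector_derivative[symmetric] intro: DERIV_subset continuous_on_subset)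
  then show "(LINT x:{a..b}|lborel. f x) = F b - F a"
    by (simp add: set_lebesgue_integral_def)
qed

text \<open>Closed intervals generate the Borel sets, so their integrals determine the signed
  measure with density \<open>f\<close>. Truncation to \<open>{-n..n}\<close> makes this measure
  finite, which the complement step of the induction needs.\<close>

lemma AE_zero_if_interval_integrals_zero:
  fixes f :: "real \<Rightarrow> real"
  assumes [measurable]: "f \<in> borel_measurable borel" and int: "\<And>a b. set_integrable lborel {a..b} f"
    and zero: "\<And>a b. a \<le> b \<Longrightarrow> (LINT x:{a..b}|lborel. f x) = 0"
  shows "AE x in lborel. f x = 0"
proof -
  have "AE x in lborel. indicator {-real n..real n} x *\<^sub>R f x = 0" for n
  proof -
    define h where "h x = indicator {-real n..real n} x *\<^sub>R f x" for x
    have h: "integrable lborel h" using int[of "-n" n] by (simp add: set_integrable_def h_def[abs_def])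
    have hA: "set_integrable lborel A h" if "A \<in> sets borel" for A
      unfolding set_integrable_def using h that by (intro integrable_mult_indicator) auto
    have hI: "(LINT x:{a..b}|lborel. h x) = 0" for a b
    proof (cases "max a (-n) \<le> min b n")
      case True
      have "(LINT x:{a..b}|lborel. h x) = (LINT x:{max a (-n)..min b n}|lborel. f x)"
        unfolding set_lebesgue_integral_def
        by (intro Bochner_Integration.integral_cong) (auto simp: h_def indicator_def)
      then show ?thesis using zero[OF True] by simp
    next
      case False
      then have "(\<lambda>x. indicator {a..b} x *\<^sub>R h x) = (\<lambda>x. 0)" by (auto simp: h_def indicator_def fun_eq_iff)
      then show ?thesis by (simp add: set_lebesgue_integral_def)
    qed
    have hU: "(LINT x|lborel. h x) = 0"
      using zero[of "-n" n] by (simp add: h_def set_lebesgue_integral_def)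
    have "set_lebesgue_integral lborel A h = 0" if "A \<in> sets lborel" for A
    proof -
      have "A \<in> sets borel" using that by simp
      then show ?thesis
      proof (induction A rule: borel_set_induct)
        case (compl A)
        have "(LINT x:-A|lborel. h x) = (LINT x|lborel. h x - indicator A x *\<^sub>R h x)"
          unfolding set_lebesgue_integral_def
          by (intro Bochner_Integration.integral_cong) (auto simp: indicator_def)
        then show ?case using compl h hA[OF compl(1)] hU
          by (simp add: set_integrable_def set_lebesgue_integral_def Compl_eq_Diff_UNIV)
      next
        case (union B)
        have "(LINT x:(\<Union>i. B i)|lborel. h x) = (\<Sum>i. (LINT x:(B i)|lborel. h x))"
          using union by (intro lebesgue_integral_countable_add hA)
             (auto simp: disjoint_family_on_def)
        then show ?case using union by simp
      qed (use hI in \<open>auto simp: set_lebesgue_integral_def\<close>)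
    qed
    then have "AE x in lborel. h x = 0"
      using h by (intro density_unique_real) auto
    then show ?thesis by (simp add: h_def)
  qed
  then have "AE x in lborel. \<forall>n. indicator {-real n..real n} x *\<^sub>R f x = 0"
    unfolding AE_all_countable by blast
  then show ?thesis
  proof eventually_elim
    case (elim x)
    obtain n :: nat where "\<bar>x\<bar> \<le> n" using real_arch_simple by blast
    then show ?case using elim[rule_format, of n] by (auto simp: indicator_def split: if_splits)
  qed
qed

lemma ac_deriv_unique:
  assumes "ac_deriv F f" "ac_deriv F g"
  shows "AE x in lborel. f x = g x"
proof -
  have "AE x in lborel. f x - g x = 0"
    using assms ac_deriv_D[OF assms(1)] ac_deriv_D[OF assms(2)]
    by (intro AE_zero_if_interval_integrals_zero) auto
  then show ?thesis by simp
qed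

lemma ac_deriv_exists:
  assumes [measurable]: "f \<in> borel_measurable borel" and int: "\<And>a b. set_integrable lborel {a..b} f"
  shows "\<exists>F. ac_deriv F f"
proof -
  define F where "F x = (if 0 \<le> x then LINT t:{0..x}|lborel. f t else - (LINT t:{x..0}|lborel. f t))" for x
  have add: "(LINT t:{a..c}|lborel. f t) = (LINT t:{a..b}|lborel. f t) + (LINT t:{b..c}|lborel. f t)"
    if "a \<le> b" "b \<le> c" for a b c
  proof -
    have "(LINT t:{a..c}|lborel. f t) = integral {a..c} f" for a c
      by (rule set_borel_integral_eq_integral(2)[OF int])
    then show ?thesis
      using Henstock_Kurzweil_Integration.integral_combine[OF that set_borel_integral_eq_integral(1)[OF int]] by simp
  qed
  have "(LINT x:{a..b}|lborel. f x) = F b - F a" if "a \<le> b" for a b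
    using add[of a b 0] add[of 0 a b] add[of a 0 b] that by (auto simp: F_def not_le)
  then show ?thesis using assms unfolding ac_deriv_def by blast
qed

section \<open>Square-integrable functions and test functions\<close>

lemma L2_D:
  assumes "f \<in> L2"
  shows "f \<in> borel_measurable borel" "integrable lborel (\<lambda>x. (f x)\<^sup>2)"
  using assms by (auto simp: L2_def)

lemma L2_integrable_mult:
  assumes "f \<in> L2" "g \<in> L2"
  shows "integrable lborel (\<lambda>x. f x * g x)"
proof (rule Bochner_Integration.integrable_bound)
  show "integrable lborel (\<lambda>x. (f x)\<^sup>2 + (g x)\<^sup>2)"
    using assms by (auto dest: L2_D)
  have "\<bar>f x * g x\<bar> \<le> (f x)\<^sup>2 + (g x)\<^sup>2" for x
  proof -
    have "2 * (\<bar>f x\<bar> * \<bar>g x\<bar>) \<le> (f x)\<^sup>2 + (g x)\<^sup>2" "0 \<le> \<bar>f x\<bar> * \<bar>g x\<bar>"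
      using sum_squares_bound[of "\<bar>f x\<bar>" "\<bar>g x\<bar>"] by (simp_all add: mult.assoc)
    then show ?thesis unfolding abs_mult by linarith
  qed
  then show "AE x in lborel. norm (f x * g x) \<le> norm ((f x)\<^sup>2 + (g x)\<^sup>2)" by simp
qed (use L2_D(1)[OF assms(1)] L2_D(1)[OF assms(2)] in simp)

lemma L2_lincomb:
  assumes "f \<in> L2" "g \<in> L2"
  shows "(\<lambda>x. a * f x + b * g x) \<in> L2"
proof -
  note [measurable] = L2_D(1)[OF assms(1)] L2_D(1)[OF assms(2)]
  have "integrable lborel (\<lambda>x. a\<^sup>2 * (f x)\<^sup>2 + b\<^sup>2 * (g x)\<^sup>2 + 2 * a * b * (f x * g x))"
    using L2_D(2)[OF assms(1)] L2_D(2)[OF assms(2)] L2_integrable_mult[OF assms]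
    by (intro Bochner_Integration.integrable_add integrable_mult_right)
  moreover have "(\<lambda>x. a\<^sup>2 * (f x)\<^sup>2 + b\<^sup>2 * (g x)\<^sup>2 + 2 * a * b * (f x * g x)) = (\<lambda>x. (a * f x + b * g x)\<^sup>2)"
    by (simp add: fun_eq_iff power2_eq_square algebra_simps)
  ultimately show ?thesis by (simp add: L2_def)
qed

lemma L2_continuous_compact_support:
  fixes w :: "real \<Rightarrow> real"
  assumes "continuous_on UNIV w" "\<And>x. R < \<bar>x\<bar> \<Longrightarrow> w x = 0"
  shows "w \<in> L2"
proof -
  have "set_integrable lborel {-R..R} (\<lambda>x. (w x)\<^sup>2)"
    using assms(1) by (intro borel_integrable_atLeastAtMost' continuous_intros) (auto intro: continuous_on_subset)
  moreover have "(\<lambda>x. indicator {-R..R} x *\<^sub>R (w x)\<^sup>2) = (\<lambda>x. (w x)\<^sup>2)"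
    using assms(2) by (force simp: indicator_def fun_eq_iff)
  ultimately show ?thesis
    using borel_measurable_continuous_onI[OF assms(1)] by (simp add: L2_def set_integrable_def)
qed

lemma L2_set_integrable:
  assumes "f \<in> L2"
  shows "set_integrable lborel {a..b} f"
proof -
  have "set_integrable lborel {a..b} (\<lambda>x. 1 + (f x)\<^sup>2)"
  proof (intro set_integral_add)
    show "set_integrable lborel {a..b} (\<lambda>x. (f x)\<^sup>2)"
      unfolding set_integrable_def using L2_D(2)[OF assms] by (intro integrable_mult_indicator) auto
    show "set_integrable lborel {a..b} (\<lambda>x. 1::real)"
      by (intro borel_integrable_atLeastAtMost' continuous_intros)
  qed
  then show ?thesis
  proof (rule set_integrable_bound)
    have [measurable]: "f \<in> borel_measurable borel" by (rule L2_D[OF assms])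
    show "set_borel_measurable lborel {a..b} f" by (simp add: set_borel_measurable_def)
    have "\<bar>f x\<bar> \<le> 1 + (f x)\<^sup>2" for x
      using sum_squares_bound[of 1 "\<bar>f x\<bar>"] by simp
    then show "AE x in lborel. x \<in> {a..b} \<longrightarrow> norm (f x) \<le> norm (1 + (f x)\<^sup>2)" by simp
  qed
qed

lemma test_functions_D:
  assumes "\<phi> \<in> test_functions"
  obtains R where "R > 0" "\<And>x. (\<phi> has_real_derivative deriv \<phi> x) (at x)" "continuous_on UNIV (deriv \<phi>)"
    "\<And>x. R \<le> \<bar>x\<bar> \<Longrightarrow> \<phi> x = 0" "\<And>x. R \<le> \<bar>x\<bar> \<Longrightarrow> deriv \<phi> x = 0"
proof -
  have C1: "\<phi> C1_differentiable_on UNIV" and c: "compact (closure {x. \<phi> x \<noteq> 0})"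
    using assms by (auto simp: test_functions_def)
  obtain D where D: "\<And>x. (\<phi> has_vector_derivative D x) (at x)" "continuous_on UNIV D"
    using C1 unfolding C1_differentiable_on_def by auto
  have D': "(\<phi> has_real_derivative D x) (at x)" for x
    using D(1) by (simp add: has_real_derivative_iff_has_vector_derivative)
  have eq: "deriv \<phi> = D" using D' by (auto intro: DERIV_imp_deriv)
  obtain B where B: "\<And>x. x \<in> closure {x. \<phi> x \<noteq> 0} \<Longrightarrow> \<bar>x\<bar> \<le> B"
    using compact_imp_bounded[OF c] by (force simp: bounded_iff)
  have z: "\<phi> x = 0" if "B < \<bar>x\<bar>" for x
    using B[of x] that closure_subset[of "{x. \<phi> x \<noteq> 0}"] by force
  have dz: "D x = 0" if "B < \<bar>x\<bar>" for x
  proof -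
    have "open {x::real. B < \<bar>x\<bar>}" by (intro open_Collect_less continuous_intros)
    then have "((\<lambda>x. 0) has_real_derivative D x) (at x)"
      using that z by (intro DERIV_cong_ev[THEN iffD1, OF refl _ refl D'])
         (auto simp: eventually_nhds intro!: exI[of _ "{x. B < \<bar>x\<bar>}"])
    then show ?thesis using DERIV_unique DERIV_const by blast
  qed
  show ?thesis
    \<comment> \<open>The margin 1 turns the strict condition \<open>B < \<bar>x\<bar>\<close> into
      \<open>R \<le> \<bar>x\<bar>\<close>; the absolute value keeps \<open>R\<close> positive even
      when the support is empty and \<open>B\<close> is arbitrary.\<close>
    by (rule that[of "\<bar>B\<bar> + 1"]) (use D' D(2) eq z dz in auto)
qed

lemma test_functions_L2:
  assumes "\<phi> \<in> test_functions"
  shows "\<phi> \<in> L2" "deriv \<phi> \<in> L2"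
proof -
  obtain R where R: "R > 0" "\<And>x. (\<phi> has_real_derivative deriv \<phi> x) (at x)" "continuous_on UNIV (deriv \<phi>)"
    "\<And>x. R \<le> \<bar>x\<bar> \<Longrightarrow> \<phi> x = 0" "\<And>x. R \<le> \<bar>x\<bar> \<Longrightarrow> deriv \<phi> x = 0"
    using test_functions_D[OF assms] by blast
  then show "\<phi> \<in> L2" "deriv \<phi> \<in> L2"
    using L2_continuous_compact_support[of \<phi> R] L2_continuous_compact_support[of "deriv \<phi>" R]
     DERIV_continuous_on[of UNIV \<phi>] by auto
qed

text \<open>The product rule on \<open>{-R..R}\<close>, where the test function kills both boundary
  terms. Integrability is exported too, since splitting integrals by linearity depends on
  it.\<close>

lemma ac_deriv_weak:
  assumes F: "ac_deriv F f" and \<phi>: "\<phi> \<in> test_functions"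
  shows "(LINT x|lborel. F x * deriv \<phi> x) = - (LINT x|lborel. f x * \<phi> x)"
    "integrable lborel (\<lambda>x. F x * deriv \<phi> x)" "integrable lborel (\<lambda>x. f x * \<phi> x)"
proof -
  obtain R where R: "R > 0" "\<And>x. (\<phi> has_real_derivative deriv \<phi> x) (at x)" "continuous_on UNIV (deriv \<phi>)"
    "\<And>x. R \<le> \<bar>x\<bar> \<Longrightarrow> \<phi> x = 0" "\<And>x. R \<le> \<bar>x\<bar> \<Longrightarrow> deriv \<phi> x = 0"
    using test_functions_D[OF \<phi>] by blast
  have A: "ac_deriv \<phi> (deriv \<phi>)" using R by (intro ac_deriv_C1)
  have cF: "continuous_on S F" and c\<phi>: "continuous_on S \<phi>" for S
    using ac_deriv_continuous[OF F] ac_deriv_continuous[OF A] by (auto intro: continuous_on_subset)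
  have i1: "set_integrable lborel {-R..R} (\<lambda>x. F x * deriv \<phi> x)"
    by (rule set_integrable_continuous_mult[OF ac_deriv_D(2)[OF A] cF])
  have i2: "set_integrable lborel {-R..R} (\<lambda>x. f x * \<phi> x)"
    using set_integrable_continuous_mult[OF ac_deriv_D(2)[OF F] c\<phi>, of "-R" R] by (simp add: mult.commute)
  have e1: "(\<lambda>x. indicator {-R..R} x *\<^sub>R (F x * deriv \<phi> x)) = (\<lambda>x. F x * deriv \<phi> x)"
    using R(5) by (force simp: indicator_def)
  have e2: "(\<lambda>x. indicator {-R..R} x *\<^sub>R (f x * \<phi> x)) = (\<lambda>x. f x * \<phi> x)"
    using R(4) by (force simp: indicator_def)
  show "integrable lborel (\<lambda>x. F x * deriv \<phi> x)" "integrable lborel (\<lambda>x. f x * \<phi> x)"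
    using i1 i2 by (simp_all only: set_integrable_def e1 e2)
  have "(LINT x:{-R..R}|lborel. f x * \<phi> x + F x * deriv \<phi> x) = 0"
    using ac_deriv_D(3)[OF ac_deriv_mult[OF F A], of "-R" R] R by simp
  then have "(LINT x:{-R..R}|lborel. f x * \<phi> x) + (LINT x:{-R..R}|lborel. F x * deriv \<phi> x) = 0"
    using i1 i2 by simp
  then show "(LINT x|lborel. F x * deriv \<phi> x) = - (LINT x|lborel. f x * \<phi> x)"
    by (simp only: set_lebesgue_integral_def e1 e2)
qed

text \<open>The zero mean is what brings the antiderivative starting from 0 at \<open>-R\<close>
  back to 0 at \<open>R\<close>, so that its support stays compact.\<close>

lemma test_function_antiderivative:
  fixes w :: "real \<Rightarrow> real"
  assumes w: "continuous_on UNIV w" "\<And>x. R \<le> \<bar>x\<bar> \<Longrightarrow> w x = 0" "R > 0" "(LINT x|lborel. w x) = 0"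
  obtains \<phi> where "\<phi> \<in> test_functions" "\<And>x. deriv \<phi> x = w x"
proof -
  have wm: "w \<in> borel_measurable borel" using w(1) by (rule borel_measurable_continuous_onI)
  have wi: "set_integrable lborel {a..b} w" for a b
    using w(1) by (intro borel_integrable_atLeastAtMost') (auto intro: continuous_on_subset)
  obtain P where P: "ac_deriv P w" using ac_deriv_exists[OF wm wi] by blast
  define \<phi> where "\<phi> x = P x - P (-R)" for x
  have d: "(\<phi> has_real_derivative w x) (at x)" for x
  proof -
    \<comment> \<open>\<open>P\<close> is known only through interval integrals. Near
      \<open>x\<close> it agrees up to a constant with the integral from \<open>x - 1\<close>, to
      which the fundamental theorem applies.\<close>
    have "((\<lambda>y. integral {x-1..y} w) has_real_derivative w x) (at x within {x-1..x+1})"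
      using w(1) by (intro integral_has_real_derivative) (auto intro: continuous_on_subset)
    then have "((\<lambda>y. integral {x-1..y} w) has_real_derivative w x) (at x)"
      by (simp add: at_within_Icc_at)
    then have "((\<lambda>y. integral {x-1..y} w + (P (x-1) - P (-R))) has_real_derivative w x) (at x)"
      by (auto intro!: derivative_eq_intros)
    moreover have "eventually (\<lambda>y. integral {x-1..y} w + (P (x-1) - P (-R)) = \<phi> y) (nhds x)"
      unfolding eventually_nhds
      using integral_unique[OF ac_deriv_has_integral[OF P]]
      by (intro exI[of _ "{x-1<..}"]) (auto simp: \<phi>_def)
    ultimately show ?thesis by (simp add: DERIV_cong_ev)
  qed
  have z: "\<phi> x = 0" if "R \<le> \<bar>x\<bar>" for x
  proof -
    have zero: "(LINT t:{a..b}|lborel. w t) = 0" if "\<And>t. t \<in> {a..b} \<Longrightarrow> R \<le> \<bar>t\<bar>" for a b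
    proof -
      have "(\<lambda>t. indicator {a..b} t *\<^sub>R w t) = (\<lambda>t. 0)" using that w(2) by (force simp: indicator_def)
      then show ?thesis by (simp add: set_lebesgue_integral_def)
    qed
    have "(\<lambda>t. indicator {-R..R} t *\<^sub>R w t) = w" using w(2) by (force simp: indicator_def)
    then have "P R - P (-R) = 0"
      using ac_deriv_D(3)[OF P, of "-R" R] w(3,4) by (simp add: set_lebesgue_integral_def)
    moreover have "P x = P R" if "R \<le> x"
      using ac_deriv_D(3)[OF P that] zero[of R x] by force
    moreover have "P x = P (-R)" if "x \<le> -R"
      using ac_deriv_D(3)[OF P that] zero[of x "-R"] by force
    ultimately show ?thesis using that by (auto simp: \<phi>_def abs_if split: if_splits)
  qed
  have "closure {x. \<phi> x \<noteq> 0} \<subseteq> {-R..R}"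
    by (rule closure_minimal) (use z in \<open>force+\<close>)
  then have "compact (closure {x. \<phi> x \<noteq> 0})"
    by (meson bounded_closed_interval bounded_subset closed_closure compact_eq_bounded_closed)
  moreover have "\<phi> C1_differentiable_on UNIV"
    unfolding C1_differentiable_on_def using d w(1)
    by (auto simp: has_real_derivative_iff_has_vector_derivative)
  ultimately have "\<phi> \<in> test_functions" by (simp add: test_functions_def)
  then show ?thesis using that d DERIV_imp_deriv by blast
qed

section \<open>From weak derivatives to absolutely continuous representatives\<close>

lemma plateau_approximates_interval:
  fixes a b :: real
  assumes "a \<le> b"
  defines "w \<equiv> \<lambda>(n::nat) x. max 0 (1 - real (Suc n) * max 0 (max (a - x) (x - b)))"
  \<comment> \<open>The trapezoids equal 1 on \<open>{a..b}\<close> and have slopes of size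
    \<open>Suc n\<close>. Their supports lie in one common interval, so a single integrable function
    dominates them all.\<close>
  shows "continuous_on UNIV (w n)" "\<And>x. \<bar>a\<bar> + \<bar>b\<bar> + 1 \<le> \<bar>x\<bar> \<Longrightarrow> w n x = 0"
    "\<And>x. 0 \<le> w n x" "\<And>x. w n x \<le> 1" "\<And>x. (\<lambda>n. w n x) \<longlonglongrightarrow> indicator {a..b} x"
proof -
  show "continuous_on UNIV (w n)" unfolding w_def by (intro continuous_intros)
  show "w n x = 0" if "\<bar>a\<bar> + \<bar>b\<bar> + 1 \<le> \<bar>x\<bar>" for x
  proof -
    have "1 \<le> max 0 (max (a - x) (x - b))" using that by linarith
    then have "1 * 1 \<le> real (Suc n) * max 0 (max (a - x) (x - b))"
      by (intro mult_mono) auto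
    then show ?thesis unfolding w_def by simp
  qed
  show "0 \<le> w n x" "w n x \<le> 1" for x unfolding w_def by auto
  show "(\<lambda>n. w n x) \<longlonglongrightarrow> indicator {a..b} x" for x
  proof (cases "x \<in> {a..b}")
    case True
    then have "max 0 (max (a - x) (x - b)) = 0" by auto
    then show ?thesis using True unfolding w_def by simp
  next
    case False
    define d where "d = max 0 (max (a - x) (x - b))"
    have "d > 0" using False by (auto simp: d_def)
    then obtain N :: nat where N: "1 / d < N" using reals_Archimedean2 by blast
    have "w n x = 0" if "n \<ge> N" for n
    proof -
      have "1 < d * real N" using N \<open>d > 0\<close> by (simp add: field_simps)
      also have "\<dots> \<le> d * real (Suc n)" using that \<open>d > 0\<close> by (intro mult_left_mono) auto
      finally show ?thesis unfolding w_def d_def[symmetric] by (simp add: mult.commute)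
    qed
    then have "eventually (\<lambda>n. w n x = 0) sequentially" by (auto simp: eventually_sequentially)
    then show ?thesis using False by (simp add: tendsto_eventually)
  qed
qed

lemma set_integrable_mult_compact_support:
  fixes h w :: "real \<Rightarrow> real"
  assumes "\<And>a b. set_integrable lborel {a..b} h" "continuous_on UNIV w" "\<And>x. R \<le> \<bar>x\<bar> \<Longrightarrow> w x = 0"
  shows "integrable lborel (\<lambda>x. h x * w x)"
proof -
  have "set_integrable lborel {-R..R} (\<lambda>x. w x * h x)"
    using assms(1,2) by (intro set_integrable_continuous_mult) (auto intro: continuous_on_subset)
  moreover have "(\<lambda>x. indicator {-R..R} x *\<^sub>R (w x * h x)) = (\<lambda>x. h x * w x)"
    using assms(3) by (force simp: indicator_def)
  ultimately show ?thesis by (simp only: set_integrable_def)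
qed

text \<open>Only functions of mean zero are derivatives of test functions, so a multiple of the tent
  \<open>w0\<close> is subtracted to correct the mean. Then \<open>h - c\<close> annihilates every
  continuous function with compact support, and the trapezoids carry this over to indicators of
  intervals.\<close>

lemma du_Bois_Reymond:
  assumes [measurable]: "h \<in> borel_measurable borel" and int: "\<And>a b. set_integrable lborel {a..b} h"
    and zero: "\<And>\<phi>. \<phi> \<in> test_functions \<Longrightarrow> (LINT x|lborel. h x * deriv \<phi> x) = 0"
  obtains c where "AE x in lborel. h x = c"
proof -
  define w0 :: "real \<Rightarrow> real" where "w0 x = max 0 (1 - \<bar>x\<bar>)" for x
  have c0: "continuous_on UNIV w0" unfolding w0_def by (intro continuous_intros)
  have z0: "1 \<le> \<bar>x\<bar> \<Longrightarrow> w0 x = 0" for x by (auto simp: w0_def)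
  have i1: "integrable lborel w" if "continuous_on UNIV w" "\<And>x. R \<le> \<bar>x\<bar> \<Longrightarrow> w x = 0" for w :: "real \<Rightarrow> real" and R
    using set_integrable_mult_compact_support[of "\<lambda>x. 1" w R, OF borel_integrable_atLeastAtMost'[OF continuous_on_const] that(1)] that(2)
    by simp
  have ih: "integrable lborel (\<lambda>x. h x * w x)" if "continuous_on UNIV w" "\<And>x. R \<le> \<bar>x\<bar> \<Longrightarrow> w x = 0" for w :: "real \<Rightarrow> real" and R
    using set_integrable_mult_compact_support[OF int that] .
  define m where "m = (LINT x|lborel. w0 x)"
  have "m > 0"
  proof -
    have "(LINT x:{-1/2..1/2::real}|lborel. (1/2::real)) \<le> m"
      unfolding m_def set_lebesgue_integral_def
    proof (rule integral_mono)
      show "integrable lborel w0" using i1[OF c0, of 1] z0 by blast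
      show "integrable lborel (\<lambda>x::real. indicator {-1/2..1/2} x *\<^sub>R (1/2::real))" by auto
    qed (auto simp: w0_def indicator_def)
    moreover have "(LINT x:{-1/2..1/2::real}|lborel. (1/2::real)) = 1/2"
      by (simp add: set_lebesgue_integral_def)
    ultimately show ?thesis by linarith
  qed
  \<comment> \<open>The only possible constant: the mean of \<open>h\<close> with respect to the
    normalized tent.\<close>
  define c where "c = (LINT x|lborel. h x * w0 x) / m"
  have key: "(LINT x|lborel. (h x - c) * w x) = 0"
    if w: "continuous_on UNIV w" "\<And>x. R \<le> \<bar>x\<bar> \<Longrightarrow> w x = 0" "R \<ge> 1" for w :: "real \<Rightarrow> real" and R
  proof -
    define I where "I = (LINT x|lborel. w x)"
    define v where "v x = w x - I / m * w0 x" for x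
    have cv: "continuous_on UNIV v" unfolding v_def using w(1) c0 by (intro continuous_intros)
    have zv: "R \<le> \<bar>x\<bar> \<Longrightarrow> v x = 0" for x using w(2,3) z0 by (simp add: v_def)
    have "(LINT x|lborel. v x) = I - I / m * m"
      unfolding v_def using i1[OF w(1,2)] i1[OF c0 z0] by (simp add: I_def m_def)
    then have "(LINT x|lborel. v x) = 0" using \<open>m > 0\<close> by simp
    then obtain \<phi> where "\<phi> \<in> test_functions" "\<And>x. deriv \<phi> x = v x"
      using test_function_antiderivative[OF cv zv] w(3) by (metis less_le_trans zero_less_one)
    then have "(LINT x|lborel. h x * v x) = 0" using zero[of \<phi>] by simp
    moreover have "(LINT x|lborel. h x * v x) = (LINT x|lborel. h x * w x - I / m * (h x * w0 x))"
      by (simp add: v_def algebra_simps)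
    moreover have "\<dots> = (LINT x|lborel. h x * w x) - I / m * (LINT x|lborel. h x * w0 x)"
      using ih[OF w(1,2)] ih[OF c0 z0] by simp
    ultimately have "(LINT x|lborel. h x * w x) = c * I" by (simp add: c_def)
    moreover have "(LINT x|lborel. (h x - c) * w x) = (LINT x|lborel. h x * w x) - c * I"
      using ih[OF w(1,2)] i1[OF w(1,2)] by (simp add: algebra_simps I_def)
    ultimately show ?thesis by simp
  qed
  have inth: "set_integrable lborel {a..b} (\<lambda>x. h x - c)" for a b
    by (rule set_integral_diff(1)[OF int borel_integrable_atLeastAtMost'[OF continuous_on_const]])
  have "AE x in lborel. h x - c = 0"
  proof (rule AE_zero_if_interval_integrals_zero)
    fix a b :: real
    assume "a \<le> b"
    define w where "w n x = max 0 (1 - real (Suc n) * max 0 (max (a - x) (x - b)))" for n :: nat and x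
    note w = plateau_approximates_interval[OF \<open>a \<le> b\<close>, folded w_def]
    define R where "R = \<bar>a\<bar> + \<bar>b\<bar> + 1"
    have i: "integrable lborel (\<lambda>x. norm (indicator {-R..R} x *\<^sub>R (h x - c)))"
      using inth[of "-R" R] by (simp add: set_integrable_def)
    have lim: "(\<lambda>n. (h x - c) * w n x) \<longlonglongrightarrow> indicator {a..b} x *\<^sub>R (h x - c)" for x
      using tendsto_mult_left[OF w(5), of "h x - c" x] by (simp add: mult.commute)
    have bd: "norm ((h x - c) * w n x) \<le> norm (indicator {-R..R} x *\<^sub>R (h x - c))" for n x
    proof (cases "R \<le> \<bar>x\<bar>")
      case True then show ?thesis using w(2)[of x n] by (simp add: R_def)
    next
      case False
      then have "x \<in> {-R..R}" by auto
      then show ?thesis using w(3,4)[of n x] by (simp add: abs_mult mult_left_le)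
    qed
    have wm: "w n \<in> borel_measurable borel" for n
      using w(1) by (rule borel_measurable_continuous_onI)
    have "(\<lambda>n. LINT x|lborel. (h x - c) * w n x) \<longlonglongrightarrow> (LINT x|lborel. indicator {a..b} x *\<^sub>R (h x - c))"
      by (rule integral_dominated_convergence[OF _ _ i]) (use lim bd wm in auto)
    moreover have "(LINT x|lborel. (h x - c) * w n x) = 0" for n
      using key[of "w n" R] w(1,2) by (simp add: R_def)
    ultimately show "(LINT x:{a..b}|lborel. h x - c) = 0"
      unfolding set_lebesgue_integral_def by (simp add: LIMSEQ_const_iff)
  qed (use inth in simp_all)
  then show ?thesis using that by simp
qed

text \<open>The difference between \<open>f\<close> and any primitive of \<open>g\<close> has weak
  derivative zero, hence is constant almost everywhere; the constant is added to the
  primitive.\<close>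

lemma weak_deriv_ac_representative:
  assumes f: "f \<in> L2" and g: "g \<in> L2" and fg: "is_weak_deriv f g"
  obtains F where "ac_deriv F g" "AE x in lborel. f x = F x"
proof -
  obtain P where P: "ac_deriv P g"
    using ac_deriv_exists[OF L2_D(1)[OF g] L2_set_integrable[OF g]] by blast
  note [measurable] = L2_D(1)[OF f] L2_D(1)[OF g] ac_deriv_measurable[OF P]
  have Pi: "set_integrable lborel {a..b} P" for a b
    using ac_deriv_continuous[OF P] by (intro borel_integrable_atLeastAtMost') (auto intro: continuous_on_subset)
  have zero: "(LINT x|lborel. (f x - P x) * deriv \<phi> x) = 0" if \<phi>: "\<phi> \<in> test_functions" for \<phi>
  proof -
    have "(LINT x|lborel. f x * deriv \<phi> x) = (LINT x|lborel. P x * deriv \<phi> x)"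
      using fg \<phi> ac_deriv_weak(1)[OF P \<phi>] by (simp add: is_weak_deriv_def)
    then show ?thesis
      using L2_integrable_mult[OF f test_functions_L2(2)[OF \<phi>]] ac_deriv_weak(2)[OF P \<phi>]
      by (simp add: left_diff_distrib)
  qed
  have "(\<lambda>x. f x - P x) \<in> borel_measurable borel" by measurable
  then obtain c where c: "AE x in lborel. f x - P x = c"
    by (rule du_Bois_Reymond[OF _ set_integral_diff(1)[OF L2_set_integrable[OF f] Pi] zero])
  have "ac_deriv (\<lambda>x. P x + c) g" using P by (simp add: ac_deriv_def)
  moreover have "AE x in lborel. f x = P x + c" using c by eventually_elim simp
  ultimately show ?thesis by (rule that)
qed

lemma weak_deriv_D:
  assumes "f \<in> H1"
  shows "weak_deriv f \<in> L2" "is_weak_deriv f (weak_deriv f)" "f \<in> L2"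
proof -
  have "\<exists>g. g \<in> L2 \<and> is_weak_deriv f g" using assms by (auto simp: H1_def)
  then have "weak_deriv f \<in> L2 \<and> is_weak_deriv f (weak_deriv f)"
    unfolding weak_deriv_def by (rule someI_ex)
  then show "weak_deriv f \<in> L2" "is_weak_deriv f (weak_deriv f)" "f \<in> L2"
    using assms by (auto simp: H1_def)
qed

lemma H1_ac_representative:
  assumes "f \<in> H1"
  obtains F where "ac_deriv F (weak_deriv f)" "AE x in lborel. f x = F x"
  using weak_deriv_ac_representative weak_deriv_D[OF assms] by blast

text \<open>The set where the functions differ is open, and a nonempty open set has positive
  measure.\<close>

lemma continuous_AE_eq:
  fixes F G :: "real \<Rightarrow> real"
  assumes "continuous_on UNIV F" "continuous_on UNIV G" "AE x in lborel. F x = G x"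
  shows "F = G"
proof (rule ccontr)
  assume "F \<noteq> G"
  then obtain x where x: "F x \<noteq> G x" by auto
  have "open {x. F x \<noteq> G x}" using assms(1,2) by (intro open_Collect_neq)
  then obtain e where e: "e > 0" "ball x e \<subseteq> {x. F x \<noteq> G x}" using openE[of "{x. F x \<noteq> G x}" x] x by blast
  have "AE y in lborel. y \<notin> {x - e<..<x + e}"
    using assms(3) by eventually_elim (use e in \<open>auto simp: ball_eq_greaterThanLessThan\<close>)
  then have "{x - e<..<x + e} \<in> null_sets lborel" by (subst AE_iff_null_sets) auto
  then have "emeasure lborel {x - e<..<x + e} = 0" by blast
  then show False using e(1) by simp
qed

text \<open>This makes the choice by \<open>SOME\<close> harmless. Both derivatives have continuous
  primitives that agree with \<open>f\<close> almost everywhere, so the primitives coincide.\<close>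

lemma weak_deriv_AE_eq:
  assumes "f \<in> H1" "g \<in> L2" "is_weak_deriv f g"
  shows "AE x in lborel. weak_deriv f x = g x"
proof -
  obtain F where F: "ac_deriv F (weak_deriv f)" "AE x in lborel. f x = F x"
    using H1_ac_representative[OF assms(1)] .
  obtain G where G: "ac_deriv G g" "AE x in lborel. f x = G x"
    using weak_deriv_ac_representative[OF weak_deriv_D(3)[OF assms(1)] assms(2,3)] .
  have "AE x in lborel. F x = G x" using F(2) G(2) by eventually_elim simp
  then have "F = G"
    using F(1) G(1) ac_deriv_continuous continuous_AE_eq by blast
  then show ?thesis using F(1) G(1) ac_deriv_unique by blast
qed

lemma H1_lincomb:
  assumes f: "f \<in> H1" and g: "g \<in> H1"
  shows "(\<lambda>x. a * f x + b * g x) \<in> H1"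
    "AE x in lborel. weak_deriv (\<lambda>x. a * f x + b * g x) x = a * weak_deriv f x + b * weak_deriv g x"
proof -
  have L: "(\<lambda>x. a * f x + b * g x) \<in> L2" "(\<lambda>x. a * weak_deriv f x + b * weak_deriv g x) \<in> L2"
    using weak_deriv_D[OF f] weak_deriv_D[OF g] by (auto intro: L2_lincomb)
  have w: "is_weak_deriv (\<lambda>x. a * f x + b * g x) (\<lambda>x. a * weak_deriv f x + b * weak_deriv g x)"
    unfolding is_weak_deriv_def
  proof
    fix \<phi> assume \<phi>: "\<phi> \<in> test_functions"
    have "(LINT x|lborel. (a * f x + b * g x) * deriv \<phi> x) = (LINT x|lborel. a * (f x * deriv \<phi> x) + b * (g x * deriv \<phi> x))"
      by (simp add: algebra_simps)
    also have "\<dots> = a * (LINT x|lborel. f x * deriv \<phi> x) + b * (LINT x|lborel. g x * deriv \<phi> x)"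
      using weak_deriv_D(3)[OF f] weak_deriv_D(3)[OF g] test_functions_L2[OF \<phi>]
      by (simp add: L2_integrable_mult)
    also have "\<dots> = - (a * (LINT x|lborel. weak_deriv f x * \<phi> x) + b * (LINT x|lborel. weak_deriv g x * \<phi> x))"
      using weak_deriv_D(2)[OF f] weak_deriv_D(2)[OF g] \<phi> by (simp add: is_weak_deriv_def)
    also have "\<dots> = - (LINT x|lborel. a * (weak_deriv f x * \<phi> x) + b * (weak_deriv g x * \<phi> x))"
      using weak_deriv_D(1)[OF f] weak_deriv_D(1)[OF g] test_functions_L2[OF \<phi>]
      by (simp add: L2_integrable_mult)
    also have "\<dots> = - (LINT x|lborel. (a * weak_deriv f x + b * weak_deriv g x) * \<phi> x)"
      by (simp add: algebra_simps)
    finally show "(LINT x|lborel. (a * f x + b * g x) * deriv \<phi> x) =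
      - (LINT x|lborel. (a * weak_deriv f x + b * weak_deriv g x) * \<phi> x)" .
  qed
  show 1: "(\<lambda>x. a * f x + b * g x) \<in> H1" using L w by (auto simp: H1_def)
  show "AE x in lborel. weak_deriv (\<lambda>x. a * f x + b * g x) x = a * weak_deriv f x + b * weak_deriv g x"
    by (rule weak_deriv_AE_eq[OF 1 L(2) w])
qed

text \<open>Between any \<open>a \<le> x\<close> the function \<open>F\<^sup>2\<close> rises by at
  most the integral \<open>I\<close>, since \<open>2 * F * g\<close> is at most
  \<open>F\<^sup>2 + g\<^sup>2\<close>. Averaging over \<open>a\<close> in the unit interval left of
  \<open>x\<close> replaces \<open>(F a)\<^sup>2\<close> by another integral bounded by
  \<open>I\<close>, hence the constant 2; no decay at infinity is involved.\<close>

lemma ac_deriv_sup_bound: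
  assumes F: "ac_deriv F g" and i: "integrable lborel (\<lambda>x. (F x)\<^sup>2)" "integrable lborel (\<lambda>x. (g x)\<^sup>2)"
  shows "(F x)\<^sup>2 \<le> 2 * (LINT x|lborel. (F x)\<^sup>2 + (g x)\<^sup>2)"
proof -
  define I where "I = (LINT x|lborel. (F x)\<^sup>2 + (g x)\<^sup>2)"
  have ii: "integrable lborel (\<lambda>x. (F x)\<^sup>2 + (g x)\<^sup>2)" using i by simp
  have FF: "ac_deriv (\<lambda>x. (F x)\<^sup>2) (\<lambda>x. 2 * F x * g x)"
    using ac_deriv_mult[OF F F] by (simp add: power2_eq_square algebra_simps)
  have step: "(F x)\<^sup>2 \<le> (F a)\<^sup>2 + I" if "a \<le> x" for a
  proof -
    have "(F x)\<^sup>2 - (F a)\<^sup>2 = (LINT t|lborel. indicator {a..x} t *\<^sub>R (2 * F t * g t))"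
      using ac_deriv_D(3)[OF FF that] by (simp add: set_lebesgue_integral_def)
    also have "\<dots> \<le> I" unfolding I_def
    proof (rule integral_mono[OF _ ii])
      show "integrable lborel (\<lambda>t. indicator {a..x} t *\<^sub>R (2 * F t * g t))"
        using ac_deriv_D(2)[OF FF] by (simp add: set_integrable_def)
      show "indicator {a..x} t *\<^sub>R (2 * F t * g t) \<le> (F t)\<^sup>2 + (g t)\<^sup>2" for t
        using sum_squares_bound[of "F t" "g t"] by (simp add: indicator_def)
    qed
    finally show ?thesis by simp
  qed
  have "(F x)\<^sup>2 = (LINT t|lborel. indicator {x-1..x} t * (F x)\<^sup>2)" by simp
  also have "\<dots> \<le> (LINT t|lborel. (F t)\<^sup>2 + (g t)\<^sup>2 + indicator {x-1..x} t * I)"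
  proof (rule integral_mono)
    show "indicator {x-1..x} t * (F x)\<^sup>2 \<le> (F t)\<^sup>2 + (g t)\<^sup>2 + indicator {x-1..x} t * I" for t
    proof (cases "t \<in> {x-1..x}")
      case True
      then have "(F x)\<^sup>2 \<le> (F t)\<^sup>2 + I" using step[of t] by simp
      then have "(F x)\<^sup>2 \<le> (F t)\<^sup>2 + (g t)\<^sup>2 + I" using zero_le_power2[of "g t"] by linarith
      then show ?thesis using True by simp
    qed simp
  qed (use ii in auto)
  also have "\<dots> = 2 * I" using ii by (simp add: I_def)
  finally show ?thesis by (simp add: I_def)
qed

section \<open>Cutoff functions and Picone's identity\<close>

text \<open>The outer square leaves a factor \<open>1 - (x / R)\<^sup>2\<close> in the derivative,
  so that \<open>(cutoff' R x)\<^sup>2\<close> is controlled by \<open>cutoff R x\<close> itself;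
  the absorption argument for positive solutions rests on this. The polynomial is not truncated
  outside \<open>{-R..R}\<close>, so its integrals are always taken over that interval.\<close>

definition cutoff :: "real \<Rightarrow> real \<Rightarrow> real" where
  "cutoff R x = (1 - (x / R)\<^sup>2)\<^sup>2"

definition cutoff' :: "real \<Rightarrow> real \<Rightarrow> real" where
  "cutoff' R x = - 4 * x / R\<^sup>2 * (1 - (x / R)\<^sup>2)"

lemma cutoff_deriv: "(cutoff R has_real_derivative cutoff' R x) (at x)"
  unfolding cutoff_def[abs_def] cutoff'_def divide_inverse
  by (auto intro!: derivative_eq_intros simp: power2_eq_square algebra_simps)

lemma cutoff_continuous: "continuous_on S (cutoff R)" "continuous_on S (cutoff' R)"
  unfolding cutoff_def[abs_def] cutoff'_def[abs_def]
  by (auto intro!: continuous_intros simp: divide_inverse)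

lemma cutoff_bounds:
  assumes "R > 0" "x \<in> {-R..R}"
  shows "0 \<le> cutoff R x" "cutoff R x \<le> 1" "(cutoff' R x)\<^sup>2 \<le> 16 / R\<^sup>2 * cutoff R x" "\<bar>cutoff' R x\<bar> \<le> 4 / R"
proof -
  have y: "(x / R)\<^sup>2 \<le> 1" using assms by (simp add: abs_square_le_1 abs_le_iff divide_le_eq)
  show 1: "0 \<le> cutoff R x" "cutoff R x \<le> 1"
    using y by (auto simp: cutoff_def power_le_one)
  have "(cutoff' R x)\<^sup>2 = 16 / R\<^sup>2 * cutoff R x * (x / R)\<^sup>2"
    by (simp add: cutoff'_def cutoff_def power2_eq_square)
  also have "\<dots> \<le> 16 / R\<^sup>2 * cutoff R x" using y 1 by (intro mult_left_le) auto
  finally show 2: "(cutoff' R x)\<^sup>2 \<le> 16 / R\<^sup>2 * cutoff R x" .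
  also have "\<dots> \<le> 16 / R\<^sup>2" using 1 by (intro mult_left_le) auto
  also have "\<dots> = (4 / R)\<^sup>2" by (simp add: power2_eq_square)
  finally show "\<bar>cutoff' R x\<bar> \<le> 4 / R" using assms(1) by (metis abs_le_square_iff abs_of_nonneg divide_nonneg_pos zero_le_numeral)
qed

lemma cutoff_boundary: "R > 0 \<Longrightarrow> cutoff R R = 0" "R > 0 \<Longrightarrow> cutoff R (-R) = 0"
  by (auto simp: cutoff_def)

lemma cutoff_tendsto: "(\<lambda>n. cutoff (real (Suc n)) x) \<longlonglongrightarrow> 1"
proof -
  have "(\<lambda>n. (1 - (x * inverse (real (Suc n)))\<^sup>2)\<^sup>2) \<longlonglongrightarrow> (1 - (x * 0)\<^sup>2)\<^sup>2"
    by (intro tendsto_intros LIMSEQ_inverse_real_of_nat)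
  then show ?thesis by (simp add: cutoff_def divide_inverse)
qed

text \<open>Nothing bounds \<open>p\<close>: the boundary terms contain \<open>cutoff R\<close> and
  vanish however large \<open>p\<close> is. In the application \<open>V\<close> grows like x^2, so
  integrability of \<open>V * F\<^sup>2\<close> is a condition of its own.\<close>

locale cutoff_picone =
  fixes p V F g :: "real \<Rightarrow> real"
  assumes p: "\<And>x. (p has_real_derivative V x - (p x)\<^sup>2) (at x)" and V: "continuous_on UNIV V"
    and F: "ac_deriv F g" and iF: "integrable lborel (\<lambda>x. (F x)\<^sup>2)" and ig: "integrable lborel (\<lambda>x. (g x)\<^sup>2)"
    and iV: "integrable lborel (\<lambda>x. V x * (F x)\<^sup>2)"
begin

text \<open>\<open>form R\<close> is \<open>(\<chi> F)'\<^sup>2 + V (\<chi> F)\<^sup>2\<close> for the cutoff \<open>\<chi>\<close>, and \<open>p' = V - p\<^sup>2\<close> makes \<open>p\<close> the logarithmic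
  derivative of a solution of \<open>u'' = V u\<close>.\<close>

definition form :: "real \<Rightarrow> real \<Rightarrow> real" where
  "form R x = (cutoff R x)\<^sup>2 * ((g x)\<^sup>2 + V x * (F x)\<^sup>2)
     + 2 * cutoff R x * cutoff' R x * F x * g x + (cutoff' R x)\<^sup>2 * (F x)\<^sup>2"

lemma form_integrable: "set_integrable lborel {a..b} (form R)"
proof -
  have FF: "ac_deriv (\<lambda>x. (F x)\<^sup>2) (\<lambda>x. 2 * F x * g x)"
    using ac_deriv_mult[OF F F] by (simp add: power2_eq_square algebra_simps)
  have cF: "continuous_on S F" and cV: "continuous_on S V" for S
    using ac_deriv_continuous[OF F] V by (auto intro: continuous_on_subset)
  have "set_integrable lborel {a..b} (\<lambda>x. (g x)\<^sup>2)"
    unfolding set_integrable_def using ig by (intro integrable_mult_indicator) auto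
  then have "set_integrable lborel {a..b} (\<lambda>x. (cutoff R x)\<^sup>2 * (g x)\<^sup>2)"
    by (intro set_integrable_continuous_mult continuous_intros cutoff_continuous)
  moreover have "set_integrable lborel {a..b} (\<lambda>x. (cutoff R x * cutoff' R x) * (2 * F x * g x))"
    by (intro set_integrable_continuous_mult continuous_intros cutoff_continuous ac_deriv_D(2)[OF FF])
  moreover have "set_integrable lborel {a..b} (\<lambda>x. ((cutoff R x)\<^sup>2 * V x + (cutoff' R x)\<^sup>2) * (F x)\<^sup>2)"
    by (intro borel_integrable_atLeastAtMost' continuous_intros cutoff_continuous cF cV)
  ultimately have "set_integrable lborel {a..b} (\<lambda>x. (cutoff R x)\<^sup>2 * (g x)\<^sup>2 +
     (cutoff R x * cutoff' R x) * (2 * F x * g x) + ((cutoff R x)\<^sup>2 * V x + (cutoff' R x)\<^sup>2) * (F x)\<^sup>2)"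
    by (intro set_integral_add)
  then show ?thesis
    by (rule back_subst[of "set_integrable lborel {a..b}"]) (simp add: form_def fun_eq_iff algebra_simps)
qed

text \<open>Picone's identity: \<open>form R\<close> exceeds the square by the derivative
  \<open>d\<close> of \<open>(cutoff R x)\<^sup>2 * p x * (F x)\<^sup>2\<close>, whose integral
  vanishes. The Riccati equation of \<open>p\<close> supplies the term with
  \<open>V\<close>.\<close>

lemma form_square:
  assumes "R > 0"
  defines "s \<equiv> \<lambda>x. (cutoff R x * (g x - p x * F x) + cutoff' R x * F x)\<^sup>2"
  shows "set_integrable lborel {-R..R} s" "(LINT x:{-R..R}|lborel. form R x) = (LINT x:{-R..R}|lborel. s x)"
proof -
  define d where "d x = (2 * cutoff R x * cutoff' R x * p x + (cutoff R x)\<^sup>2 * (V x - (p x)\<^sup>2)) * (F x)\<^sup>2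
     + ((cutoff R x)\<^sup>2 * p x) * (2 * F x * g x)" for x
  have FF: "ac_deriv (\<lambda>x. (F x)\<^sup>2) (\<lambda>x. 2 * F x * g x)"
    using ac_deriv_mult[OF F F] by (simp add: power2_eq_square algebra_simps)
  have cp: "continuous_on S p" for S by (intro continuous_at_imp_continuous_on ballI DERIV_isCont[OF p])
  have cV: "continuous_on S V" for S using V by (auto intro: continuous_on_subset)
  have "ac_deriv (\<lambda>x. (cutoff R x)\<^sup>2 * p x) (\<lambda>x. 2 * cutoff R x * cutoff' R x * p x + (cutoff R x)\<^sup>2 * (V x - (p x)\<^sup>2))"
  proof (rule ac_deriv_C1)
    show "((\<lambda>x. (cutoff R x)\<^sup>2 * p x) has_real_derivative
        2 * cutoff R x * cutoff' R x * p x + (cutoff R x)\<^sup>2 * (V x - (p x)\<^sup>2)) (at x)" for x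
      using DERIV_mult[OF DERIV_power[OF cutoff_deriv[of R x], of 2] p[of x]] by (simp add: algebra_simps)
  qed (intro continuous_intros cutoff_continuous cp cV)
  from ac_deriv_mult[OF this FF]
  have D: "ac_deriv (\<lambda>x. (cutoff R x)\<^sup>2 * p x * (F x)\<^sup>2) d" unfolding d_def .
  have d0: "(LINT x:{-R..R}|lborel. d x) = 0"
    using ac_deriv_D(3)[OF D, of "-R" R] assms(1) by (simp add: cutoff_boundary)
  have s: "s = (\<lambda>x. form R x - d x)"
    unfolding s_def form_def d_def by (auto simp: fun_eq_iff power2_eq_square algebra_simps)
  show "set_integrable lborel {-R..R} s"
    unfolding s using form_integrable ac_deriv_D(2)[OF D] by (rule set_integral_diff)
  show "(LINT x:{-R..R}|lborel. form R x) = (LINT x:{-R..R}|lborel. s x)"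
    unfolding s using d0 set_integral_diff(2)[OF form_integrable ac_deriv_D(2)[OF D]] by simp
qed

text \<open>Along the radii \<open>Suc n\<close>, which are at least 1, the cutoff is at most 1 and
  its derivative at most 4 in absolute value. This gives the weights 4 and 16 of the dominating
  function.\<close>

lemma form_tendsto:
  "(\<lambda>n. LINT x:{-real (Suc n)..real (Suc n)}|lborel. form (real (Suc n)) x) \<longlonglongrightarrow> (LINT x|lborel. (g x)\<^sup>2 + V x * (F x)\<^sup>2)"
  unfolding set_lebesgue_integral_def
proof (rule integral_dominated_convergence[where w = "\<lambda>x. (g x)\<^sup>2 + \<bar>V x * (F x)\<^sup>2\<bar> + 4 * ((F x)\<^sup>2 + (g x)\<^sup>2) + 16 * (F x)\<^sup>2"])
  have [measurable]: "g \<in> borel_measurable borel" "F \<in> borel_measurable borel" "V \<in> borel_measurable borel"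
    using ac_deriv_D(1)[OF F] ac_deriv_measurable[OF F] borel_measurable_continuous_onI[OF V] by auto
  show "(\<lambda>x. (g x)\<^sup>2 + V x * (F x)\<^sup>2) \<in> borel_measurable lborel" by simp
  show "(\<lambda>x. indicator {-real (Suc n)..real (Suc n)} x *\<^sub>R form (real (Suc n)) x) \<in> borel_measurable lborel" for n
    using borel_measurable_integrable[OF form_integrable[unfolded set_integrable_def]] .
  show "integrable lborel (\<lambda>x. (g x)\<^sup>2 + \<bar>V x * (F x)\<^sup>2\<bar> + 4 * ((F x)\<^sup>2 + (g x)\<^sup>2) + 16 * (F x)\<^sup>2)"
    using iF ig iV by simp
  show "AE x in lborel. norm (indicator {-real (Suc n)..real (Suc n)} x *\<^sub>R form (real (Suc n)) x)
     \<le> (g x)\<^sup>2 + \<bar>V x * (F x)\<^sup>2\<bar> + 4 * ((F x)\<^sup>2 + (g x)\<^sup>2) + 16 * (F x)\<^sup>2" for n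
  proof (rule AE_I2)
    fix x
    define R where "R = real (Suc n)"
    have R: "R \<ge> 1" by (simp add: R_def)
    have nn: "0 \<le> (g x)\<^sup>2 + \<bar>V x * (F x)\<^sup>2\<bar>" "0 \<le> 4 * ((F x)\<^sup>2 + (g x)\<^sup>2)" "0 \<le> 16 * (F x)\<^sup>2" by simp_all
    have "\<bar>form R x\<bar> \<le> (g x)\<^sup>2 + \<bar>V x * (F x)\<^sup>2\<bar> + 4 * ((F x)\<^sup>2 + (g x)\<^sup>2) + 16 * (F x)\<^sup>2" if "x \<in> {-R..R}"
    proof -
      have c: "0 \<le> cutoff R x" "cutoff R x \<le> 1" "\<bar>cutoff' R x\<bar> \<le> 4 / R" using cutoff_bounds[of R x] R that by auto
      have c': "\<bar>cutoff' R x\<bar> \<le> 4" 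
      proof -
        have "4 / R \<le> 4 / 1" using R by (intro divide_left_mono) auto
        then show ?thesis using c(3) by simp
      qed
      have "\<bar>(cutoff R x)\<^sup>2 * ((g x)\<^sup>2 + V x * (F x)\<^sup>2)\<bar> \<le> 1 * \<bar>(g x)\<^sup>2 + V x * (F x)\<^sup>2\<bar>"
        unfolding abs_mult using c by (intro mult_right_mono) (auto simp: power_le_one)
      moreover have "\<bar>(g x)\<^sup>2 + V x * (F x)\<^sup>2\<bar> \<le> (g x)\<^sup>2 + \<bar>V x * (F x)\<^sup>2\<bar>"
        using abs_triangle_ineq[of "(g x)\<^sup>2" "V x * (F x)\<^sup>2"] by simp
      moreover have "\<bar>2 * cutoff R x * cutoff' R x * F x * g x\<bar> \<le> 4 * ((F x)\<^sup>2 + (g x)\<^sup>2)"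
      proof -
        have "\<bar>2 * cutoff R x * cutoff' R x * F x * g x\<bar> = (cutoff R x * \<bar>cutoff' R x\<bar>) * (2 * \<bar>F x\<bar> * \<bar>g x\<bar>)"
          using c(1) by (simp add: abs_mult)
        also have "\<dots> \<le> (1 * 4) * (2 * \<bar>F x\<bar> * \<bar>g x\<bar>)"
          using c c' by (intro mult_right_mono mult_mono) auto
        also have "\<dots> \<le> 4 * ((F x)\<^sup>2 + (g x)\<^sup>2)"
          using sum_squares_bound[of "\<bar>F x\<bar>" "\<bar>g x\<bar>"] by simp
        finally show ?thesis .
      qed
      moreover have "\<bar>(cutoff' R x)\<^sup>2 * (F x)\<^sup>2\<bar> \<le> 16 * (F x)\<^sup>2"
        using power_mono[OF c', of 2] by (simp add: abs_mult mult_right_mono)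
      moreover have "\<bar>s\<bar> \<le> 1 * s' \<Longrightarrow> s' \<le> s'' \<Longrightarrow> \<bar>t\<bar> \<le> t' \<Longrightarrow> \<bar>u\<bar> \<le> u' \<Longrightarrow> \<bar>s + t + u\<bar> \<le> s'' + t' + u'"
        for s s' s'' t t' u u' :: real by linarith
      ultimately show ?thesis unfolding form_def by blast
    qed
    then show "norm (indicator {-real (Suc n)..real (Suc n)} x *\<^sub>R form (real (Suc n)) x)
     \<le> (g x)\<^sup>2 + \<bar>V x * (F x)\<^sup>2\<bar> + 4 * ((F x)\<^sup>2 + (g x)\<^sup>2) + 16 * (F x)\<^sup>2"
      unfolding R_def[symmetric] using nn by (cases "x \<in> {-R..R}") simp_all
  qed
  show "AE x in lborel. (\<lambda>n. indicator {-real (Suc n)..real (Suc n)} x *\<^sub>R form (real (Suc n)) x) \<longlonglongrightarrow> (g x)\<^sup>2 + V x * (F x)\<^sup>2"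
  proof (rule AE_I2)
    fix x
    have inv: "(\<lambda>n. inverse (real (Suc n))) \<longlonglongrightarrow> 0" by (rule LIMSEQ_inverse_real_of_nat)
    have "(\<lambda>n. - 4 * x * (inverse (real (Suc n)))\<^sup>2 * (1 - (x * inverse (real (Suc n)))\<^sup>2)) \<longlonglongrightarrow> - 4 * x * 0\<^sup>2 * (1 - (x * 0)\<^sup>2)"
      by (intro tendsto_intros inv)
    then have c': "(\<lambda>n. cutoff' (real (Suc n)) x) \<longlonglongrightarrow> 0"
      by (simp add: cutoff'_def divide_inverse power_inverse)
    have "(\<lambda>n. form (real (Suc n)) x) \<longlonglongrightarrow> 1\<^sup>2 * ((g x)\<^sup>2 + V x * (F x)\<^sup>2) + 2 * 1 * 0 * F x * g x + 0\<^sup>2 * (F x)\<^sup>2"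
      unfolding form_def by (intro tendsto_intros cutoff_tendsto c')
    moreover have "eventually (\<lambda>n. form (real (Suc n)) x = indicator {-real (Suc n)..real (Suc n)} x *\<^sub>R form (real (Suc n)) x) sequentially"
    proof -
      obtain N :: nat where "\<bar>x\<bar> \<le> real N" using real_arch_simple by blast
      then have "x \<in> {-real (Suc n)..real (Suc n)}" if "n \<ge> N" for n
        using that by auto
      then show ?thesis unfolding eventually_sequentially by (intro exI[of _ N]) simp
    qed
    ultimately show "(\<lambda>n. indicator {-real (Suc n)..real (Suc n)} x *\<^sub>R form (real (Suc n)) x) \<longlonglongrightarrow> (g x)\<^sup>2 + V x * (F x)\<^sup>2"
      using Lim_transform_eventually by fastforce
  qed
qed

lemma nonneg: "0 \<le> (LINT x|lborel. (g x)\<^sup>2 + V x * (F x)\<^sup>2)"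
proof (rule LIMSEQ_le_const[OF form_tendsto])
  have "0 \<le> (LINT x:{-real (Suc n)..real (Suc n)}|lborel. form (real (Suc n)) x)" for n
    using form_square(2)[of "real (Suc n)"]
    by (simp add: set_lebesgue_integral_def integral_nonneg_AE)
  then show "\<exists>N. \<forall>n\<ge>N. 0 \<le> (LINT x:{-real (Suc n)..real (Suc n)}|lborel. form (real (Suc n)) x)" by blast
qed

text \<open>For a solution of \<open>F' = p F\<close> the square in Picone's identity collapses to
  \<open>(cutoff' R x)\<^sup>2 * (F x)\<^sup>2\<close>, at most
  \<open>16 / R\<^sup>2 * (F x)\<^sup>2\<close>, which square-integrability of \<open>F\<close>
  sends to zero.\<close>

lemma eq_zero:
  assumes "\<And>x. g x = p x * F x"
  shows "(LINT x|lborel. (g x)\<^sup>2 + V x * (F x)\<^sup>2) = 0"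
proof (rule antisym[OF LIMSEQ_le[OF form_tendsto] nonneg])
  show "(\<lambda>n. 16 * (LINT x|lborel. (F x)\<^sup>2) * (inverse (real (Suc n)))\<^sup>2) \<longlonglongrightarrow> 0"
  proof -
    have "(\<lambda>n. 16 * (LINT x|lborel. (F x)\<^sup>2) * (inverse (real (Suc n)))\<^sup>2) \<longlonglongrightarrow> 16 * (LINT x|lborel. (F x)\<^sup>2) * 0\<^sup>2"
      by (intro tendsto_intros LIMSEQ_inverse_real_of_nat)
    then show ?thesis by simp
  qed
  have "(LINT x:{-R..R}|lborel. form R x) \<le> 16 * (LINT x|lborel. (F x)\<^sup>2) * (inverse R)\<^sup>2" if R: "R > 0" for R
  proof -
    have "(LINT x:{-R..R}|lborel. form R x) = (LINT x:{-R..R}|lborel. (cutoff R x * (g x - p x * F x) + cutoff' R x * F x)\<^sup>2)"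
      by (rule form_square(2)[OF R])
    also have "\<dots> \<le> (LINT x|lborel. 16 / R\<^sup>2 * (F x)\<^sup>2)"
      unfolding set_lebesgue_integral_def
    proof (rule integral_mono)
      show "integrable lborel (\<lambda>x. indicator {-R..R} x *\<^sub>R (cutoff R x * (g x - p x * F x) + cutoff' R x * F x)\<^sup>2)"
        using form_square(1)[OF R] by (simp add: set_integrable_def)
      show "integrable lborel (\<lambda>x. 16 / R\<^sup>2 * (F x)\<^sup>2)" using iF by simp
      fix x
      show "indicator {-R..R} x *\<^sub>R (cutoff R x * (g x - p x * F x) + cutoff' R x * F x)\<^sup>2 \<le> 16 / R\<^sup>2 * (F x)\<^sup>2"
      proof (cases "x \<in> {-R..R}")
        case True
        have "(cutoff' R x)\<^sup>2 \<le> 16 / R\<^sup>2"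
          using power_mono[OF cutoff_bounds(4)[OF R True], of 2] by (simp add: power_divide)
        then have "(cutoff' R x)\<^sup>2 * (F x)\<^sup>2 \<le> 16 / R\<^sup>2 * (F x)\<^sup>2" by (rule mult_right_mono) simp
        then show ?thesis using True by (simp add: assms power_mult_distrib)
      qed simp
    qed
    finally show ?thesis by (simp add: power_inverse divide_inverse mult_ac)
  qed
  then show "\<exists>N. \<forall>n\<ge>N. (LINT x:{-real (Suc n)..real (Suc n)}|lborel. form (real (Suc n)) x)
     \<le> 16 * (LINT x|lborel. (F x)\<^sup>2) * (inverse (real (Suc n)))\<^sup>2"
    by (metis of_nat_0_less_iff zero_less_Suc)
qed

end

section \<open>Positive solutions without decay assumptions\<close>

text \<open>The nonlinear equations read as linear ones: the squares of the unknowns are frozen into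
  the potential \<open>V\<close>, so that Picone's identity can compare solutions of different
  equations.\<close>

definition positive_solution :: "(real \<Rightarrow> real) \<Rightarrow> (real \<Rightarrow> real) \<Rightarrow> bool" where
  "positive_solution V u \<longleftrightarrow> twice_differentiable u \<and> (\<forall>x. u x > 0) \<and> (\<forall>x. deriv (deriv u) x = V x * u x)"

lemma positive_solution_D:
  assumes "positive_solution V u"
  shows "(u has_real_derivative deriv u x) (at x)" "(deriv u has_real_derivative V x * u x) (at x)" "u x > 0"
    "continuous_on S u" "continuous_on S (deriv u)"
proof -
  have d: "(u has_real_derivative deriv u x) (at x)" "(deriv u has_real_derivative V x * u x) (at x)" for x
    using assms by (auto simp: positive_solution_def twice_differentiable_def DERIV_deriv_iff_real_differentiable)
      (metis DERIV_deriv_iff_real_differentiable)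
  show "(u has_real_derivative deriv u x) (at x)" "(deriv u has_real_derivative V x * u x) (at x)" "u x > 0"
    using d assms by (auto simp: positive_solution_def)
  show "continuous_on S u" "continuous_on S (deriv u)"
    by (intro continuous_at_imp_continuous_on ballI DERIV_isCont[OF d(1)] DERIV_isCont[OF d(2)])+
qed

lemma log_derivative_Riccati:
  assumes "positive_solution V u"
  shows "((\<lambda>x. deriv u x / u x) has_real_derivative V x - (deriv u x / u x)\<^sup>2) (at x)"
  using positive_solution_D(1-3)[OF assms, of x]
  by (auto intro!: derivative_eq_intros simp: field_simps power2_eq_square)

text \<open>The difference of the two logarithmic derivatives, multiplied by
  \<open>(cutoff R x)\<^sup>2 * (v x)\<^sup>2\<close>, vanishes at both ends, so its derivative
  \<open>D\<close> integrates to zero; the integrand of the claim dominates \<open>D\<close>. The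
  gauge integral is convenient because its fundamental theorem asks only for a derivative at every
  point.\<close>

lemma picone_comparison:
  assumes u: "positive_solution U u" and v: "positive_solution V v"
    and U: "continuous_on UNIV U" and V: "continuous_on UNIV V" and "R > 0"
  shows "0 \<le> integral {-R..R} (\<lambda>x. (cutoff R x)\<^sup>2 * (U x - V x) * (v x)\<^sup>2 + (cutoff' R x)\<^sup>2 * (v x)\<^sup>2)"
proof -
  define p where "p x = deriv u x / u x" for x
  define q where "q x = deriv v x / v x" for x
  define D where "D x = 2 * cutoff R x * cutoff' R x * (p x - q x) * (v x)\<^sup>2
     + (cutoff R x)\<^sup>2 * ((U x - (p x)\<^sup>2) - (V x - (q x)\<^sup>2)) * (v x)\<^sup>2
     + (cutoff R x)\<^sup>2 * (p x - q x) * (2 * v x * deriv v x)" for x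
  have p: "(p has_real_derivative U x - (p x)\<^sup>2) (at x)" and q: "(q has_real_derivative V x - (q x)\<^sup>2) (at x)" for x
    using log_derivative_Riccati[OF u] log_derivative_Riccati[OF v] by (simp_all add: p_def[abs_def] q_def[abs_def])
  have "((\<lambda>x. ((cutoff R x)\<^sup>2 * (p x - q x)) * (v x)\<^sup>2) has_real_derivative D x) (at x)" for x
    using DERIV_mult[OF DERIV_mult[OF DERIV_power[OF cutoff_deriv[of R x], of 2] DERIV_diff[OF p[of x] q[of x]]]
       DERIV_power[OF positive_solution_D(1)[OF v, of x], of 2]]
    by (simp add: D_def algebra_simps)
  then have "(D has_integral (cutoff R R)\<^sup>2 * (p R - q R) * (v R)\<^sup>2 - (cutoff R (-R))\<^sup>2 * (p (-R) - q (-R)) * (v (-R))\<^sup>2) {-R..R}"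
    using \<open>R > 0\<close> by (intro fundamental_theorem_of_calculus)
      (auto simp: has_real_derivative_iff_has_vector_derivative[symmetric] intro: DERIV_subset)
  then have D0: "(D has_integral 0) {-R..R}" using \<open>R > 0\<close> by (simp add: cutoff_boundary)
  have cont: "continuous_on {-R..R} U" "continuous_on {-R..R} V"
    using U V by (auto intro: continuous_on_subset)
  have "(\<lambda>x. (cutoff R x)\<^sup>2 * (U x - V x) * (v x)\<^sup>2 + (cutoff' R x)\<^sup>2 * (v x)\<^sup>2) integrable_on {-R..R}"
    by (intro integrable_continuous_real continuous_intros cutoff_continuous cont positive_solution_D(4)[OF v])
  then have I: "((\<lambda>x. (cutoff R x)\<^sup>2 * (U x - V x) * (v x)\<^sup>2 + (cutoff' R x)\<^sup>2 * (v x)\<^sup>2) has_integral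
     integral {-R..R} (\<lambda>x. (cutoff R x)\<^sup>2 * (U x - V x) * (v x)\<^sup>2 + (cutoff' R x)\<^sup>2 * (v x)\<^sup>2)) {-R..R}"
    by (rule integrable_integral)
  show ?thesis
  proof (rule has_integral_le[OF D0 I])
    fix x
    define c where "c = cutoff R x"
    define c' where "c' = cutoff' R x"
    have vq: "deriv v x = q x * v x" using positive_solution_D(3)[OF v, of x] by (simp add: q_def)
    \<comment> \<open>Completing the square removes \<open>p\<close> and \<open>q\<close>, so no bound on the logarithmic derivatives is needed.\<close>
    have "0 \<le> (c * (p x - q x) - c')\<^sup>2 * (v x)\<^sup>2" by simp
    also have "\<dots> = c\<^sup>2 * (U x - V x) * (v x)\<^sup>2 + c'\<^sup>2 * (v x)\<^sup>2 - D x"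
      unfolding D_def c_def[symmetric] c'_def[symmetric] vq by (simp add: power2_eq_square algebra_simps)
    finally show "D x \<le> (cutoff R x)\<^sup>2 * (U x - V x) * (v x)\<^sup>2 + (cutoff' R x)\<^sup>2 * (v x)\<^sup>2"
      by (simp add: c_def c'_def)
  qed
qed

section \<open>Uniqueness for the coupled system\<close>

lemma quadratic_form_lower_bound:
  fixes a b \<gamma> :: real
  assumes "0 < \<gamma>" "\<gamma> < 1"
  shows "(1 - \<gamma>) * (a\<^sup>2 + b\<^sup>2) \<le> (a + \<gamma> * b) * a + (\<gamma> * a + b) * b"
proof -
  have "0 \<le> \<gamma> * (a + b)\<^sup>2" using assms by simp
  then show ?thesis by (simp add: power2_eq_square algebra_simps)
qed

text \<open>Since \<open>d\<close> is bounded by a multiple of \<open>c\<close>, the quadratic term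
  comes with the weight \<open>c\<^sup>2\<close>. With \<open>c\<close> the cutoff this is the
  weight of the coercive term that has to absorb it, and the remainder is free of
  \<open>t\<close>.\<close>

lemma weighted_Young:
  fixes k \<delta> t c :: real
  assumes "\<delta> > 0" "0 \<le> c" "0 \<le> d" "d \<le> m * c"
  shows "d * t \<le> \<delta> * c\<^sup>2 * t\<^sup>2 + m\<^sup>2 / (4 * \<delta>)"
proof -
  have "d * t \<le> d * \<bar>t\<bar>" using assms by (intro mult_left_mono) auto
  also have "\<dots> \<le> m * c * \<bar>t\<bar>" using assms by (intro mult_right_mono) auto
  also have "\<dots> \<le> \<delta> * (c * \<bar>t\<bar>)\<^sup>2 + m\<^sup>2 / (4 * \<delta>)"
  proof -
    have "0 \<le> \<delta> * (c * \<bar>t\<bar> - m / (2 * \<delta>))\<^sup>2" using assms by simp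
    also have "\<dots> = \<delta> * (c * \<bar>t\<bar>)\<^sup>2 - m * c * \<bar>t\<bar> + m\<^sup>2 / (4 * \<delta>)"
      using assms(1) by (simp add: power2_diff field_simps power2_eq_square)
    finally show ?thesis by simp
  qed
  finally show ?thesis by (simp add: power_mult_distrib mult.assoc)
qed

text \<open>On a fixed window \<open>{-K..K}\<close> with \<open>2 * K \<le> R\<close> the cutoff is
  at least (1 - 1/4)^2 = 9/16. The integral of \<open>f\<close> over the window is thus bounded by a
  multiple of \<open>C / R\<close> for all large \<open>R\<close>, hence zero.\<close>

lemma continuous_zero_if_interval_integrals_vanish:
  fixes f :: "real \<Rightarrow> real"
  assumes f: "continuous_on UNIV f" "\<And>x. 0 \<le> f x"
    and small: "\<And>R. 1 \<le> R \<Longrightarrow> integral {-R..R} (\<lambda>x. (cutoff R x)\<^sup>2 * f x) \<le> C / R"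
  shows "f x = 0"
proof -
  define K where "K = \<bar>x\<bar> + 1"
  have cf: "continuous_on S f" for S using f(1) by (rule continuous_on_subset) simp
  have le: "(9/16)\<^sup>2 * integral {-K..K} f \<le> C / R" if R: "2 * K \<le> R" for R
  proof -
    have "R > 0" "R \<ge> 1" "K > 0" using R by (auto simp: K_def)
    have "(9/16)\<^sup>2 * integral {-K..K} f = integral {-K..K} (\<lambda>x. (9/16)\<^sup>2 * f x)" by simp
    also have "\<dots> \<le> integral {-K..K} (\<lambda>x. (cutoff R x)\<^sup>2 * f x)"
    proof (rule integral_le)
      show "(\<lambda>x. (9/16)\<^sup>2 * f x) integrable_on {-K..K}" "(\<lambda>x. (cutoff R x)\<^sup>2 * f x) integrable_on {-K..K}"
        by (intro integrable_continuous_real continuous_intros cutoff_continuous cf)+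
      fix y assume y: "y \<in> {-K..K}"
      have "\<bar>y\<bar> \<le> K" using y by auto
      then have "\<bar>y / R\<bar> \<le> 1 / 2" using R \<open>R > 0\<close> by (simp add: field_simps)
      then have "(y / R)\<^sup>2 \<le> (1/2)\<^sup>2" by (metis abs_le_square_iff abs_of_pos half_gt_zero_iff zero_less_one)
      then have "3/4 \<le> 1 - (y / R)\<^sup>2" by (simp add: power2_eq_square)
      then have "(3/4)\<^sup>2 \<le> cutoff R y" unfolding cutoff_def by (intro power_mono) auto
      then have "((3/4)\<^sup>2)\<^sup>2 \<le> (cutoff R y)\<^sup>2" by (intro power_mono) auto
      then show "(9/16)\<^sup>2 * f y \<le> (cutoff R y)\<^sup>2 * f y"
        using f(2)[of y] by (intro mult_right_mono) (auto simp: power2_eq_square)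
    qed
    also have "\<dots> \<le> integral {-R..R} (\<lambda>x. (cutoff R x)\<^sup>2 * f x)"
      using R \<open>K > 0\<close> f(2)
      by (intro integral_subset_le integrable_continuous_real continuous_intros cutoff_continuous cf) auto
    also have "\<dots> \<le> C / R" using small \<open>R \<ge> 1\<close> by simp
    finally show ?thesis .
  qed
  have "(9/16)\<^sup>2 * integral {-K..K} f \<le> 0"
  proof (rule tendsto_lowerbound)
    show "((\<lambda>R. C / R) \<longlongrightarrow> 0) at_top" by real_asymp
    show "\<forall>\<^sub>F R in at_top. (9/16)\<^sup>2 * integral {-K..K} f \<le> C / R"
      using eventually_ge_at_top[of "2 * K"] by eventually_elim (rule le)
  qed simp
  moreover have "0 \<le> integral {-K..K} f" using f(2) cf by (intro integral_nonneg integrable_continuous_real) auto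
  ultimately have "integral {-K..K} f = 0" by (simp add: power2_eq_square)
  then have "\<forall>y\<in>{-K..K}. f y = 0"
    using integral_eq_0_iff[of "-K" K f] cf f(2) by (simp add: K_def)
  moreover have "x \<in> {-K..K}" by (auto simp: K_def)
  ultimately show ?thesis by blast
qed

text \<open>Comparing in one direction only leaves the weight \<open>e\<^sup>2\<close> on a
  potential difference of unknown sign. The two directions together turn the weight into
  \<open>e\<^sup>2 - \<psi>1\<^sup>2 = - a\<close>, and likewise \<open>- b\<close>, so the
  potential terms combine into a quadratic form in \<open>a\<close> and \<open>b\<close> that is
  definite for \<gamma> < 1.\<close>

lemma coupled_comparison:
  fixes \<psi>1 \<psi>2 e :: "real \<Rightarrow> real"
  assumes \<epsilon>: "\<epsilon> > 0" and \<gamma>: "0 < \<gamma>" "\<gamma> < 1"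
    and 1: "positive_solution (\<lambda>x. (x\<^sup>2 - 1 + (\<psi>1 x)\<^sup>2 + \<gamma> * (\<psi>2 x)\<^sup>2) / \<epsilon>\<^sup>2) \<psi>1"
    and 2: "positive_solution (\<lambda>x. (x\<^sup>2 - 1 + \<gamma> * (\<psi>1 x)\<^sup>2 + (\<psi>2 x)\<^sup>2) / \<epsilon>\<^sup>2) \<psi>2"
    and e: "positive_solution (\<lambda>x. (x\<^sup>2 - 1 + (1 + \<gamma>) * (e x)\<^sup>2) / \<epsilon>\<^sup>2) e"
    and M: "\<And>x. (e x)\<^sup>2 \<le> M"
  shows "\<psi>1 x = e x \<and> \<psi>2 x = e x"
proof -
  define a where "a x = (\<psi>1 x)\<^sup>2 - (e x)\<^sup>2" for x
  define b where "b x = (\<psi>2 x)\<^sup>2 - (e x)\<^sup>2" for x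
  define U where "U x = (x\<^sup>2 - 1 + (\<psi>1 x)\<^sup>2 + \<gamma> * (\<psi>2 x)\<^sup>2) / \<epsilon>\<^sup>2" for x
  define V where "V x = (x\<^sup>2 - 1 + \<gamma> * (\<psi>1 x)\<^sup>2 + (\<psi>2 x)\<^sup>2) / \<epsilon>\<^sup>2" for x
  define W where "W x = (x\<^sup>2 - 1 + (1 + \<gamma>) * (e x)\<^sup>2) / \<epsilon>\<^sup>2" for x
  note s = 1[folded U_def] 2[folded V_def] e[folded W_def]
  note c = positive_solution_D(4)[OF s(1)] positive_solution_D(4)[OF s(2)] positive_solution_D(4)[OF s(3)]
  have cUVW: "continuous_on S U" "continuous_on S V" "continuous_on S W" for S
    unfolding U_def V_def W_def using \<epsilon> by (auto intro!: continuous_intros c)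
  have cab: "continuous_on S a" "continuous_on S b" for S
    unfolding a_def b_def by (auto intro!: continuous_intros c)
  \<comment> \<open>Half of the coercivity constant \<open>1 - \<gamma>\<close> absorbs the Young
    terms; the other half survives.\<close>
  define \<delta> where "\<delta> = (1 - \<gamma>) / 2"
  have \<delta>: "\<delta> > 0" using \<gamma> by (simp add: \<delta>_def)
  \<comment> \<open>Chosen so that \<open>2 * R * B \<le> \<delta> * (C / R)\<close>: the constant
    \<open>B\<close> is integrated over length \<open>2 * R\<close>, its Young part is of order
    R^(-4) and its part with \<open>M\<close> of order R^(-2), and \<open>1 \<le> R\<close>.\<close>
  define C where "C = 2 * (2 * ((16 * \<epsilon>\<^sup>2)\<^sup>2 / (4 * \<delta>)) + 64 * \<epsilon>\<^sup>2 * \<bar>M\<bar>) / \<delta>"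
  have "integral {-R..R} (\<lambda>x. (cutoff R x)\<^sup>2 * ((a x)\<^sup>2 + (b x)\<^sup>2)) \<le> C / R" if "1 \<le> R" for R
  proof -
    have R: "R > 0" using that by simp
    define k where "k U V v x = (cutoff R x)\<^sup>2 * (U x - V x) * (v x)\<^sup>2 + (cutoff' R x)\<^sup>2 * (v x)\<^sup>2"
      for U V v :: "real \<Rightarrow> real" and x
    define m where "m = 16 * \<epsilon>\<^sup>2 / R\<^sup>2"
    define B where "B = 2 * (m\<^sup>2 / (4 * \<delta>)) + 64 * \<epsilon>\<^sup>2 / R\<^sup>2 * \<bar>M\<bar>"
    have ki: "k U W e integrable_on {-R..R}" "k W U \<psi>1 integrable_on {-R..R}"
      "k V W e integrable_on {-R..R}" "k W V \<psi>2 integrable_on {-R..R}"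
      unfolding k_def by (intro integrable_continuous_real continuous_intros cutoff_continuous c cUVW)+
    have "0 \<le> integral {-R..R} (k U W e) + integral {-R..R} (k W U \<psi>1)
             + integral {-R..R} (k V W e) + integral {-R..R} (k W V \<psi>2)"
      unfolding k_def
      by (intro add_nonneg_nonneg picone_comparison[OF s(1) s(3)] picone_comparison[OF s(3) s(1)]
           picone_comparison[OF s(2) s(3)] picone_comparison[OF s(3) s(2)] cUVW R)
    also have "\<dots> = integral {-R..R} (\<lambda>x. k U W e x + k W U \<psi>1 x + k V W e x + k W V \<psi>2 x)"
      using ki by (simp add: Henstock_Kurzweil_Integration.integral_add integrable_add)
    also have "\<dots> \<le> integral {-R..R} (\<lambda>x. (B - \<delta> * ((cutoff R x)\<^sup>2 * ((a x)\<^sup>2 + (b x)\<^sup>2))) / \<epsilon>\<^sup>2)"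
    proof (rule integral_le)
      show "(\<lambda>x. k U W e x + k W U \<psi>1 x + k V W e x + k W V \<psi>2 x) integrable_on {-R..R}"
        using ki by (intro integrable_add)
      show "(\<lambda>x. (B - \<delta> * ((cutoff R x)\<^sup>2 * ((a x)\<^sup>2 + (b x)\<^sup>2))) / \<epsilon>\<^sup>2) integrable_on {-R..R}"
        using \<epsilon> by (auto intro!: integrable_continuous_real continuous_intros cutoff_continuous cab)
      fix x assume x: "x \<in> {-R..R}"
      define t where "t = (cutoff R x)\<^sup>2"
      define d where "d = (cutoff' R x)\<^sup>2"
      have d: "\<epsilon>\<^sup>2 * d \<le> m * cutoff R x" "0 \<le> \<epsilon>\<^sup>2 * d"
        using mult_left_mono[OF cutoff_bounds(3)[OF R x], of "\<epsilon>\<^sup>2"] by (simp_all add: m_def d_def mult_ac)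
      have cc: "0 \<le> cutoff R x" "cutoff R x \<le> 1" using cutoff_bounds[OF R x] by auto
      have Y: "\<epsilon>\<^sup>2 * d * z \<le> \<delta> * t * z\<^sup>2 + m\<^sup>2 / (4 * \<delta>)" for z
        unfolding t_def by (rule weighted_Young[OF \<delta> cc(1) d(2) d(1)])
      have E: "\<epsilon>\<^sup>2 * d * (4 * (e x)\<^sup>2) \<le> 64 * \<epsilon>\<^sup>2 / R\<^sup>2 * \<bar>M\<bar>"
      proof -
        have "\<epsilon>\<^sup>2 * d \<le> m" using d(1) mult_left_le[OF cc(2), of m] by (simp add: m_def)
        moreover have "4 * (e x)\<^sup>2 \<le> 4 * \<bar>M\<bar>" using M[of x] by simp
        ultimately have "\<epsilon>\<^sup>2 * d * (4 * (e x)\<^sup>2) \<le> m * (4 * \<bar>M\<bar>)" by (intro mult_mono) (auto simp: m_def)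
        then show ?thesis by (simp add: m_def)
      qed
      \<comment> \<open>The four terms with \<open>d\<close> carry the squares of \<open>e\<close>,
        \<open>\<psi>1\<close>, \<open>e\<close> and \<open>\<psi>2\<close>, and \<psi>1^2 +
        \<psi>2^2 + 2 e^2 = a + b + 4 e^2.\<close>
      have "\<epsilon>\<^sup>2 * (k U W e x + k W U \<psi>1 x + k V W e x + k W V \<psi>2 x)
         = - t * ((a x + \<gamma> * b x) * a x + (\<gamma> * a x + b x) * b x) + \<epsilon>\<^sup>2 * d * a x + \<epsilon>\<^sup>2 * d * b x + \<epsilon>\<^sup>2 * d * (4 * (e x)\<^sup>2)"
      proof -
        have UW: "\<epsilon>\<^sup>2 * (U x - W x) = a x + \<gamma> * b x" "\<epsilon>\<^sup>2 * (V x - W x) = \<gamma> * a x + b x"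
          using \<epsilon> by (simp_all add: U_def V_def W_def a_def b_def field_simps)
        have "\<epsilon>\<^sup>2 * (k U W e x + k W U \<psi>1 x + k V W e x + k W V \<psi>2 x)
          = - t * ((\<epsilon>\<^sup>2 * (U x - W x)) * a x + (\<epsilon>\<^sup>2 * (V x - W x)) * b x) + \<epsilon>\<^sup>2 * d * a x + \<epsilon>\<^sup>2 * d * b x + \<epsilon>\<^sup>2 * d * (4 * (e x)\<^sup>2)"
          by (simp add: k_def t_def[symmetric] d_def[symmetric] a_def b_def algebra_simps)
        then show ?thesis unfolding UW .
      qed
      also have "\<dots> \<le> - t * ((1 - \<gamma>) * ((a x)\<^sup>2 + (b x)\<^sup>2)) + \<epsilon>\<^sup>2 * d * a x + \<epsilon>\<^sup>2 * d * b x + \<epsilon>\<^sup>2 * d * (4 * (e x)\<^sup>2)"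
        using mult_left_mono[OF quadratic_form_lower_bound[OF \<gamma>, of "a x" "b x"], of t] by (simp add: t_def)
      also have "\<dots> \<le> - t * ((1 - \<gamma>) * ((a x)\<^sup>2 + (b x)\<^sup>2)) + (\<delta> * t * (a x)\<^sup>2 + m\<^sup>2 / (4 * \<delta>))
         + (\<delta> * t * (b x)\<^sup>2 + m\<^sup>2 / (4 * \<delta>)) + 64 * \<epsilon>\<^sup>2 / R\<^sup>2 * \<bar>M\<bar>"
        by (intro add_mono Y E order_refl)
      also have "\<dots> = B - \<delta> * (t * ((a x)\<^sup>2 + (b x)\<^sup>2))"
        by (simp add: B_def \<delta>_def field_simps)
      finally show "k U W e x + k W U \<psi>1 x + k V W e x + k W V \<psi>2 x
         \<le> (B - \<delta> * ((cutoff R x)\<^sup>2 * ((a x)\<^sup>2 + (b x)\<^sup>2))) / \<epsilon>\<^sup>2"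
        using \<epsilon> by (simp add: t_def pos_le_divide_eq mult.commute)
    qed
    also have "\<dots> = (2 * R * B - \<delta> * integral {-R..R} (\<lambda>x. (cutoff R x)\<^sup>2 * ((a x)\<^sup>2 + (b x)\<^sup>2))) / \<epsilon>\<^sup>2"
    proof -
      have "(\<lambda>x. (cutoff R x)\<^sup>2 * ((a x)\<^sup>2 + (b x)\<^sup>2)) integrable_on {-R..R}"
        by (intro integrable_continuous_real continuous_intros cutoff_continuous cab)
      moreover have "((\<lambda>x. B) has_integral 2 * R * B) {-R..R}"
        using has_integral_const_real[of B "-R" R] R by simp
      ultimately have "((\<lambda>x. (B - \<delta> * ((cutoff R x)\<^sup>2 * ((a x)\<^sup>2 + (b x)\<^sup>2))) / \<epsilon>\<^sup>2) has_integral
         (2 * R * B - \<delta> * integral {-R..R} (\<lambda>x. (cutoff R x)\<^sup>2 * ((a x)\<^sup>2 + (b x)\<^sup>2))) / \<epsilon>\<^sup>2) {-R..R}"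
        by (intro has_integral_divide has_integral_diff has_integral_mult_right integrable_integral)
      then show ?thesis by (rule integral_unique)
    qed
    finally have "\<delta> * integral {-R..R} (\<lambda>x. (cutoff R x)\<^sup>2 * ((a x)\<^sup>2 + (b x)\<^sup>2)) \<le> 2 * R * B"
      using \<epsilon> by (simp add: zero_le_divide_iff)
    also have "\<dots> \<le> \<delta> * (C / R)"
    proof -
      have "m\<^sup>2 * R \<le> (16 * \<epsilon>\<^sup>2)\<^sup>2 / R"
      proof -
        have "m\<^sup>2 * R = (16 * \<epsilon>\<^sup>2)\<^sup>2 / R / R\<^sup>2"
          using R by (simp add: m_def field_simps power2_eq_square)
        also have "\<dots> \<le> (16 * \<epsilon>\<^sup>2)\<^sup>2 / R / 1\<^sup>2"
          using that R by (intro divide_left_mono power_mono mult_pos_pos) auto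
        finally show ?thesis by simp
      qed
      then have "m\<^sup>2 * R / (4 * \<delta>) \<le> (16 * \<epsilon>\<^sup>2)\<^sup>2 / R / (4 * \<delta>)"
        using \<delta> by (intro divide_right_mono) auto
      moreover have "2 * R * B = 4 * (m\<^sup>2 * R / (4 * \<delta>)) + 2 * (64 * \<epsilon>\<^sup>2 * \<bar>M\<bar> / R)"
        using R by (simp add: B_def power2_eq_square field_simps)
      moreover have "\<delta> * (C / R) = 4 * ((16 * \<epsilon>\<^sup>2)\<^sup>2 / R / (4 * \<delta>)) + 2 * (64 * \<epsilon>\<^sup>2 * \<bar>M\<bar> / R)"
        using \<delta> R by (simp add: C_def field_simps)
      ultimately show ?thesis by linarith
    qed
    finally show ?thesis by (rule mult_left_le_imp_le) (rule \<delta>)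
  qed
  then have "(a x)\<^sup>2 + (b x)\<^sup>2 = 0"
    by (intro continuous_zero_if_interval_integrals_vanish[where C = C])
      (auto intro!: continuous_intros cab)
  then have "(\<psi>1 x)\<^sup>2 = (e x)\<^sup>2" "(\<psi>2 x)\<^sup>2 = (e x)\<^sup>2" by (simp_all add: a_def b_def)
  then show ?thesis
    using positive_solution_D(3)[OF s(1), of x] positive_solution_D(3)[OF s(2), of x] positive_solution_D(3)[OF s(3), of x]
    by (simp add: power2_eq_iff_nonneg)
qed

section \<open>The energy near the ground state\<close>

text \<open>With the potential frozen the equation is linear, so the multiple of \<eta> in the
  symmetric state solves the same equation as \<eta>.\<close>

lemma positive_solution_scale:
  assumes u: "positive_solution V u" and "c > 0"
  shows "positive_solution V (\<lambda>x. c * u x)"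
proof -
  have d: "((\<lambda>x. c * u x) has_real_derivative c * deriv u x) (at x)" for x
    by (rule DERIV_cmult[OF positive_solution_D(1)[OF u]])
  then have e: "deriv (\<lambda>x. c * u x) = (\<lambda>x. c * deriv u x)" by (auto intro: DERIV_imp_deriv)
  have d': "((\<lambda>x. c * deriv u x) has_real_derivative c * (V x * u x)) (at x)" for x
    by (rule DERIV_cmult[OF positive_solution_D(2)[OF u]])
  have "deriv (\<lambda>x. c * deriv u x) x = V x * (c * u x)" for x
    using DERIV_imp_deriv[OF d'[of x]] by simp
  then show ?thesis
    unfolding positive_solution_def twice_differentiable_def e
    using d d' positive_solution_D(3)[OF u] \<open>c > 0\<close>
    by (auto simp: real_differentiable_def)
qed

lemma coupled_solution_iff_positive_solution:
  assumes "\<epsilon> > 0"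
  shows "coupled_solution \<epsilon> \<gamma> (\<psi>1, \<psi>2) \<and> positive_state (\<psi>1, \<psi>2) \<longleftrightarrow>
    positive_solution (\<lambda>x. (x\<^sup>2 - 1 + (\<psi>1 x)\<^sup>2 + \<gamma> * (\<psi>2 x)\<^sup>2) / \<epsilon>\<^sup>2) \<psi>1 \<and>
    positive_solution (\<lambda>x. (x\<^sup>2 - 1 + \<gamma> * (\<psi>1 x)\<^sup>2 + (\<psi>2 x)\<^sup>2) / \<epsilon>\<^sup>2) \<psi>2"
proof -
  have key: "- \<epsilon>\<^sup>2 * D + x\<^sup>2 * y + (u - 1) * y = 0 \<longleftrightarrow> D = (x\<^sup>2 - 1 + u) / \<epsilon>\<^sup>2 * y" for D x y u :: real
  proof -
    have "D = (x\<^sup>2 - 1 + u) / \<epsilon>\<^sup>2 * y \<longleftrightarrow> \<epsilon>\<^sup>2 * D = (x\<^sup>2 - 1 + u) * y"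
      using assms by (simp add: field_simps)
    then show ?thesis by (auto simp: algebra_simps)
  qed
  have "- \<epsilon>\<^sup>2 * deriv (deriv \<psi>1) x + x\<^sup>2 * \<psi>1 x + ((\<psi>1 x)\<^sup>2 + \<gamma> * (\<psi>2 x)\<^sup>2 - 1) * \<psi>1 x = 0 \<longleftrightarrow>
      deriv (deriv \<psi>1) x = (x\<^sup>2 - 1 + (\<psi>1 x)\<^sup>2 + \<gamma> * (\<psi>2 x)\<^sup>2) / \<epsilon>\<^sup>2 * \<psi>1 x"
    and "- \<epsilon>\<^sup>2 * deriv (deriv \<psi>2) x + x\<^sup>2 * \<psi>2 x + (\<gamma> * (\<psi>1 x)\<^sup>2 + (\<psi>2 x)\<^sup>2 - 1) * \<psi>2 x = 0 \<longleftrightarrow>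
      deriv (deriv \<psi>2) x = (x\<^sup>2 - 1 + \<gamma> * (\<psi>1 x)\<^sup>2 + (\<psi>2 x)\<^sup>2) / \<epsilon>\<^sup>2 * \<psi>2 x" for x
    by (subst key, simp only: add.assoc)+
  then show ?thesis
    unfolding coupled_solution.simps positive_state.simps positive_solution_def by blast
qed

section \<open>The weighted Sobolev space\<close>

lemma AE_bounded_mult_integrable:
  fixes m u :: "real \<Rightarrow> real"
  assumes "AE x in lborel. \<bar>m x\<bar> \<le> M" "m \<in> borel_measurable borel" "integrable lborel u"
  shows "integrable lborel (\<lambda>x. m x * u x)"
proof (rule Bochner_Integration.integrable_bound)
  show "integrable lborel (\<lambda>x. M * u x)" using assms by simp
  show "(\<lambda>x. m x * u x) \<in> borel_measurable lborel" using assms by simp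
  show "AE x in lborel. norm (m x * u x) \<le> norm (M * u x)"
    using assms(1) by eventually_elim (auto simp: abs_mult intro!: mult_right_mono)
qed

text \<open>The square of the norm of one component: squares add up over the two components, and
  energy increments at critical states are bounded linearly by them.\<close>

definition H1_norm2 :: "(real \<Rightarrow> real) \<Rightarrow> real" where
  "H1_norm2 f = (LINT x|lborel. (weak_deriv f x)\<^sup>2 + (1 + x\<^sup>2) * (f x)\<^sup>2)"

lemma weighted_H1_D:
  assumes "f \<in> H1 \<inter> L21"
  shows "f \<in> H1" "f \<in> L2" "weak_deriv f \<in> L2" "(\<lambda>x. \<bar>x\<bar> * f x) \<in> L2"
    "f \<in> borel_measurable borel" "weak_deriv f \<in> borel_measurable borel"
    "integrable lborel (\<lambda>x. (f x)\<^sup>2)" "integrable lborel (\<lambda>x. (weak_deriv f x)\<^sup>2)"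
    "integrable lborel (\<lambda>x. x\<^sup>2 * (f x)\<^sup>2)" "integrable lborel (\<lambda>x. (weak_deriv f x)\<^sup>2 + (1 + x\<^sup>2) * (f x)\<^sup>2)"
proof -
  show 1: "f \<in> H1" "f \<in> L2" "weak_deriv f \<in> L2" "(\<lambda>x. \<bar>x\<bar> * f x) \<in> L2"
    using assms weak_deriv_D[of f] by (auto simp: L21_def)
  show "f \<in> borel_measurable borel" "weak_deriv f \<in> borel_measurable borel"
    and 2: "integrable lborel (\<lambda>x. (f x)\<^sup>2)" "integrable lborel (\<lambda>x. (weak_deriv f x)\<^sup>2)"
    using L2_D 1 by blast+
  show 3: "integrable lborel (\<lambda>x. x\<^sup>2 * (f x)\<^sup>2)"
    using L2_D(2)[OF 1(4)] by (simp add: power_mult_distrib)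
  have "integrable lborel (\<lambda>x. (weak_deriv f x)\<^sup>2 + ((f x)\<^sup>2 + x\<^sup>2 * (f x)\<^sup>2))" using 2 3 by simp
  then show "integrable lborel (\<lambda>x. (weak_deriv f x)\<^sup>2 + (1 + x\<^sup>2) * (f x)\<^sup>2)"
    by (simp add: algebra_simps)
qed

lemma weighted_H1_lincomb:
  assumes "f \<in> H1 \<inter> L21" "h \<in> H1 \<inter> L21"
  shows "(\<lambda>x. a * f x + b * h x) \<in> H1 \<inter> L21"
proof -
  note f = weighted_H1_D[OF assms(1)] and h = weighted_H1_D[OF assms(2)]
  have "(\<lambda>x. a * (\<bar>x\<bar> * f x) + b * (\<bar>x\<bar> * h x)) \<in> L2" by (rule L2_lincomb[OF f(4) h(4)])
  then have "(\<lambda>x. \<bar>x\<bar> * (a * f x + b * h x)) \<in> L2" by (simp add: algebra_simps)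
  then show ?thesis using H1_lincomb(1)[OF f(1) h(1)] L2_lincomb[OF f(2) h(2)] by (simp add: L21_def)
qed

lemma H1_norm2_nonneg: "0 \<le> H1_norm2 f"
  unfolding H1_norm2_def by (intro integral_nonneg_AE AE_I2) simp

lemma L2_norm_le_H1_norm2:
  assumes "f \<in> H1 \<inter> L21"
  shows "(LINT x|lborel. (f x)\<^sup>2) \<le> H1_norm2 f"
  unfolding H1_norm2_def
  by (rule integral_mono) (use weighted_H1_D[OF assms] in \<open>auto simp: algebra_simps\<close>)

lemma energy_norm_eq:
  assumes "f \<in> H1 \<inter> L21" "h \<in> H1 \<inter> L21"
  shows "energy_norm (f, h) = sqrt (H1_norm2 f + H1_norm2 h)"
proof -
  have "H1_norm2 f + H1_norm2 h = (LINT x|lborel. ((weak_deriv f x)\<^sup>2 + (1 + x\<^sup>2) * (f x)\<^sup>2) + ((weak_deriv h x)\<^sup>2 + (1 + x\<^sup>2) * (h x)\<^sup>2))"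
    unfolding H1_norm2_def
    by (rule Bochner_Integration.integral_add[symmetric, OF weighted_H1_D(10)[OF assms(1)] weighted_H1_D(10)[OF assms(2)]])
  then show ?thesis by (simp add: algebra_simps)
qed

text \<open>The Sobolev embedding into bounded functions. It makes all quartic terms integrable,
  each being a bounded square times an integrable one.\<close>

lemma weighted_H1_sup_bound:
  assumes f: "f \<in> H1 \<inter> L21"
  shows "AE x in lborel. (f x)\<^sup>2 \<le> 2 * H1_norm2 f"
proof -
  note D = weighted_H1_D[OF f]
  obtain F where F: "ac_deriv F (weak_deriv f)" "AE x in lborel. f x = F x"
    using H1_ac_representative[OF D(1)] .
  note [measurable] = D(5,6) ac_deriv_measurable[OF F(1)]
  have eq: "AE x in lborel. (f x)\<^sup>2 = (F x)\<^sup>2" using F(2) by eventually_elim simp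
  then have iF: "integrable lborel (\<lambda>x. (F x)\<^sup>2)"
    using D(7) by (subst integrable_cong_AE[symmetric, of "\<lambda>x. (f x)\<^sup>2"]) auto
  have "(LINT x|lborel. (F x)\<^sup>2 + (weak_deriv f x)\<^sup>2) = (LINT x|lborel. (f x)\<^sup>2 + (weak_deriv f x)\<^sup>2)"
    by (rule integral_cong_AE) (use eq in \<open>auto elim: eventually_mono\<close>)
  also have "\<dots> \<le> H1_norm2 f"
    unfolding H1_norm2_def by (rule integral_mono) (use D in \<open>auto simp: algebra_simps\<close>)
  finally have "(F x)\<^sup>2 \<le> 2 * H1_norm2 f" for x
    using ac_deriv_sup_bound[OF F(1) iF D(8), of x] by linarith
  then show ?thesis using F(2) by (auto elim: eventually_mono)
qed

lemma weighted_H1_integrable_squares: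
  assumes f: "f \<in> H1 \<inter> L21" and h: "h \<in> H1 \<inter> L21"
  shows "integrable lborel (\<lambda>x. (f x)\<^sup>2 * (h x)\<^sup>2)"
  using weighted_H1_sup_bound[OF f] weighted_H1_D(5)[OF f] weighted_H1_D(7)[OF h]
  by (intro AE_bounded_mult_integrable[where M = "2 * H1_norm2 f"]) auto

text \<open>What remains of twice the energy density when both quadratic forms are split off, with
  \<open>y\<close> the value of \<eta>: the term with \<open>- y\<^sup>2\<close> cancels the
  \<eta>^2 that was added to the forms.\<close>

definition potential :: "real \<Rightarrow> real \<Rightarrow> real \<Rightarrow> real \<Rightarrow> real" where
  "potential \<gamma> y s t = - y\<^sup>2 * (s\<^sup>2 + t\<^sup>2) + 1 / 2 * (s\<^sup>2 + t\<^sup>2)\<^sup>2 + (\<gamma> - 1) * s\<^sup>2 * t\<^sup>2"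

lemma potential_scale: "potential \<gamma> y (a * y) (b * y) = potential \<gamma> 1 a b * y ^ 4"
  by (simp add: potential_def power_mult_distrib algebra_simps power2_eq_square power4_eq_xxxx)

lemma potential_commute: "potential \<gamma> y s t = potential \<gamma> y t s"
  by (simp add: potential_def algebra_simps)

section \<open>The quadratic form of the ground state and the energy splitting\<close>

locale ground_state =
  fixes \<epsilon> :: real and \<eta> :: "real \<Rightarrow> real"
  assumes eps: "\<epsilon> > 0" and gs: "is_ground_state \<epsilon> \<eta>"
begin

definition V :: "real \<Rightarrow> real" where
  "V x = (x\<^sup>2 - 1 + (\<eta> x)\<^sup>2) / \<epsilon>\<^sup>2"

lemma eta: "\<eta> \<in> H1 \<inter> L21"
  using gs by (simp add: is_ground_state_def)

lemma positive_solution_eta: "positive_solution V \<eta>"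
proof -
  have "deriv (deriv \<eta>) x = V x * \<eta> x" for x
  proof -
    have "\<epsilon>\<^sup>2 * deriv (deriv \<eta>) x = (x\<^sup>2 - 1 + (\<eta> x)\<^sup>2) * \<eta> x"
      using gs unfolding is_ground_state_def by (auto simp: algebra_simps dest: spec[of _ x])
    then show ?thesis using eps by (simp add: V_def field_simps)
  qed
  then show ?thesis using gs by (simp add: positive_solution_def is_ground_state_def)
qed

lemmas eta_D = positive_solution_D[OF positive_solution_eta]

lemma V_continuous: "continuous_on UNIV V"
  unfolding V_def using eps by (auto intro!: continuous_intros eta_D(4))

lemma ac_deriv_eta: "ac_deriv \<eta> (deriv \<eta>)"
  by (rule ac_deriv_C1[OF eta_D(1) eta_D(5)])

lemma weak_deriv_eta: "AE x in lborel. weak_deriv \<eta> x = deriv \<eta> x"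
proof -
  obtain F where F: "ac_deriv F (weak_deriv \<eta>)" "AE x in lborel. \<eta> x = F x"
    using H1_ac_representative weighted_H1_D(1)[OF eta] by blast
  have "\<eta> = F" by (rule continuous_AE_eq[OF eta_D(4) ac_deriv_continuous[OF F(1)] F(2)])
  then show ?thesis using ac_deriv_unique[OF F(1)] ac_deriv_eta by simp
qed

lemma eta_bound: "(\<eta> x)\<^sup>2 \<le> 2 * H1_norm2 \<eta>"
proof (rule ccontr)
  assume neg: "\<not> (\<eta> x)\<^sup>2 \<le> 2 * H1_norm2 \<eta>"
  \<comment> \<open>Taking the maximum turns an inequality almost everywhere into an equality of
    continuous functions, which then holds at every point.\<close>
  have "(\<lambda>x. max ((\<eta> x)\<^sup>2) (2 * H1_norm2 \<eta>)) = (\<lambda>x. 2 * H1_norm2 \<eta>)"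
  proof (rule continuous_AE_eq)
    show "AE x in lborel. max ((\<eta> x)\<^sup>2) (2 * H1_norm2 \<eta>) = 2 * H1_norm2 \<eta>"
      using weighted_H1_sup_bound[OF eta] by eventually_elim simp
  qed (intro continuous_intros eta_D(4))+
  then show False using neg by (metis max.cobounded1)
qed

lemma eta_mult_L2:
  assumes "f \<in> H1 \<inter> L21"
  shows "(\<lambda>x. \<eta> x * f x) \<in> L2"
  using weighted_H1_integrable_squares[OF eta assms] weighted_H1_D(5)[OF eta] weighted_H1_D(5)[OF assms]
  by (simp add: L2_def power_mult_distrib)

definition bilinear_density :: "(real \<Rightarrow> real) \<Rightarrow> (real \<Rightarrow> real) \<Rightarrow> real \<Rightarrow> real" where
  "bilinear_density f h x = \<epsilon>\<^sup>2 * (weak_deriv f x * weak_deriv h x) + (x\<^sup>2 - 1 + (\<eta> x)\<^sup>2) * (f x * h x)"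

text \<open>The polar form of the Schroedinger operator \<open>- \<epsilon>\<^sup>2
  \<partial>\<^sup>2 + x\<^sup>2 - 1 + \<eta>\<^sup>2\<close>; the equation of \<eta> says that this
  operator annihilates \<eta>.\<close>

definition B :: "(real \<Rightarrow> real) \<Rightarrow> (real \<Rightarrow> real) \<Rightarrow> real" where
  "B f h = (LINT x|lborel. bilinear_density f h x)"

abbreviation Q :: "(real \<Rightarrow> real) \<Rightarrow> real" where
  "Q f \<equiv> B f f"

lemma bilinear_density_integrable:
  assumes f: "f \<in> H1 \<inter> L21" and h: "h \<in> H1 \<inter> L21"
  shows "integrable lborel (bilinear_density f h)"
proof -
  have "integrable lborel (\<lambda>x. \<epsilon>\<^sup>2 * (weak_deriv f x * weak_deriv h x) + (\<bar>x\<bar> * f x) * (\<bar>x\<bar> * h x)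
     - f x * h x + (\<eta> x * f x) * (\<eta> x * h x))"
    by (intro Bochner_Integration.integrable_add Bochner_Integration.integrable_diff integrable_mult_right
       L2_integrable_mult weighted_H1_D(2,3,4)[OF f] weighted_H1_D(2,3,4)[OF h] eta_mult_L2 f h)
  moreover have "(\<lambda>x. \<epsilon>\<^sup>2 * (weak_deriv f x * weak_deriv h x) + (\<bar>x\<bar> * f x) * (\<bar>x\<bar> * h x)
     - f x * h x + (\<eta> x * f x) * (\<eta> x * h x)) = bilinear_density f h"
    by (simp add: fun_eq_iff bilinear_density_def power2_eq_square algebra_simps flip: abs_mult)
  ultimately show ?thesis by simp
qed

lemma Q_lincomb:
  assumes f: "f \<in> H1 \<inter> L21" and h: "h \<in> H1 \<inter> L21"
  shows "Q (\<lambda>x. a * f x + b * h x) = a\<^sup>2 * Q f + 2 * a * b * B f h + b\<^sup>2 * Q h"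
proof -
  define k where "k = (\<lambda>x. a * f x + b * h x)"
  have k: "k \<in> H1 \<inter> L21" unfolding k_def by (rule weighted_H1_lincomb[OF f h])
  note i = bilinear_density_integrable[OF f f] bilinear_density_integrable[OF f h] bilinear_density_integrable[OF h h]
  have "AE x in lborel. weak_deriv k x = a * weak_deriv f x + b * weak_deriv h x"
    unfolding k_def by (rule H1_lincomb(2)[OF weighted_H1_D(1)[OF f] weighted_H1_D(1)[OF h]])
  then have "AE x in lborel. bilinear_density k k x =
     a\<^sup>2 * bilinear_density f f x + 2 * a * b * bilinear_density f h x + b\<^sup>2 * bilinear_density h h x"
    by eventually_elim (simp add: bilinear_density_def k_def power2_eq_square algebra_simps)
  then have "Q k = (LINT x|lborel. a\<^sup>2 * bilinear_density f f x + 2 * a * b * bilinear_density f h x + b\<^sup>2 * bilinear_density h h x)"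
    unfolding B_def
    using i bilinear_density_integrable[OF k k] by (intro integral_cong_AE borel_measurable_integrable) auto
  also have "\<dots> = a\<^sup>2 * Q f + 2 * a * b * B f h + b\<^sup>2 * Q h"
    using i by (simp add: B_def)
  finally show ?thesis by (simp add: k_def)
qed

lemma Riccati_eta: "((\<lambda>x. deriv \<eta> x / \<eta> x) has_real_derivative V x - (deriv \<eta> x / \<eta> x)\<^sup>2) (at x)"
  by (rule log_derivative_Riccati[OF positive_solution_eta])

lemma V_integrable:
  assumes f: "f \<in> H1 \<inter> L21"
  shows "integrable lborel (\<lambda>x. V x * (f x)\<^sup>2)"
proof -
  have "integrable lborel (\<lambda>x. (x\<^sup>2 * (f x)\<^sup>2 - (f x)\<^sup>2 + (\<eta> x)\<^sup>2 * (f x)\<^sup>2) / \<epsilon>\<^sup>2)"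
    using weighted_H1_D[OF f] weighted_H1_integrable_squares[OF eta f] by simp
  then show ?thesis by (simp add: V_def algebra_simps)
qed

lemma Q_eq: "Q f = \<epsilon>\<^sup>2 * (LINT x|lborel. (weak_deriv f x)\<^sup>2 + V x * (f x)\<^sup>2)"
proof -
  have "bilinear_density f f x = \<epsilon>\<^sup>2 * ((weak_deriv f x)\<^sup>2 + V x * (f x)\<^sup>2)" for x
    using eps by (simp add: bilinear_density_def V_def power2_eq_square field_simps)
  then show ?thesis by (simp add: B_def)
qed

lemma Q_nonneg:
  assumes f: "f \<in> H1 \<inter> L21"
  shows "0 \<le> Q f"
proof -
  note D = weighted_H1_D[OF f]
  obtain F where rep: "ac_deriv F (weak_deriv f)" "AE x in lborel. f x = F x"
    using H1_ac_representative[OF D(1)] .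
  note [measurable] = D(5,6) ac_deriv_measurable[OF rep(1)] borel_measurable_continuous_onI[OF V_continuous]
  have iF: "integrable lborel (\<lambda>x. (F x)\<^sup>2)"
    by (rule integrable_cong_AE_imp[OF D(7)]) (use rep(2) in \<open>auto elim: eventually_mono\<close>)
  have iV: "integrable lborel (\<lambda>x. V x * (F x)\<^sup>2)"
    by (rule integrable_cong_AE_imp[OF V_integrable[OF f]]) (use rep(2) in \<open>auto elim: eventually_mono\<close>)
  interpret cutoff_picone "\<lambda>x. deriv \<eta> x / \<eta> x" V F "weak_deriv f"
    by unfold_locales (fact Riccati_eta V_continuous rep(1) iF D(8) iV)+
  have "(LINT x|lborel. (weak_deriv f x)\<^sup>2 + V x * (f x)\<^sup>2) = (LINT x|lborel. (weak_deriv f x)\<^sup>2 + V x * (F x)\<^sup>2)"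
    by (rule integral_cong_AE) (use rep(2) in \<open>auto elim: eventually_mono\<close>)
  then show ?thesis using nonneg by (simp add: Q_eq)
qed

text \<open>The classical derivative replaces the weak one because \<open>eq_zero\<close> asks for
  \<open>g x = p x * F x\<close> at every point, not just almost everywhere.\<close>

lemma Q_eta: "Q \<eta> = 0"
proof -
  note D = weighted_H1_D[OF eta]
  note [measurable] = D(5,6) ac_deriv_D(1)[OF ac_deriv_eta] borel_measurable_continuous_onI[OF V_continuous]
  have id: "integrable lborel (\<lambda>x. (deriv \<eta> x)\<^sup>2)"
    by (rule integrable_cong_AE_imp[OF D(8)]) (use weak_deriv_eta in \<open>auto elim: eventually_mono\<close>)
  interpret cutoff_picone "\<lambda>x. deriv \<eta> x / \<eta> x" V \<eta> "deriv \<eta>"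
    by unfold_locales (fact Riccati_eta V_continuous ac_deriv_eta D(7) id V_integrable[OF eta])+
  have "(LINT x|lborel. (weak_deriv \<eta> x)\<^sup>2 + V x * (\<eta> x)\<^sup>2) = (LINT x|lborel. (deriv \<eta> x)\<^sup>2 + V x * (\<eta> x)\<^sup>2)"
    by (rule integral_cong_AE) (use weak_deriv_eta in \<open>auto elim: eventually_mono\<close>)
  also have "\<dots> = 0"
  proof (rule eq_zero)
    show "deriv \<eta> x = deriv \<eta> x / \<eta> x * \<eta> x" for x using eta_D(3)[of x] by simp
  qed
  finally show ?thesis by (simp add: Q_eq)
qed

text \<open>A null vector of a nonnegative form lies in its kernel. This yields the weak form of the
  equation of \<eta> without any boundary terms.\<close>

lemma B_eta:
  assumes f: "f \<in> H1 \<inter> L21"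
  shows "B \<eta> f = 0"
proof (rule ccontr)
  assume nz: "B \<eta> f \<noteq> 0"
  \<comment> \<open>\<open>Q (a \<eta> + f)\<close> is affine in \<open>a\<close>, because
    \<open>Q \<eta> = 0\<close>; this \<open>a\<close> gives it the value -1.\<close>
  define a where "a = - (Q f + 1) / (2 * B \<eta> f)"
  have "0 \<le> Q (\<lambda>x. a * \<eta> x + 1 * f x)" by (rule Q_nonneg[OF weighted_H1_lincomb[OF eta f]])
  also have "\<dots> = 2 * a * B \<eta> f + Q f" unfolding Q_lincomb[OF eta f] Q_eta by simp
  also have "2 * a * B \<eta> f = - (Q f + 1)" using nz by (simp add: a_def)
  finally show False by simp
qed

lemma Q_shift:
  assumes f: "f \<in> H1 \<inter> L21"
  shows "Q (\<lambda>x. a * \<eta> x + f x) = Q f"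
  using Q_lincomb[OF eta f, of a 1] by (simp add: Q_eta B_eta[OF f])

lemma Q_scale: "Q (\<lambda>x. a * \<eta> x) = 0"
  using Q_lincomb[OF eta eta, of a 0] by (simp add: Q_eta)

lemma scale_mem: "(\<lambda>x. a * \<eta> x) \<in> H1 \<inter> L21"
  using weighted_H1_lincomb[OF eta eta, of a 0] by simp

lemma shift_mem: "f \<in> H1 \<inter> L21 \<Longrightarrow> (\<lambda>x. a * \<eta> x + f x) \<in> H1 \<inter> L21"
  using weighted_H1_lincomb[OF eta, of f a 1] by simp

lemma potential_integrable:
  assumes f: "f \<in> H1 \<inter> L21" and h: "h \<in> H1 \<inter> L21"
  shows "integrable lborel (\<lambda>x. potential \<gamma> (\<eta> x) (f x) (h x))"
proof -
  have "integrable lborel (\<lambda>x. - ((\<eta> x)\<^sup>2 * (f x)\<^sup>2) - (\<eta> x)\<^sup>2 * (h x)\<^sup>2 + 1 / 2 * ((f x)\<^sup>2 * (f x)\<^sup>2)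
     + (f x)\<^sup>2 * (h x)\<^sup>2 + 1 / 2 * ((h x)\<^sup>2 * (h x)\<^sup>2) + (\<gamma> - 1) * ((f x)\<^sup>2 * (h x)\<^sup>2))"
    by (intro Bochner_Integration.integrable_add Bochner_Integration.integrable_diff integrable_mult_right
       integrable_minus weighted_H1_integrable_squares f h eta)
  moreover have "(\<lambda>x. - ((\<eta> x)\<^sup>2 * (f x)\<^sup>2) - (\<eta> x)\<^sup>2 * (h x)\<^sup>2 + 1 / 2 * ((f x)\<^sup>2 * (f x)\<^sup>2)
     + (f x)\<^sup>2 * (h x)\<^sup>2 + 1 / 2 * ((h x)\<^sup>2 * (h x)\<^sup>2) + (\<gamma> - 1) * ((f x)\<^sup>2 * (h x)\<^sup>2))
     = (\<lambda>x. potential \<gamma> (\<eta> x) (f x) (h x))"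
    unfolding potential_def fun_eq_iff by (simp add: power2_eq_square algebra_simps)
  ultimately show ?thesis by simp
qed

lemma energy_eq:
  assumes f: "f \<in> H1 \<inter> L21" and h: "h \<in> H1 \<inter> L21"
  shows "2 * energy \<epsilon> \<gamma> (f, h) = Q f + Q h + (LINT x|lborel. potential \<gamma> (\<eta> x) (f x) (h x))"
proof -
  have "Q f + Q h + (LINT x|lborel. potential \<gamma> (\<eta> x) (f x) (h x))
    = (LINT x|lborel. bilinear_density f f x + bilinear_density h h x + potential \<gamma> (\<eta> x) (f x) (h x))"
    unfolding B_def
    using bilinear_density_integrable[OF f f] bilinear_density_integrable[OF h h] potential_integrable[OF f h]
    by simp
  also have "\<dots> = 2 * energy \<epsilon> \<gamma> (f, h)"
    by (simp add: bilinear_density_def potential_def power2_eq_square algebra_simps)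
  finally show ?thesis by simp
qed

definition K :: real where
  "K = (LINT x|lborel. (\<eta> x) ^ 4)"

lemma eta4_integrable: "integrable lborel (\<lambda>x. (\<eta> x) ^ 4)"
  using weighted_H1_integrable_squares[OF eta eta] by (simp flip: power_add)

lemma K_pos: "K > 0"
proof (rule ccontr)
  assume "\<not> K > 0"
  moreover have "0 \<le> K" unfolding K_def by (intro integral_nonneg_AE AE_I2) simp
  ultimately have "K = 0" by simp
  then have "(LINT x|lborel. (\<eta> x) ^ 4) = 0" unfolding K_def .
  then have "AE x in lborel. (\<eta> x) ^ 4 = 0"
    using integral_nonneg_eq_0_iff_AE[OF eta4_integrable] by simp
  then have "(\<lambda>x. (\<eta> x) ^ 4) = (\<lambda>x. 0)"
    by (intro continuous_AE_eq continuous_intros eta_D(4))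
  then have "(\<eta> 0) ^ 4 = 0" by meson
  then show False using eta_D(3)[of 0] by simp
qed

lemma energy_scale: "2 * energy \<epsilon> \<gamma> (\<lambda>x. a * \<eta> x, \<lambda>x. b * \<eta> x) = potential \<gamma> 1 a b * K"
  using energy_eq[OF scale_mem scale_mem, of \<gamma> a b] by (simp add: Q_scale potential_scale K_def)

text \<open>As the forms are nonnegative, a pointwise bound on the quartic suffices. It is sharp
  when \<open>m\<close> is the value \<open>potential \<gamma> 1 a b\<close>, because the forms
  vanish on multiples of \<eta>.\<close>

lemma energy_lower_bound:
  assumes f: "f \<in> H1 \<inter> L21" and h: "h \<in> H1 \<inter> L21" and le: "\<And>y s t. m * y ^ 4 \<le> potential \<gamma> y s t"
  shows "m * K \<le> 2 * energy \<epsilon> \<gamma> (f, h)"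
proof -
  have "m * K = (LINT x|lborel. m * (\<eta> x) ^ 4)" by (simp add: K_def)
  also have "\<dots> \<le> (LINT x|lborel. potential \<gamma> (\<eta> x) (f x) (h x))"
    by (rule integral_mono) (use eta4_integrable potential_integrable[OF f h] le in auto)
  finally show ?thesis using Q_nonneg[OF f] Q_nonneg[OF h] unfolding energy_eq[OF f h] by linarith
qed

lemma global_minimizer_scale:
  assumes le: "\<And>y s t. potential \<gamma> 1 a b * y ^ 4 \<le> potential \<gamma> y s t"
  shows "global_minimizer (energy \<epsilon> \<gamma>) (\<lambda>x. a * \<eta> x, \<lambda>x. b * \<eta> x)"
  unfolding global_minimizer_def
proof (intro conjI ballI)
  show "(\<lambda>x. a * \<eta> x, \<lambda>x. b * \<eta> x) \<in> energy_space"
    using scale_mem[of a] scale_mem[of b] by (simp add: energy_space_def)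
  fix \<Phi> assume "\<Phi> \<in> energy_space"
  then obtain f h where \<Phi>: "\<Phi> = (f, h)" "f \<in> H1 \<inter> L21" "h \<in> H1 \<inter> L21"
    by (auto simp: energy_space_def)
  have "2 * energy \<epsilon> \<gamma> (\<lambda>x. a * \<eta> x, \<lambda>x. b * \<eta> x) \<le> 2 * energy \<epsilon> \<gamma> (f, h)"
    unfolding energy_scale using le by (intro energy_lower_bound \<Phi>)
  then show "energy \<epsilon> \<gamma> (\<lambda>x. a * \<eta> x, \<lambda>x. b * \<eta> x) \<le> energy \<epsilon> \<gamma> \<Phi>" by (simp add: \<Phi>)
qed

text \<open>The case of equality in the lower bound: the excess of the quartic over its minimum is
  nonnegative with integral zero.\<close>

lemma minimizer_AE:
  assumes f: "f \<in> H1 \<inter> L21" and h: "h \<in> H1 \<inter> L21" and le: "\<And>y s t. m * y ^ 4 \<le> potential \<gamma> y s t"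
    and eq: "2 * energy \<epsilon> \<gamma> (f, h) \<le> m * K"
  shows "AE x in lborel. potential \<gamma> (\<eta> x) (f x) (h x) = m * (\<eta> x) ^ 4"
proof -
  have i: "integrable lborel (\<lambda>x. potential \<gamma> (\<eta> x) (f x) (h x) - m * (\<eta> x) ^ 4)"
    using potential_integrable[OF f h] eta4_integrable by simp
  have "(LINT x|lborel. potential \<gamma> (\<eta> x) (f x) (h x) - m * (\<eta> x) ^ 4)
      = (LINT x|lborel. potential \<gamma> (\<eta> x) (f x) (h x)) - m * K"
    using potential_integrable[OF f h] eta4_integrable by (simp add: K_def)
  also have "\<dots> \<le> 0" using eq Q_nonneg[OF f] Q_nonneg[OF h] unfolding energy_eq[OF f h] by linarith
  finally have "(LINT x|lborel. potential \<gamma> (\<eta> x) (f x) (h x) - m * (\<eta> x) ^ 4) = 0"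
    using le by (intro antisym integral_nonneg_AE) auto
  then have "AE x in lborel. potential \<gamma> (\<eta> x) (f x) (h x) - m * (\<eta> x) ^ 4 = 0"
    using integral_nonneg_eq_0_iff_AE[OF i] le by simp
  then show ?thesis by eventually_elim simp
qed

end

section \<open>Energy increments at multiples of the ground state\<close>

lemma potential_increment:
  assumes a: "a * (a\<^sup>2 + \<gamma> * b\<^sup>2 - 1) = 0" and b: "b * (\<gamma> * a\<^sup>2 + b\<^sup>2 - 1) = (0::real)"
  \<comment> \<open>\<open>\<alpha>\<close> and \<open>\<beta>\<close> are the increments of the two
    squares. The two hypotheses say that the gradient of \<open>potential \<gamma> 1\<close>
    vanishes at \<open>(a, b)\<close>, which removes the terms linear in \<open>s\<close> and
    \<open>t\<close>.\<close>
  defines "\<alpha> \<equiv> \<lambda>y s. 2 * a * y * s + s\<^sup>2" and "\<beta> \<equiv> \<lambda>y t. 2 * b * y * t + t\<^sup>2"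
  shows "potential \<gamma> y (a * y + s) (b * y + t) - potential \<gamma> y (a * y) (b * y) =
    y\<^sup>2 * (a\<^sup>2 + \<gamma> * b\<^sup>2 - 1) * s\<^sup>2 + y\<^sup>2 * (\<gamma> * a\<^sup>2 + b\<^sup>2 - 1) * t\<^sup>2
     + 1 / 2 * (\<alpha> y s + \<beta> y t)\<^sup>2 + (\<gamma> - 1) * \<alpha> y s * \<beta> y t"
proof -
  have "potential \<gamma> y (a * y + s) (b * y + t) - potential \<gamma> y (a * y) (b * y) =
    y\<^sup>2 * (a\<^sup>2 + \<gamma> * b\<^sup>2 - 1) * s\<^sup>2 + y\<^sup>2 * (\<gamma> * a\<^sup>2 + b\<^sup>2 - 1) * t\<^sup>2
     + 1 / 2 * (\<alpha> y s + \<beta> y t)\<^sup>2 + (\<gamma> - 1) * \<alpha> y s * \<beta> y t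
     + 2 * y ^ 3 * s * (a * (a\<^sup>2 + \<gamma> * b\<^sup>2 - 1)) + 2 * y ^ 3 * t * (b * (\<gamma> * a\<^sup>2 + b\<^sup>2 - 1))"
    unfolding potential_def \<alpha>_def \<beta>_def by algebra
  then show ?thesis using a b by simp
qed

text \<open>The restriction to squares at most 2 matches the sup bound for increments of squared
  norm at most 1; it lets quartic terms be traded for quadratic ones.\<close>

lemma potential_increment_bound:
  assumes a: "a * (a\<^sup>2 + \<gamma> * b\<^sup>2 - 1) = 0" and b: "b * (\<gamma> * a\<^sup>2 + b\<^sup>2 - 1) = (0::real)"
    and y: "y\<^sup>2 \<le> M" and s: "s\<^sup>2 \<le> 2" and t: "t\<^sup>2 \<le> 2"
  shows "\<bar>potential \<gamma> y (a * y + s) (b * y + t) - potential \<gamma> y (a * y) (b * y)\<bar> \<le>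
    (M * (\<bar>a\<^sup>2 + \<gamma> * b\<^sup>2 - 1\<bar> + \<bar>\<gamma> * a\<^sup>2 + b\<^sup>2 - 1\<bar>) + (1 + \<bar>\<gamma> - 1\<bar>) * (8 * (a\<^sup>2 + b\<^sup>2) * M + 4)) * (s\<^sup>2 + t\<^sup>2)"
proof -
  define \<alpha> where "\<alpha> = 2 * a * y * s + s\<^sup>2"
  define \<beta> where "\<beta> = 2 * b * y * t + t\<^sup>2"
  define p where "p = a\<^sup>2 + \<gamma> * b\<^sup>2 - 1"
  define q where "q = \<gamma> * a\<^sup>2 + b\<^sup>2 - 1"
  define G where "G = 1 + \<bar>\<gamma> - 1\<bar>"
  define H where "H = 8 * (a\<^sup>2 + b\<^sup>2) * M + 4"
  have M0: "0 \<le> M" using y zero_le_power2 order_trans by blast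
  have sq: "(2 * c * y * r + r\<^sup>2)\<^sup>2 \<le> H * r\<^sup>2" if "c\<^sup>2 \<le> a\<^sup>2 + b\<^sup>2" "r\<^sup>2 \<le> 2" for c r :: real
  proof -
    \<comment> \<open>Adding the square of the difference gives, by the parallelogram law, a sum
      without the cubic cross term; this is the origin of the constants 8 and 4 in
      \<open>H\<close>.\<close>
    have "(2 * c * y * r + r\<^sup>2)\<^sup>2 \<le> (2 * c * y * r + r\<^sup>2)\<^sup>2 + (2 * c * y * r - r\<^sup>2)\<^sup>2" by simp
    also have "\<dots> = 8 * (c\<^sup>2 * y\<^sup>2) * r\<^sup>2 + 2 * r\<^sup>2 * r\<^sup>2" by algebra
    also have "\<dots> \<le> 8 * ((a\<^sup>2 + b\<^sup>2) * M) * r\<^sup>2 + 2 * 2 * r\<^sup>2"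
      using that y M0 by (intro add_mono mult_right_mono mult_left_mono mult_mono) auto
    also have "\<dots> = H * r\<^sup>2" by (simp add: H_def algebra_simps)
    finally show ?thesis .
  qed
  have A: "\<alpha>\<^sup>2 \<le> H * s\<^sup>2" and Bt: "\<beta>\<^sup>2 \<le> H * t\<^sup>2" unfolding \<alpha>_def \<beta>_def using s t by (intro sq; simp)+
  have t1: "\<bar>y\<^sup>2 * c * r\<^sup>2\<bar> \<le> M * \<bar>c\<bar> * r\<^sup>2" for c r :: real
    using y M0 by (auto simp: abs_mult intro!: mult_right_mono)
  have mixed: "2 * \<bar>\<alpha> * \<beta>\<bar> \<le> \<alpha>\<^sup>2 + \<beta>\<^sup>2"
    using sum_squares_bound[of "\<bar>\<alpha>\<bar>" "\<bar>\<beta>\<bar>"] by (simp add: abs_mult)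
  have t2: "\<bar>1 / 2 * (\<alpha> + \<beta>)\<^sup>2\<bar> \<le> \<alpha>\<^sup>2 + \<beta>\<^sup>2"
  proof -
    have "1 / 2 * (\<alpha> + \<beta>)\<^sup>2 = \<alpha>\<^sup>2 + \<beta>\<^sup>2 - 1 / 2 * (\<alpha> - \<beta>)\<^sup>2"
      by (simp add: power2_eq_square algebra_simps)
    then show ?thesis using zero_le_power2[of "\<alpha> - \<beta>"] zero_le_power2[of "\<alpha> + \<beta>"] by linarith
  qed
  have t3: "\<bar>(\<gamma> - 1) * \<alpha> * \<beta>\<bar> \<le> \<bar>\<gamma> - 1\<bar> * (\<alpha>\<^sup>2 + \<beta>\<^sup>2)"
  proof -
    have "\<bar>\<alpha> * \<beta>\<bar> \<le> \<alpha>\<^sup>2 + \<beta>\<^sup>2" using mixed abs_ge_zero[of "\<alpha> * \<beta>"] by linarith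
    then have "\<bar>\<gamma> - 1\<bar> * \<bar>\<alpha> * \<beta>\<bar> \<le> \<bar>\<gamma> - 1\<bar> * (\<alpha>\<^sup>2 + \<beta>\<^sup>2)" by (rule mult_left_mono) simp
    then show ?thesis by (simp add: abs_mult)
  qed
  have "potential \<gamma> y (a * y + s) (b * y + t) - potential \<gamma> y (a * y) (b * y) =
      y\<^sup>2 * p * s\<^sup>2 + y\<^sup>2 * q * t\<^sup>2 + 1 / 2 * (\<alpha> + \<beta>)\<^sup>2 + (\<gamma> - 1) * \<alpha> * \<beta>"
    unfolding potential_increment[OF a b] p_def q_def \<alpha>_def \<beta>_def ..
  then have "\<bar>potential \<gamma> y (a * y + s) (b * y + t) - potential \<gamma> y (a * y) (b * y)\<bar>
     \<le> \<bar>y\<^sup>2 * p * s\<^sup>2\<bar> + \<bar>y\<^sup>2 * q * t\<^sup>2\<bar> + \<bar>1 / 2 * (\<alpha> + \<beta>)\<^sup>2\<bar> + \<bar>(\<gamma> - 1) * \<alpha> * \<beta>\<bar>"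
    by linarith
  also have "\<dots> \<le> M * \<bar>p\<bar> * s\<^sup>2 + M * \<bar>q\<bar> * t\<^sup>2 + (\<alpha>\<^sup>2 + \<beta>\<^sup>2) + \<bar>\<gamma> - 1\<bar> * (\<alpha>\<^sup>2 + \<beta>\<^sup>2)"
    by (intro add_mono t1 t2 t3)
  also have "\<dots> = M * \<bar>p\<bar> * s\<^sup>2 + M * \<bar>q\<bar> * t\<^sup>2 + G * (\<alpha>\<^sup>2 + \<beta>\<^sup>2)"
    by (simp add: G_def algebra_simps)
  also have "\<dots> \<le> M * \<bar>p\<bar> * (s\<^sup>2 + t\<^sup>2) + M * \<bar>q\<bar> * (s\<^sup>2 + t\<^sup>2) + G * (H * s\<^sup>2 + H * t\<^sup>2)"
    using A Bt M0 by (intro add_mono mult_left_mono) (auto simp: G_def)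
  also have "\<dots> = (M * (\<bar>p\<bar> + \<bar>q\<bar>) + G * H) * (s\<^sup>2 + t\<^sup>2)" by (simp add: algebra_simps)
  finally show ?thesis by (simp only: p_def q_def G_def H_def)
qed

context ground_state
begin

lemma Q_bound:
  assumes f: "f \<in> H1 \<inter> L21"
  shows "Q f \<le> (\<epsilon>\<^sup>2 + 1 + 2 * H1_norm2 \<eta>) * H1_norm2 f"
proof -
  define C where "C = \<epsilon>\<^sup>2 + 1 + 2 * H1_norm2 \<eta>"
  note N = H1_norm2_nonneg[of \<eta>]
  have "Q f \<le> (LINT x|lborel. C * ((weak_deriv f x)\<^sup>2 + (1 + x\<^sup>2) * (f x)\<^sup>2))"
    unfolding B_def
  proof (rule integral_mono[OF bilinear_density_integrable[OF f f]])
    show "integrable lborel (\<lambda>x. C * ((weak_deriv f x)\<^sup>2 + (1 + x\<^sup>2) * (f x)\<^sup>2))"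
      using weighted_H1_D(10)[OF f] by simp
    fix x
    have "\<epsilon>\<^sup>2 * (weak_deriv f x)\<^sup>2 \<le> C * (weak_deriv f x)\<^sup>2"
      using N by (intro mult_right_mono) (auto simp: C_def)
    moreover have "(x\<^sup>2 - 1 + (\<eta> x)\<^sup>2) * (f x)\<^sup>2 \<le> (C * (1 + x\<^sup>2)) * (f x)\<^sup>2"
    proof (rule mult_right_mono)
      have "x\<^sup>2 - 1 + (\<eta> x)\<^sup>2 \<le> 1 * x\<^sup>2 + C * 1"
      proof -
        have "X - 1 + y \<le> 1 * X + (e + 1 + z) * 1" if "y \<le> z" "0 \<le> e" for X y z e :: real
          using that by simp
        then show ?thesis unfolding C_def using eta_bound[of x] zero_le_power2[of \<epsilon>] by blast
      qed
      also have "\<dots> \<le> C * x\<^sup>2 + C * 1" using N by (intro add_mono mult_right_mono) (auto simp: C_def)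
      finally show "x\<^sup>2 - 1 + (\<eta> x)\<^sup>2 \<le> C * (1 + x\<^sup>2)" by (simp add: algebra_simps)
    qed simp
    ultimately show "bilinear_density f f x \<le> C * ((weak_deriv f x)\<^sup>2 + (1 + x\<^sup>2) * (f x)\<^sup>2)"
      by (simp add: bilinear_density_def power2_eq_square algebra_simps)
  qed
  also have "\<dots> = C * H1_norm2 f" by (simp add: H1_norm2_def)
  finally show ?thesis by (simp add: C_def)
qed

text \<open>\<open>Q_shift\<close> removes the cross terms from the forms and stationarity those
  from the quartic, so only terms of second order in the increment remain.\<close>

lemma energy_increment_bound:
  assumes a: "a * (a\<^sup>2 + \<gamma> * b\<^sup>2 - 1) = 0" and b: "b * (\<gamma> * a\<^sup>2 + b\<^sup>2 - 1) = 0"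
  obtains C where "C \<ge> 0"
    "\<And>f h. f \<in> H1 \<inter> L21 \<Longrightarrow> h \<in> H1 \<inter> L21 \<Longrightarrow> H1_norm2 f + H1_norm2 h \<le> 1 \<Longrightarrow>
       \<bar>energy \<epsilon> \<gamma> (\<lambda>x. a * \<eta> x + f x, \<lambda>x. b * \<eta> x + h x) - energy \<epsilon> \<gamma> (\<lambda>x. a * \<eta> x, \<lambda>x. b * \<eta> x)\<bar>
         \<le> C * (H1_norm2 f + H1_norm2 h)"
proof -
  define M where "M = 2 * H1_norm2 \<eta>"
  define C1 where "C1 = \<epsilon>\<^sup>2 + 1 + 2 * H1_norm2 \<eta>"
  define C2 where "C2 = M * (\<bar>a\<^sup>2 + \<gamma> * b\<^sup>2 - 1\<bar> + \<bar>\<gamma> * a\<^sup>2 + b\<^sup>2 - 1\<bar>) + (1 + \<bar>\<gamma> - 1\<bar>) * (8 * (a\<^sup>2 + b\<^sup>2) * M + 4)"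
  have M0: "M \<ge> 0" using H1_norm2_nonneg by (simp add: M_def)
  have C: "C1 \<ge> 0" "C2 \<ge> 0"
    using M0 H1_norm2_nonneg[of \<eta>] by (auto simp: C1_def C2_def)
  show thesis
  proof (rule that[of "C1 + C2"])
    show "C1 + C2 \<ge> 0" using C by simp
    fix f h
    assume f: "f \<in> H1 \<inter> L21" and h: "h \<in> H1 \<inter> L21" and small: "H1_norm2 f + H1_norm2 h \<le> 1"
    define n where "n = H1_norm2 f + H1_norm2 h"
    define E1 where "E1 = energy \<epsilon> \<gamma> (\<lambda>x. a * \<eta> x + f x, \<lambda>x. b * \<eta> x + h x)"
    define E0 where "E0 = energy \<epsilon> \<gamma> (\<lambda>x. a * \<eta> x, \<lambda>x. b * \<eta> x)"
    define d where "d x = potential \<gamma> (\<eta> x) (a * \<eta> x + f x) (b * \<eta> x + h x) - potential \<gamma> (\<eta> x) (a * \<eta> x) (b * \<eta> x)" for x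
    have N: "H1_norm2 f \<le> 1" "H1_norm2 h \<le> 1"
      using small H1_norm2_nonneg[of f] H1_norm2_nonneg[of h] by linarith+
    have n0: "n \<ge> 0" using H1_norm2_nonneg[of f] H1_norm2_nonneg[of h] by (simp add: n_def)
    note i = potential_integrable[OF shift_mem[OF f] shift_mem[OF h]] potential_integrable[OF scale_mem scale_mem]
    have di: "integrable lborel d" unfolding d_def using i by simp
    have diff: "2 * (E1 - E0) = Q f + Q h + (LINT x|lborel. d x)"
    proof -
      have "2 * (E1 - E0) = 2 * E1 - 2 * E0" by simp
      also have "\<dots> = Q f + Q h + ((LINT x|lborel. potential \<gamma> (\<eta> x) (a * \<eta> x + f x) (b * \<eta> x + h x))
         - (LINT x|lborel. potential \<gamma> (\<eta> x) (a * \<eta> x) (b * \<eta> x)))"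
        unfolding E1_def E0_def energy_eq[OF shift_mem[OF f] shift_mem[OF h]] energy_eq[OF scale_mem scale_mem]
          Q_shift[OF f] Q_shift[OF h] Q_scale by simp
      also have "\<dots> = Q f + Q h + (LINT x|lborel. d x)"
        unfolding d_def using i by simp
      finally show ?thesis .
    qed
    have "AE x in lborel. \<bar>d x\<bar> \<le> C2 * ((f x)\<^sup>2 + (h x)\<^sup>2)"
      using weighted_H1_sup_bound[OF f] weighted_H1_sup_bound[OF h]
    proof eventually_elim
      case (elim x)
      show ?case unfolding d_def C2_def
        by (rule potential_increment_bound[OF a b]) (use elim N eta_bound[of x] in \<open>auto simp: M_def\<close>)
    qed
    then have "(LINT x|lborel. \<bar>d x\<bar>) \<le> (LINT x|lborel. C2 * ((f x)\<^sup>2 + (h x)\<^sup>2))"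
      using di weighted_H1_D(7)[OF f] weighted_H1_D(7)[OF h] by (intro integral_mono_AE) auto
    also have "\<dots> = C2 * ((LINT x|lborel. (f x)\<^sup>2) + (LINT x|lborel. (h x)\<^sup>2))"
      using weighted_H1_D(7)[OF f] weighted_H1_D(7)[OF h] by simp
    also have "\<dots> \<le> C2 * n"
      unfolding n_def using C by (intro mult_left_mono add_mono L2_norm_le_H1_norm2 f h)
    finally have D: "\<bar>LINT x|lborel. d x\<bar> \<le> C2 * n"
      using integral_abs_bound[of lborel d] by linarith
    have "0 \<le> Q f + Q h" using Q_nonneg[OF f] Q_nonneg[OF h] by simp
    moreover have "Q f + Q h \<le> C1 * n"
      using Q_bound[OF f] Q_bound[OF h] by (simp add: C1_def n_def distrib_left)
    ultimately have "\<bar>2 * (E1 - E0)\<bar> \<le> C1 * n + C2 * n"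
      unfolding diff using D by linarith
    moreover have "\<bar>E1 - E0\<bar> \<le> \<bar>2 * (E1 - E0)\<bar>" unfolding abs_mult by simp
    ultimately have "\<bar>E1 - E0\<bar> \<le> C1 * n + C2 * n" by (rule order_trans[rotated])
    then show "\<bar>energy \<epsilon> \<gamma> (\<lambda>x. a * \<eta> x + f x, \<lambda>x. b * \<eta> x + h x) - energy \<epsilon> \<gamma> (\<lambda>x. a * \<eta> x, \<lambda>x. b * \<eta> x)\<bar>
         \<le> (C1 + C2) * (H1_norm2 f + H1_norm2 h)"
      unfolding E1_def[symmetric] E0_def[symmetric] n_def[symmetric] by (simp only: distrib_right)
  qed
qed

lemma critical_point_scale:
  assumes a: "a * (a\<^sup>2 + \<gamma> * b\<^sup>2 - 1) = 0" and b: "b * (\<gamma> * a\<^sup>2 + b\<^sup>2 - 1) = 0"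
  shows "critical_point (energy \<epsilon> \<gamma>) (\<lambda>x. a * \<eta> x, \<lambda>x. b * \<eta> x)"
  unfolding critical_point_def
proof (intro conjI allI impI)
  show "(\<lambda>x. a * \<eta> x, \<lambda>x. b * \<eta> x) \<in> energy_space"
    using scale_mem[of a] scale_mem[of b] by (simp add: energy_space_def)
  obtain C where C: "C \<ge> 0"
    "\<And>f h. f \<in> H1 \<inter> L21 \<Longrightarrow> h \<in> H1 \<inter> L21 \<Longrightarrow> H1_norm2 f + H1_norm2 h \<le> 1 \<Longrightarrow>
       \<bar>energy \<epsilon> \<gamma> (\<lambda>x. a * \<eta> x + f x, \<lambda>x. b * \<eta> x + h x) - energy \<epsilon> \<gamma> (\<lambda>x. a * \<eta> x, \<lambda>x. b * \<eta> x)\<bar>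
         \<le> C * (H1_norm2 f + H1_norm2 h)"
    using energy_increment_bound[OF a b] by blast
  fix e :: real assume e: "e > 0"
  \<comment> \<open>The bound 1 keeps increments in the range of the quadratic estimate, and
    \<open>C + 1\<close> avoids division by zero.\<close>
  define \<delta> where "\<delta> = min 1 (e / (C + 1))"
  have \<delta>: "\<delta> > 0" "\<delta> \<le> 1" "C * \<delta> \<le> e"
  proof -
    show "\<delta> > 0" "\<delta> \<le> 1" using C(1) e by (auto simp: \<delta>_def)
    have "C * \<delta> \<le> (C + 1) * (e / (C + 1))" using C(1) e \<open>\<delta> > 0\<close> by (intro mult_mono) (auto simp: \<delta>_def)
    then show "C * \<delta> \<le> e" using C(1) by simp
  qed
  show "\<exists>\<delta>>0. \<forall>\<Phi>\<in>energy_space. energy_norm \<Phi> < \<delta> \<longrightarrow>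
     \<bar>energy \<epsilon> \<gamma> ((\<lambda>x. a * \<eta> x, \<lambda>x. b * \<eta> x) + \<Phi>) - energy \<epsilon> \<gamma> (\<lambda>x. a * \<eta> x, \<lambda>x. b * \<eta> x)\<bar> \<le> e * energy_norm \<Phi>"
  proof (intro exI[of _ \<delta>] conjI ballI impI \<delta>(1))
    fix \<Phi> assume "\<Phi> \<in> energy_space" and small: "energy_norm \<Phi> < \<delta>"
    then obtain f h where \<Phi>: "\<Phi> = (f, h)" "f \<in> H1 \<inter> L21" "h \<in> H1 \<inter> L21"
      by (auto simp: energy_space_def)
    define n where "n = energy_norm \<Phi>"
    have n: "n = sqrt (H1_norm2 f + H1_norm2 h)" unfolding n_def \<Phi>(1) by (rule energy_norm_eq[OF \<Phi>(2,3)])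
    have n0: "n \<ge> 0" and nn: "n\<^sup>2 = H1_norm2 f + H1_norm2 h"
      unfolding n using H1_norm2_nonneg[of f] H1_norm2_nonneg[of h] by simp_all
    have n1: "n < \<delta>" using small by (simp add: n_def)
    have "n\<^sup>2 \<le> 1\<^sup>2" using n0 n1 \<delta>(2) by (intro power_mono) auto
    then have "\<bar>energy \<epsilon> \<gamma> (\<lambda>x. a * \<eta> x + f x, \<lambda>x. b * \<eta> x + h x) - energy \<epsilon> \<gamma> (\<lambda>x. a * \<eta> x, \<lambda>x. b * \<eta> x)\<bar> \<le> C * n\<^sup>2"
      using C(2)[OF \<Phi>(2,3)] nn by simp
    also have "\<dots> = (C * n) * n" by (simp add: power2_eq_square)
    also have "\<dots> \<le> (C * \<delta>) * n" using C(1) n0 n1 by (intro mult_right_mono mult_left_mono) auto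
    also have "\<dots> \<le> e * n" using \<delta>(3) n0 by (rule mult_right_mono)
    finally show "\<bar>energy \<epsilon> \<gamma> ((\<lambda>x. a * \<eta> x, \<lambda>x. b * \<eta> x) + \<Phi>) - energy \<epsilon> \<gamma> (\<lambda>x. a * \<eta> x, \<lambda>x. b * \<eta> x)\<bar> \<le> e * energy_norm \<Phi>"
      by (simp only: \<Phi>(1) n_def add_Pair plus_fun_def)
  qed
qed

lemma H1_norm2_scale: "H1_norm2 (\<lambda>x. a * \<eta> x) = a\<^sup>2 * H1_norm2 \<eta>"
proof -
  have "AE x in lborel. weak_deriv (\<lambda>x. a * \<eta> x) x = a * weak_deriv \<eta> x"
    using H1_lincomb(2)[OF weighted_H1_D(1)[OF eta] weighted_H1_D(1)[OF eta], of a 0] by simp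
  moreover note [measurable] = weighted_H1_D(5,6)[OF eta] weighted_H1_D(5,6)[OF scale_mem[of a]]
  ultimately have "H1_norm2 (\<lambda>x. a * \<eta> x) = (LINT x|lborel. a\<^sup>2 * ((weak_deriv \<eta> x)\<^sup>2 + (1 + x\<^sup>2) * (\<eta> x)\<^sup>2))"
    unfolding H1_norm2_def
    by (intro integral_cong_AE) (auto elim!: eventually_mono simp: power_mult_distrib algebra_simps)
  then show ?thesis by (simp add: H1_norm2_def)
qed

text \<open>On the plane of multiples of \<eta> the energy is \<open>potential \<gamma> 1\<close>
  times the positive number \<open>K / 2\<close>, so rising and falling directions can be sought for
  a polynomial in two real variables. Criticality in the whole space comes from the increment
  bound.\<close>

lemma saddle_point_scale:
  assumes a: "a * (a\<^sup>2 + \<gamma> * b\<^sup>2 - 1) = 0" and b: "b * (\<gamma> * a\<^sup>2 + b\<^sup>2 - 1) = 0"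
    and down: "\<And>d. d > 0 \<Longrightarrow> \<exists>s t. s\<^sup>2 + t\<^sup>2 < d \<and> potential \<gamma> 1 (a + s) (b + t) < potential \<gamma> 1 a b"
    and up: "\<And>d. d > 0 \<Longrightarrow> \<exists>s t. s\<^sup>2 + t\<^sup>2 < d \<and> potential \<gamma> 1 a b < potential \<gamma> 1 (a + s) (b + t)"
  shows "saddle_point (energy \<epsilon> \<gamma>) (\<lambda>x. a * \<eta> x, \<lambda>x. b * \<eta> x)"
  unfolding saddle_point_def
proof (intro conjI allI impI critical_point_scale a b)
  fix \<delta> :: real assume \<delta>: "\<delta> > 0"
  \<comment> \<open>The squared norm of \<open>(s \<eta>, t \<eta>)\<close> is
    \<open>s\<^sup>2 + t\<^sup>2\<close> times \<open>H1_norm2 \<eta>\<close>; the added 1 makes the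
    denominator positive.\<close>
  define d where "d = \<delta>\<^sup>2 / (H1_norm2 \<eta> + 1)"
  have d: "d > 0" using \<delta> H1_norm2_nonneg[of \<eta>] by (simp add: d_def)
  have mem: "(\<lambda>x. s * \<eta> x, \<lambda>x. t * \<eta> x) \<in> energy_space" for s t
    using scale_mem[of s] scale_mem[of t] by (simp add: energy_space_def)
  have norm: "energy_norm (\<lambda>x. s * \<eta> x, \<lambda>x. t * \<eta> x) < \<delta>" if "s\<^sup>2 + t\<^sup>2 < d" for s t
  proof -
    have "H1_norm2 (\<lambda>x. s * \<eta> x) + H1_norm2 (\<lambda>x. t * \<eta> x) = (s\<^sup>2 + t\<^sup>2) * H1_norm2 \<eta>"
      by (simp add: H1_norm2_scale distrib_right)
    also have "\<dots> \<le> (s\<^sup>2 + t\<^sup>2) * (H1_norm2 \<eta> + 1)" by (intro mult_left_mono) auto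
    also have "\<dots> < d * (H1_norm2 \<eta> + 1)"
      using that H1_norm2_nonneg[of \<eta>] by (intro mult_strict_right_mono) auto
    also have "\<dots> = \<delta>\<^sup>2" using H1_norm2_nonneg[of \<eta>] by (simp add: d_def)
    finally show ?thesis unfolding energy_norm_eq[OF scale_mem scale_mem]
      using \<delta> by (metis abs_of_pos real_sqrt_abs real_sqrt_less_iff)
  qed
  have shift: "(\<lambda>x. a * \<eta> x, \<lambda>x. b * \<eta> x) + (\<lambda>x. s * \<eta> x, \<lambda>x. t * \<eta> x)
     = (\<lambda>x. (a + s) * \<eta> x, \<lambda>x. (b + t) * \<eta> x)" for s t
    by (simp add: plus_fun_def distrib_right)
  have less: "energy \<epsilon> \<gamma> (\<lambda>x. s * \<eta> x, \<lambda>x. t * \<eta> x) < energy \<epsilon> \<gamma> (\<lambda>x. s' * \<eta> x, \<lambda>x. t' * \<eta> x)"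
    if "potential \<gamma> 1 s t < potential \<gamma> 1 s' t'" for s t s' t'
  proof -
    have "2 * energy \<epsilon> \<gamma> (\<lambda>x. s * \<eta> x, \<lambda>x. t * \<eta> x) < 2 * energy \<epsilon> \<gamma> (\<lambda>x. s' * \<eta> x, \<lambda>x. t' * \<eta> x)"
      unfolding energy_scale using that K_pos by (rule mult_strict_right_mono)
    then show ?thesis by linarith
  qed
  obtain s t where st: "s\<^sup>2 + t\<^sup>2 < d" "potential \<gamma> 1 (a + s) (b + t) < potential \<gamma> 1 a b"
    using down[OF d] by blast
  show "\<exists>\<Phi>\<in>energy_space. energy_norm \<Phi> < \<delta> \<and>
      energy \<epsilon> \<gamma> ((\<lambda>x. a * \<eta> x, \<lambda>x. b * \<eta> x) + \<Phi>) < energy \<epsilon> \<gamma> (\<lambda>x. a * \<eta> x, \<lambda>x. b * \<eta> x)"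
    by (intro bexI[OF _ mem[of s t]] conjI norm st) (unfold shift, rule less, rule st)
  obtain s t where st: "s\<^sup>2 + t\<^sup>2 < d" "potential \<gamma> 1 a b < potential \<gamma> 1 (a + s) (b + t)"
    using up[OF d] by blast
  show "\<exists>\<Phi>\<in>energy_space. energy_norm \<Phi> < \<delta> \<and>
      energy \<epsilon> \<gamma> (\<lambda>x. a * \<eta> x, \<lambda>x. b * \<eta> x) < energy \<epsilon> \<gamma> ((\<lambda>x. a * \<eta> x, \<lambda>x. b * \<eta> x) + \<Phi>)"
    by (intro bexI[OF _ mem[of s t]] conjI norm st) (unfold shift, rule less, rule st)
qed

end

section \<open>Minima and saddle directions of the quartic polynomial\<close>

lemma symmetric_coefficient:
  fixes \<gamma> :: real
  assumes "\<gamma> > 0"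
  defines "c \<equiv> (1 + \<gamma>) powr (-1/2)"
  shows "c > 0" "c\<^sup>2 = 1 / (1 + \<gamma>)" "(1 + \<gamma>) * c\<^sup>2 = 1" "potential \<gamma> 1 c c = - 1 / (1 + \<gamma>)"
proof -
  show "c > 0" using assms by simp
  have "c\<^sup>2 = (1 + \<gamma>) powr (-1)"
    using assms by (simp add: power2_eq_square flip: powr_add)
  then show 1: "c\<^sup>2 = 1 / (1 + \<gamma>)" using assms by (simp add: powr_minus_divide)
  then show 2: "(1 + \<gamma>) * c\<^sup>2 = 1" using assms by simp
  have "potential \<gamma> 1 c c = c\<^sup>2 * ((1 + \<gamma>) * c\<^sup>2 - 2)"
    by (simp add: potential_def power2_eq_square algebra_simps)
  then show "potential \<gamma> 1 c c = - 1 / (1 + \<gamma>)" unfolding 2 using 1 by simp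
qed

text \<open>In the variables s^2 + t^2 and s^2 - t^2 the quartic part is diagonal with weights (1 +
  \<gamma>)/4 and (1 - \<gamma>)/4, both positive here. The centre \<open>2 * k * y\<^sup>2\<close>
  corresponds to s^2 = t^2 = y^2 / (1 + \<gamma>).\<close>

lemma potential_ge_symmetric:
  assumes "0 < \<gamma>" "\<gamma> < 1"
  shows "- 1 / (1 + \<gamma>) * y ^ 4 \<le> potential \<gamma> y s t"
proof -
  define k where "k = 1 / (1 + \<gamma>)"
  have k: "(1 + \<gamma>) * k = 1" using assms by (simp add: k_def)
  have "0 \<le> (1 + \<gamma>) / 4 * (s\<^sup>2 + t\<^sup>2 - 2 * k * y\<^sup>2)\<^sup>2 + (1 - \<gamma>) / 4 * (s\<^sup>2 - t\<^sup>2)\<^sup>2"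
    using assms by simp
  also have "\<dots> = (1 + \<gamma>) / 4 * (s\<^sup>2 + t\<^sup>2)\<^sup>2 - ((1 + \<gamma>) * k) * (s\<^sup>2 + t\<^sup>2) * y\<^sup>2 + ((1 + \<gamma>) * k) * k * y ^ 4
      + (1 - \<gamma>) / 4 * (s\<^sup>2 - t\<^sup>2)\<^sup>2"
    by (simp add: power2_eq_square power4_eq_xxxx field_simps)
  also have "\<dots> = potential \<gamma> y s t + k * y ^ 4"
    unfolding k by (simp add: potential_def power2_eq_square field_simps)
  finally show ?thesis by (simp add: k_def)
qed

lemma potential_uncoupled: "potential \<gamma> 1 1 0 = - 1 / 2"
  by (simp add: potential_def)

text \<open>The decomposition suited to \<gamma> > 1, where both weights are positive and the
  minimum forces one component to vanish at each point.\<close>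

lemma potential_plus_quartic_eq_squares:
  "potential \<gamma> y s t - - 1 / 2 * y ^ 4 = 1 / 2 * (s\<^sup>2 + t\<^sup>2 - y\<^sup>2)\<^sup>2 + (\<gamma> - 1) * (s * t)\<^sup>2"
  by (simp add: potential_def power2_eq_square power4_eq_xxxx algebra_simps)

text \<open>Changing the occupied component raises the quartic, since 1 minimizes it for a single
  component on the positive axis. Switching on the empty component lowers it with leading
  coefficient \<open>- (1 - \<gamma>)\<close>.\<close>

lemma uncoupled_directions:
  assumes "\<gamma> < 1" "d > (0::real)"
  obtains s t where "s\<^sup>2 < d" "potential \<gamma> 1 1 0 < potential \<gamma> 1 (1 + s) 0"
    "t\<^sup>2 < d" "potential \<gamma> 1 1 t < potential \<gamma> 1 1 0"
proof -
  define s where "s = sqrt (d / 2)"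
  \<comment> \<open>Small enough for the norm and for the term with
    \<open>t\<^sup>2 * t\<^sup>2\<close> not to outweigh the descent.\<close>
  define u where "u = min d (1 - \<gamma>) / 2"
  define t where "t = sqrt u"
  have s: "s > 0" "s\<^sup>2 < d" using assms by (simp_all add: s_def)
  have u: "u > 0" "u < d" "u < 1 - \<gamma>" using assms by (auto simp: u_def min_def)
  have t: "t\<^sup>2 = u" using u by (simp add: t_def)
  have "potential \<gamma> 1 (1 + s) 0 - potential \<gamma> 1 1 0 = 1 / 2 * (s * (2 + s))\<^sup>2"
    by (simp add: potential_def power2_eq_square algebra_simps)
  moreover have "\<dots> > 0" using s by simp
  ultimately have 1: "potential \<gamma> 1 1 0 < potential \<gamma> 1 (1 + s) 0" by linarith
  have "potential \<gamma> 1 1 t = - 1 / 2 + t\<^sup>2 * (1 / 2 * t\<^sup>2 - (1 - \<gamma>))"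
    by (simp add: potential_def power2_eq_square algebra_simps)
  moreover have "t\<^sup>2 * (1 / 2 * t\<^sup>2 - (1 - \<gamma>)) < 0" unfolding t using u by (intro mult_pos_neg) auto
  ultimately have 2: "potential \<gamma> 1 1 t < potential \<gamma> 1 1 0" unfolding potential_uncoupled by linarith
  show ?thesis using that[OF s(2) 1 _ 2] u t by simp
qed

text \<open>Along the diagonal the quartic is a double well with bottom at \<open>c\<close>, so it
  rises. Making the components unequal lowers it, with leading coefficient proportional to
  \<open>- (\<gamma> - 1)\<close>.\<close>

lemma symmetric_directions:
  assumes "\<gamma> > 1" "d > (0::real)" "c > 0" "(1 + \<gamma>) * c\<^sup>2 = 1"
  obtains s where "2 * s\<^sup>2 < d" "potential \<gamma> 1 c c < potential \<gamma> 1 (c + s) (c + s)"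
    "potential \<gamma> 1 (c + s) (c - s) < potential \<gamma> 1 c c"
proof -
  \<comment> \<open>The value of \<open>s\<^sup>2\<close> at which the antidiagonal descent is used
    up: \<open>(1 + \<gamma>) * k = 4 * (\<gamma> - 1) * c\<^sup>2\<close>.\<close>
  define k where "k = 4 * (\<gamma> - 1) * c\<^sup>2 / (1 + \<gamma>)"
  define u where "u = min d k / 4"
  have k: "k > 0" using assms by (simp add: k_def)
  have u: "u > 0" "2 * u < d" "u < k" using assms k by (auto simp: u_def min_def)
  define s where "s = sqrt u"
  have s: "s > 0" "s\<^sup>2 = u" using u by (simp_all add: s_def)
  have pc: "potential \<gamma> 1 r r = (1 + \<gamma>) * (r\<^sup>2 - c\<^sup>2)\<^sup>2 - c\<^sup>2" for r
  proof -
    have "(1 + \<gamma>) * (r\<^sup>2 - c\<^sup>2)\<^sup>2 - c\<^sup>2 = (1 + \<gamma>) * r\<^sup>2 * r\<^sup>2 - 2 * ((1 + \<gamma>) * c\<^sup>2) * r\<^sup>2 + ((1 + \<gamma>) * c\<^sup>2) * c\<^sup>2 - c\<^sup>2"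
      by (simp add: power2_eq_square algebra_simps)
    then show ?thesis unfolding assms(4) by (simp add: potential_def power2_eq_square algebra_simps)
  qed
  have "0 < (1 + \<gamma>) * (s * (2 * c + s))\<^sup>2" using assms s by simp
  also have "s * (2 * c + s) = (c + s)\<^sup>2 - c\<^sup>2" by (simp add: power2_eq_square algebra_simps)
  finally have 1: "potential \<gamma> 1 c c < potential \<gamma> 1 (c + s) (c + s)" unfolding pc by simp
  have "potential \<gamma> 1 (c + s) (c - s) - potential \<gamma> 1 c c = s\<^sup>2 * ((1 + \<gamma>) * s\<^sup>2 + (6 - 2 * \<gamma>) * c\<^sup>2 - 2)"
    by (simp add: potential_def power2_eq_square algebra_simps)
  also have "\<dots> = s\<^sup>2 * ((1 + \<gamma>) * u - 4 * (\<gamma> - 1) * c\<^sup>2)"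
  proof -
    \<comment> \<open>The constant 2 is rewritten as \<open>2 * (1 + \<gamma>) * c\<^sup>2\<close>
      by the normalization of \<open>c\<close>.\<close>
    have "(1 + \<gamma>) * s\<^sup>2 + (6 - 2 * \<gamma>) * c\<^sup>2 - 2 = (1 + \<gamma>) * u - 4 * (\<gamma> - 1) * c\<^sup>2"
      using assms(4) by (simp add: s(2) algebra_simps)
    then show ?thesis by (simp only:)
  qed
  also have "\<dots> < 0"
  proof (rule mult_pos_neg)
    have "(1 + \<gamma>) * u < (1 + \<gamma>) * k" using assms u by (intro mult_strict_left_mono) auto
    then show "(1 + \<gamma>) * u - 4 * (\<gamma> - 1) * c\<^sup>2 < 0" using assms by (simp add: k_def)
  qed (use s u in simp)
  finally have 2: "potential \<gamma> 1 (c + s) (c - s) < potential \<gamma> 1 c c" by simp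
  show ?thesis using that[OF _ 1 2] u s by simp
qed

section \<open>Identification of minimizers and of positive solutions\<close>

lemma continuous_square_eq_positive:
  fixes F g :: "real \<Rightarrow> real"
  assumes F: "continuous_on UNIV F" and sq: "\<And>x. (F x)\<^sup>2 = (g x)\<^sup>2" and g: "\<And>x. g x > 0"
  shows "F = g \<or> F = - g"
proof -
  have alt: "F x = g x \<or> F x = - g x" for x using sq[of x] by (simp add: power2_eq_iff)
  have nz: "F x \<noteq> 0" for x using alt[of x] g[of x] by auto
  have "connected (F ` UNIV)" using F by (intro connected_continuous_image) auto
  then have "(\<forall>x. F x > 0) \<or> (\<forall>x. F x < 0)"
    using nz by (smt (verit, best) connectedD_interval imageE rangeI)
  then show ?thesis
  proof
    assume "\<forall>x. F x > 0"
    then have "F x = g x" for x using alt[of x] g[of x] by (metis less_asym neg_0_less_iff_less neg_less_0_iff_less)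
    then show ?thesis by auto
  next
    assume "\<forall>x. F x < 0"
    then have "F x = - g x" for x using alt[of x] g[of x] by (metis less_asym)
    then show ?thesis by (auto simp: fun_eq_iff)
  qed
qed

text \<open>Almost everywhere one component is zero and the other is \<eta> up to sign, but which
  one could depend on the point. Continuous representatives exclude this: their zero sets are
  closed, cover the line, and are disjoint because \<eta> > 0, so one of them is empty. The signs
  remain because the energy is even in each component.\<close>

lemma (in ground_state) uncoupled_minimizers:
  assumes \<gamma>: "\<gamma> > 1" and min: "global_minimizer (energy \<epsilon> \<gamma>) (f, h)"
  shows "ae_eq (f, h) (\<eta>, 0) \<or> ae_eq (f, h) (- \<eta>, 0) \<or> ae_eq (f, h) (0, \<eta>) \<or> ae_eq (f, h) (0, - \<eta>)"
proof -
  have f: "f \<in> H1 \<inter> L21" and h: "h \<in> H1 \<inter> L21"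
    using min by (auto simp: global_minimizer_def energy_space_def)
  have le: "- 1 / 2 * y ^ 4 \<le> potential \<gamma> y s t" for y s t
  proof -
    have "0 \<le> 1 / 2 * (s\<^sup>2 + t\<^sup>2 - y\<^sup>2)\<^sup>2 + (\<gamma> - 1) * (s * t)\<^sup>2" using \<gamma> by simp
    then show ?thesis unfolding potential_plus_quartic_eq_squares[symmetric] by simp
  qed
  have "(\<lambda>x. 1 * \<eta> x, \<lambda>x. 0 * \<eta> x) \<in> energy_space"
    using scale_mem[of 1] scale_mem[of 0] by (simp add: energy_space_def)
  then have "energy \<epsilon> \<gamma> (f, h) \<le> energy \<epsilon> \<gamma> (\<lambda>x. 1 * \<eta> x, \<lambda>x. 0 * \<eta> x)"
    using min unfolding global_minimizer_def by blast
  then have "2 * energy \<epsilon> \<gamma> (f, h) \<le> 2 * energy \<epsilon> \<gamma> (\<lambda>x. 1 * \<eta> x, \<lambda>x. 0 * \<eta> x)"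
    by (rule mult_left_mono) simp
  also have "\<dots> = - 1 / 2 * K" unfolding energy_scale potential_uncoupled ..
  finally have "AE x in lborel. potential \<gamma> (\<eta> x) (f x) (h x) = - 1 / 2 * (\<eta> x) ^ 4"
    by (rule minimizer_AE[OF f h le])
  then have AE0: "AE x in lborel. (f x)\<^sup>2 + (h x)\<^sup>2 = (\<eta> x)\<^sup>2 \<and> f x * h x = 0"
  proof eventually_elim
    case (elim x)
    have "1 / 2 * ((f x)\<^sup>2 + (h x)\<^sup>2 - (\<eta> x)\<^sup>2)\<^sup>2 + (\<gamma> - 1) * (f x * h x)\<^sup>2 = 0"
      unfolding potential_plus_quartic_eq_squares[symmetric] using elim by simp
    moreover have "0 \<le> 1 / 2 * ((f x)\<^sup>2 + (h x)\<^sup>2 - (\<eta> x)\<^sup>2)\<^sup>2" "0 \<le> (\<gamma> - 1) * (f x * h x)\<^sup>2"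
      using \<gamma> by simp_all
    ultimately have "1 / 2 * ((f x)\<^sup>2 + (h x)\<^sup>2 - (\<eta> x)\<^sup>2)\<^sup>2 = 0" "(\<gamma> - 1) * (f x * h x)\<^sup>2 = 0" by linarith+
    then show ?case using \<gamma> by simp
  qed
  obtain F where F: "ac_deriv F (weak_deriv f)" "AE x in lborel. f x = F x"
    using H1_ac_representative weighted_H1_D(1)[OF f] by blast
  obtain H where H: "ac_deriv H (weak_deriv h)" "AE x in lborel. h x = H x"
    using H1_ac_representative weighted_H1_D(1)[OF h] by blast
  note c = ac_deriv_continuous[OF F(1)] ac_deriv_continuous[OF H(1)]
  have "(\<lambda>x. (F x)\<^sup>2 + (H x)\<^sup>2) = (\<lambda>x. (\<eta> x)\<^sup>2)"
  proof (rule continuous_AE_eq)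
    show "AE x in lborel. (F x)\<^sup>2 + (H x)\<^sup>2 = (\<eta> x)\<^sup>2"
      using AE0 F(2) H(2) by eventually_elim simp
  qed (intro continuous_intros c eta_D(4))+
  then have sum: "(F x)\<^sup>2 + (H x)\<^sup>2 = (\<eta> x)\<^sup>2" for x by meson
  have "(\<lambda>x. F x * H x) = (\<lambda>x. 0)"
  proof (rule continuous_AE_eq)
    show "AE x in lborel. F x * H x = 0"
      using AE0 F(2) H(2) by eventually_elim simp
  qed (intro continuous_intros c)+
  then have "F x * H x = 0" for x by meson
  then have prod: "F x = 0 \<or> H x = 0" for x by simp
  have "(\<forall>x. F x = 0) \<or> (\<forall>x. H x = 0)"
  proof -
    have "closed {x. F x = 0}" "closed {x. H x = 0}"
      using c by (auto intro!: closed_Collect_eq)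
    moreover have "{x. F x = 0} \<inter> {x. H x = 0} = {}"
    proof -
      have False if "F x = 0" "H x = 0" for x
        using sum[of x] eta_D(3)[of x] that by simp
      then show ?thesis by blast
    qed
    moreover have "UNIV \<subseteq> {x. F x = 0} \<union> {x. H x = 0}" using prod by auto
    ultimately have "{x. F x = 0} = {} \<or> {x. H x = 0} = {}"
      using connected_closedD[OF connected_UNIV, of "{x. F x = 0}" "{x. H x = 0}"] by auto
    then show ?thesis using prod by blast
  qed
  then show ?thesis
  proof
    assume z: "\<forall>x. F x = 0"
    have "H = \<eta> \<or> H = - \<eta>"
      using sum z by (intro continuous_square_eq_positive c eta_D(3)) simp
    moreover have "AE x in lborel. f x = 0 \<and> h x = H x" using F(2) H(2) by eventually_elim (use z in simp)
    then have "ae_eq (f, h) (0, H)" by simp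
    ultimately show ?thesis by metis
  next
    assume z: "\<forall>x. H x = 0"
    have "F = \<eta> \<or> F = - \<eta>"
      using sum z by (intro continuous_square_eq_positive c eta_D(3)) simp
    moreover have "AE x in lborel. f x = F x \<and> h x = 0" using F(2) H(2) by eventually_elim (use z in simp)
    then have "ae_eq (f, h) (F, 0)" by simp
    ultimately show ?thesis by metis
  qed
qed

text \<open>Since \<open>(1 + \<gamma>) * e\<^sup>2 = \<eta>\<^sup>2\<close>, the potential in the
  equation of \<open>e\<close> is that of \<eta>, which settles existence. The upper bound on
  \<open>e\<close> for the comparison comes from the sup bound on \<eta>.\<close>

lemma (in ground_state) unique_positive_solution:
  assumes \<gamma>: "0 < \<gamma>" "\<gamma> < 1"
  shows "coupled_solution \<epsilon> \<gamma> \<Psi> \<and> positive_state \<Psi> \<longleftrightarrow> \<Psi> = symmetric_state \<gamma> \<eta>"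
proof -
  define c where "c = (1 + \<gamma>) powr (-1/2)"
  note c = symmetric_coefficient[OF \<gamma>(1), folded c_def]
  define e where "e x = c * \<eta> x" for x
  have e2: "(1 + \<gamma>) * (e x)\<^sup>2 = (\<eta> x)\<^sup>2" for x
    using c(3) by (simp add: e_def power_mult_distrib flip: mult.assoc)
  have e: "positive_solution (\<lambda>x. (x\<^sup>2 - 1 + (1 + \<gamma>) * (e x)\<^sup>2) / \<epsilon>\<^sup>2) e"
    using positive_solution_scale[OF positive_solution_eta c(1)] unfolding e2
    by (simp add: V_def[abs_def] e_def[abs_def])
  have s: "symmetric_state \<gamma> \<eta> = (e, e)" by (simp add: symmetric_state_def c_def e_def[abs_def])
  have e': "(\<lambda>x. (x\<^sup>2 - 1 + (e x)\<^sup>2 + \<gamma> * (e x)\<^sup>2) / \<epsilon>\<^sup>2) = (\<lambda>x. (x\<^sup>2 - 1 + (1 + \<gamma>) * (e x)\<^sup>2) / \<epsilon>\<^sup>2)"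
    "(\<lambda>x. (x\<^sup>2 - 1 + \<gamma> * (e x)\<^sup>2 + (e x)\<^sup>2) / \<epsilon>\<^sup>2) = (\<lambda>x. (x\<^sup>2 - 1 + (1 + \<gamma>) * (e x)\<^sup>2) / \<epsilon>\<^sup>2)"
    by (simp_all add: algebra_simps)
  have M: "(e x)\<^sup>2 \<le> c\<^sup>2 * (2 * H1_norm2 \<eta>)" for x
    using mult_left_mono[OF eta_bound[of x], of "c\<^sup>2"] by (simp add: e_def power_mult_distrib)
  obtain \<psi>1 \<psi>2 where \<Psi>: "\<Psi> = (\<psi>1, \<psi>2)" by (cases \<Psi>)
  show ?thesis
    unfolding \<Psi> s coupled_solution_iff_positive_solution[OF eps]
  proof
    assume "positive_solution (\<lambda>x. (x\<^sup>2 - 1 + (\<psi>1 x)\<^sup>2 + \<gamma> * (\<psi>2 x)\<^sup>2) / \<epsilon>\<^sup>2) \<psi>1 \<and>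
      positive_solution (\<lambda>x. (x\<^sup>2 - 1 + \<gamma> * (\<psi>1 x)\<^sup>2 + (\<psi>2 x)\<^sup>2) / \<epsilon>\<^sup>2) \<psi>2"
    then have "\<psi>1 x = e x \<and> \<psi>2 x = e x" for x
      using coupled_comparison[OF eps \<gamma> _ _ e M] by blast
    then show "(\<psi>1, \<psi>2) = (e, e)" by auto
  next
    assume "(\<psi>1, \<psi>2) = (e, e)"
    then show "positive_solution (\<lambda>x. (x\<^sup>2 - 1 + (\<psi>1 x)\<^sup>2 + \<gamma> * (\<psi>2 x)\<^sup>2) / \<epsilon>\<^sup>2) \<psi>1 \<and>
      positive_solution (\<lambda>x. (x\<^sup>2 - 1 + \<gamma> * (\<psi>1 x)\<^sup>2 + (\<psi>2 x)\<^sup>2) / \<epsilon>\<^sup>2) \<psi>2"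
      using e by (simp add: e')
  qed
qed

theorem theorem2:
  fixes \<epsilon> \<gamma> :: real and \<eta> :: "real \<Rightarrow> real"
  assumes "\<epsilon> > 0" and "is_ground_state \<epsilon> \<eta>"
  shows "(\<gamma> \<in> {0<..<1} \<longrightarrow> global_minimizer (energy \<epsilon> \<gamma>) (symmetric_state \<gamma> \<eta>)) \<and>
    (\<gamma> \<in> {1<..} \<longrightarrow> saddle_point (energy \<epsilon> \<gamma>) (symmetric_state \<gamma> \<eta>)) \<and>
    (\<gamma> \<in> {0<..<1} \<longrightarrow>
       (\<forall>\<Psi>. coupled_solution \<epsilon> \<gamma> \<Psi> \<and> positive_state \<Psi> \<longleftrightarrow> \<Psi> = symmetric_state \<gamma> \<eta>)) \<and>
    (\<gamma> \<in> {0<..<1} \<longrightarrow>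
       saddle_point (energy \<epsilon> \<gamma>) (\<eta>, 0) \<and> saddle_point (energy \<epsilon> \<gamma>) (0, \<eta>)) \<and>
    (\<gamma> \<in> {1<..} \<longrightarrow>
       global_minimizer (energy \<epsilon> \<gamma>) (\<eta>, 0) \<and> global_minimizer (energy \<epsilon> \<gamma>) (0, \<eta>) \<and>
       (\<forall>\<Psi>. global_minimizer (energy \<epsilon> \<gamma>) \<Psi> \<longrightarrow>
          ae_eq \<Psi> (\<eta>, 0) \<or> ae_eq \<Psi> (- \<eta>, 0) \<or> ae_eq \<Psi> (0, \<eta>) \<or> ae_eq \<Psi> (0, - \<eta>)))"
proof -
  interpret ground_state \<epsilon> \<eta> using assms by unfold_locales
  define c where "c = (1 + \<gamma>) powr (-1/2)"
  have sym: "symmetric_state \<gamma> \<eta> = (\<lambda>x. c * \<eta> x, \<lambda>x. c * \<eta> x)"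
    by (simp add: symmetric_state_def c_def)
  \<comment> \<open>With coefficients 1 and 0 the uncoupled states become multiples of \<eta>, so
    the same scaling lemmas serve them and the symmetric state.\<close>
  have unc: "(\<eta>, 0) = (\<lambda>x. 1 * \<eta> x, \<lambda>x. 0 * \<eta> x)" "(0, \<eta>) = (\<lambda>x. 0 * \<eta> x, \<lambda>x. 1 * \<eta> x)"
    by (simp_all add: zero_fun_def)
  show ?thesis
  proof (intro conjI impI allI)
    assume "\<gamma> \<in> {0<..<1}"
    then have \<gamma>: "0 < \<gamma>" "\<gamma> < 1" by auto
    show "global_minimizer (energy \<epsilon> \<gamma>) (symmetric_state \<gamma> \<eta>)"
      unfolding sym using potential_ge_symmetric[OF \<gamma>] symmetric_coefficient(4)[OF \<gamma>(1), folded c_def]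
      by (intro global_minimizer_scale) simp
    show "coupled_solution \<epsilon> \<gamma> \<Psi> \<and> positive_state \<Psi> \<longleftrightarrow> \<Psi> = symmetric_state \<gamma> \<eta>" for \<Psi>
      by (rule unique_positive_solution[OF \<gamma>])
    show "saddle_point (energy \<epsilon> \<gamma>) (\<eta>, 0)" unfolding unc
    proof (rule saddle_point_scale)
      fix d :: real assume "d > 0"
      then obtain s t where st: "s\<^sup>2 < d" "potential \<gamma> 1 1 0 < potential \<gamma> 1 (1 + s) 0"
        "t\<^sup>2 < d" "potential \<gamma> 1 1 t < potential \<gamma> 1 1 0"
        using uncoupled_directions[OF \<gamma>(2)] by blast
      show "\<exists>s t. s\<^sup>2 + t\<^sup>2 < d \<and> potential \<gamma> 1 (1 + s) (0 + t) < potential \<gamma> 1 1 0"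
        using st by (intro exI[of _ 0] exI[of _ t]) simp
      show "\<exists>s t. s\<^sup>2 + t\<^sup>2 < d \<and> potential \<gamma> 1 1 0 < potential \<gamma> 1 (1 + s) (0 + t)"
        using st by (intro exI[of _ s] exI[of _ 0]) simp
    qed simp_all
    show "saddle_point (energy \<epsilon> \<gamma>) (0, \<eta>)" unfolding unc
    proof (rule saddle_point_scale)
      fix d :: real assume "d > 0"
      then obtain s t where st: "s\<^sup>2 < d" "potential \<gamma> 1 0 1 < potential \<gamma> 1 0 (1 + s)"
        "t\<^sup>2 < d" "potential \<gamma> 1 t 1 < potential \<gamma> 1 0 1"
        using uncoupled_directions[OF \<gamma>(2)] potential_commute by metis
      show "\<exists>s t. s\<^sup>2 + t\<^sup>2 < d \<and> potential \<gamma> 1 (0 + s) (1 + t) < potential \<gamma> 1 0 1"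
        using st by (intro exI[of _ t] exI[of _ 0]) simp
      show "\<exists>s t. s\<^sup>2 + t\<^sup>2 < d \<and> potential \<gamma> 1 0 1 < potential \<gamma> 1 (0 + s) (1 + t)"
        using st by (intro exI[of _ 0] exI[of _ s]) simp
    qed simp_all
  next
    assume "\<gamma> \<in> {1<..}"
    then have \<gamma>: "\<gamma> > 1" by simp
    then have c: "c > 0" "(1 + \<gamma>) * c\<^sup>2 = 1" using symmetric_coefficient[of \<gamma>, folded c_def] by auto
    show "saddle_point (energy \<epsilon> \<gamma>) (symmetric_state \<gamma> \<eta>)" unfolding sym
    proof (rule saddle_point_scale)
      fix d :: real assume "d > 0"
      then obtain s where s: "2 * s\<^sup>2 < d" "potential \<gamma> 1 c c < potential \<gamma> 1 (c + s) (c + s)"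
        "potential \<gamma> 1 (c + s) (c - s) < potential \<gamma> 1 c c"
        using symmetric_directions[OF \<gamma> _ c] by blast
      show "\<exists>s t. s\<^sup>2 + t\<^sup>2 < d \<and> potential \<gamma> 1 (c + s) (c + t) < potential \<gamma> 1 c c"
        using s by (intro exI[of _ s] exI[of _ "- s"]) simp
      show "\<exists>s t. s\<^sup>2 + t\<^sup>2 < d \<and> potential \<gamma> 1 c c < potential \<gamma> 1 (c + s) (c + t)"
        using s by (intro exI[of _ s]) simp
    qed (use c(2) in \<open>simp_all add: algebra_simps\<close>)
    have le: "- 1 / 2 * y ^ 4 \<le> potential \<gamma> y s t" for y s t
    proof -
      have "0 \<le> 1 / 2 * (s\<^sup>2 + t\<^sup>2 - y\<^sup>2)\<^sup>2 + (\<gamma> - 1) * (s * t)\<^sup>2" using \<gamma> by simp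
      then show ?thesis unfolding potential_plus_quartic_eq_squares[symmetric] by simp
    qed
    show "global_minimizer (energy \<epsilon> \<gamma>) (\<eta>, 0)" unfolding unc
      by (rule global_minimizer_scale) (use le in \<open>simp add: potential_uncoupled\<close>)
    show "global_minimizer (energy \<epsilon> \<gamma>) (0, \<eta>)" unfolding unc
      by (rule global_minimizer_scale) (use le in \<open>simp add: potential_uncoupled potential_commute[of \<gamma> 1 0]\<close>)
    show "ae_eq \<Psi> (\<eta>, 0) \<or> ae_eq \<Psi> (- \<eta>, 0) \<or> ae_eq \<Psi> (0, \<eta>) \<or> ae_eq \<Psi> (0, - \<eta>)"
      if "global_minimizer (energy \<epsilon> \<gamma>) \<Psi>" for \<Psi>
      using uncoupled_minimizers[OF \<gamma>] that by (cases \<Psi>) simp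
  qed
qed

end
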